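(* Let $K$ be a global field with ring of integers $\mathcal{O}_K$, and let $P(x)\in\mathcal{O}_K[x]$ be a polynomial. The following are equivalent: (i) $P$ is good for irrational equidistribution; (ii) for any measure-preserving system $(X,\mu,(T_n)_{n\in\mathcal{O}_K})$ that is ergodic along ideals and any $f\in L^2(\mu)$, $$\mathrm{UC\text{-}lim}_{n\in\mathcal{O}_K}\,T_{P(n)}f=\int_X f\,d\mu$$ in $L^2(\mu)$.
   Context: A global field $K$ is either a finite extension of $\mathbb{Q}$ (number field) or a finite extension of $\mathbb{F}_q(t)$ for a finite field $\mathbb{F}_q$ (global function field). Its ring of integers $\mathcal{O}_K$ is the integral closure in $K$ of $\mathbb{Z}$, respectively of $\mathbb{F}_q[t]$. A measure-preserving system $(X,\mu,(T_n)_{n\in\mathcal{O}_K})$ is a standard probability space $(X,\mu)$ with an action $(T_n)$ of $(\mathcal{O}_K,+)$ by measure-preserving transformations; $T_nf=f\circ T_n$ for $f\in L^2(\mu)$. The system is ergodic along ideals if for every nonzero ideal $I\le\mathcal{O}_K$ (including $I=\mathcal{O}_K$) every measurable set invariant under all $T_n$, $n\in I$, has measure $0$ or $1$. A character $\chi:(\mathcal{O}_K,+)\to S^1$ is rational if there is $m\in\mathcal{O}_K\setminus\{0\}$ with $\chi(mn+r)=\chi(r)$ for all $n,r\in\mathcal{O}_K$, and irrational otherwise. $P(x)\in\mathcal{O}_K[x]$ is good for irrational equidistribution if for every irrational character $\chi$ one has $\mathrm{UC\text{-}lim}_{n\in\mathcal{O}_K}\chi(P(n))=0$. A Følner sequence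 in $(\mathcal{O}_K,+)$ is a sequence of finite (nonempty) sets $\Phi_N\subseteq\mathcal{O}_K$ with $|\Phi_N\triangle(\Phi_N+n)|/|\Phi_N|\to0$ for every $n\in\mathcal{O}_K$. $\mathrm{UC\text{-}lim}_{n\in\mathcal{O}_K}x_n=x$ means $\frac1{|\Phi_N|}\sum_{n\in\Phi_N}x_n\to x$ for every Følner sequence $(\Phi_N)$. *)

theory Defs
  imports "HOL-Probability.Probability" "HOL-Computational_Algebra.Polynomial"
begin

section \<open>Global fields and their rings of integers\<close>

text \<open>
  The global field \<open>K\<close> is a type \<open>'k\<close> of class \<open>field\<close>; its subfields and subrings are
  subsets of that type.
\<close>

definition finite_subfield :: "'k::field set \<Rightarrow> bool" where
  "finite_subfield F \<longleftrightarrow> finite F \<and> 0 \<in> F \<and> 1 \<in> F \<and>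
     (\<forall>a\<in>F. \<forall>b\<in>F. a - b \<in> F \<and> a * b \<in> F) \<and> (\<forall>a\<in>F. inverse a \<in> F)"

definition polys_over :: "'k::field set \<Rightarrow> 'k poly set" where
  "polys_over R = {p. \<forall>i. coeff p i \<in> R}"

definition transcendental_over :: "'k::field set \<Rightarrow> 'k \<Rightarrow> bool" where
  "transcendental_over F t \<longleftrightarrow> (\<forall>p \<in> polys_over F. poly p t = 0 \<longrightarrow> p = 0)"

definition adjoin_ring :: "'k::field set \<Rightarrow> 'k \<Rightarrow> 'k set" where
  "adjoin_ring F t = {poly p t | p. p \<in> polys_over F}"

definition fractions :: "'k::field set \<Rightarrow> 'k set" where
  "fractions R = {a / b | a b. a \<in> R \<and> b \<in> R \<and> b \<noteq> 0}"

text \<open>The whole field is a finite-dimensional vector space over its subfield \<open>L\<close>.\<close>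

definition finite_extension_of :: "'k::field set \<Rightarrow> bool" where
  "finite_extension_of L \<longleftrightarrow>
     (\<exists>B. finite B \<and> (\<forall>x. \<exists>c. (\<forall>b\<in>B. c b \<in> L) \<and> x = (\<Sum>b\<in>B. c b * b)))"

definition integral_closure :: "'k::field set \<Rightarrow> 'k set" where
  "integral_closure R = {x. \<exists>p \<in> polys_over R. lead_coeff p = 1 \<and> poly p x = 0}"

text \<open>In characteristic 0, \<open>fractions \<int>\<close> is the prime field \<open>\<rat>\<close>.\<close>

definition number_field_integers :: "'k::field set \<Rightarrow> bool" where
  "number_field_integers OK \<longleftrightarrow>
     CHAR('k) = 0 \<and> finite_extension_of (fractions (\<int> :: 'k set)) \<and> OK = integral_closure \<int>"

text \<open>
  Here \<open>F\<close> and \<open>t\<close> are the images in \<open>K\<close> of the constants and of the variable of the rational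
  function field; the ring of integers depends on this choice.
\<close>

definition function_field_integers :: "'k::field set \<Rightarrow> bool" where
  "function_field_integers OK \<longleftrightarrow>
     (\<exists>F t. finite_subfield F \<and> transcendental_over F t \<and>
        finite_extension_of (fractions (adjoin_ring F t)) \<and>
        OK = integral_closure (adjoin_ring F t))"

definition global_field_integers :: "'k::field set \<Rightarrow> bool" where
  "global_field_integers OK \<longleftrightarrow> number_field_integers OK \<or> function_field_integers OK"

definition ideal_of :: "'k::field set \<Rightarrow> 'k set \<Rightarrow> bool" where
  "ideal_of OK I \<longleftrightarrow> I \<subseteq> OK \<and> 0 \<in> I \<and>
     (\<forall>a\<in>I. \<forall>b\<in>I. a + b \<in> I) \<and> (\<forall>r\<in>OK. \<forall>a\<in>I. r * a \<in> I)"


section \<open>Uniform Cesaro limits\<close>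

definition folner :: "'k::field set \<Rightarrow> (nat \<Rightarrow> 'k set) \<Rightarrow> bool" where
  "folner OK \<Phi> \<longleftrightarrow>
     (\<forall>N. finite (\<Phi> N) \<and> \<Phi> N \<noteq> {} \<and> \<Phi> N \<subseteq> OK) \<and>
     (\<forall>n\<in>OK. (\<lambda>N. real (card (sym_diff (\<Phi> N) ((\<lambda>x. x + n) ` \<Phi> N))) / real (card (\<Phi> N)))
        \<longlonglongrightarrow> 0)"

definition average :: "'k set \<Rightarrow> ('k \<Rightarrow> complex) \<Rightarrow> complex" where
  "average A u = (\<Sum>n\<in>A. u n) / of_nat (card A)"

definition UC_lim :: "'k::field set \<Rightarrow> ('k \<Rightarrow> complex) \<Rightarrow> complex \<Rightarrow> bool" where
  "UC_lim OK u l \<longleftrightarrow> (\<forall>\<Phi>. folner OK \<Phi> \<longrightarrow> (\<lambda>N. average (\<Phi> N) u) \<longlonglongrightarrow> l)"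

definition L2 :: "'x measure \<Rightarrow> ('x \<Rightarrow> complex) \<Rightarrow> bool" where
  "L2 M f \<longleftrightarrow> f \<in> borel_measurable M \<and> integrable M (\<lambda>x. (norm (f x))\<^sup>2)"

text \<open>Uniform Cesaro convergence in \<open>L\<^sup>2\<close>, expressed by the square of the \<open>L\<^sup>2\<close> distance.\<close>

definition UC_lim_L2 ::
    "'x measure \<Rightarrow> 'k::field set \<Rightarrow> ('k \<Rightarrow> 'x \<Rightarrow> complex) \<Rightarrow> ('x \<Rightarrow> complex) \<Rightarrow> bool" where
  "UC_lim_L2 M OK u g \<longleftrightarrow> (\<forall>\<Phi>. folner OK \<Phi> \<longrightarrow>
     (\<lambda>N. \<integral>\<^sup>+x. ennreal ((norm (average (\<Phi> N) (\<lambda>n. u n x) - g x))\<^sup>2) \<partial>M) \<longlonglongrightarrow> 0)"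


section \<open>Characters\<close>

definition add_character :: "'k::field set \<Rightarrow> ('k \<Rightarrow> complex) \<Rightarrow> bool" where
  "add_character OK \<psi> \<longleftrightarrow>
     (\<forall>n\<in>OK. norm (\<psi> n) = 1) \<and> (\<forall>m\<in>OK. \<forall>n\<in>OK. \<psi> (m + n) = \<psi> m * \<psi> n)"

definition rational_character :: "'k::field set \<Rightarrow> ('k \<Rightarrow> complex) \<Rightarrow> bool" where
  "rational_character OK \<psi> \<longleftrightarrow> add_character OK \<psi> \<and>
     (\<exists>m \<in> OK - {0}. \<forall>n\<in>OK. \<forall>r\<in>OK. \<psi> (m * n + r) = \<psi> r)"

definition irrational_character :: "'k::field set \<Rightarrow> ('k \<Rightarrow> complex) \<Rightarrow> bool" where
  "irrational_character OK \<psi> \<longleftrightarrow> add_character OK \<psi> \<and> \<not> rational_character OK \<psi>"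

definition good_for_irrational_equidistribution :: "'k::field set \<Rightarrow> 'k poly \<Rightarrow> bool" where
  "good_for_irrational_equidistribution OK P \<longleftrightarrow>
     (\<forall>\<psi>. irrational_character OK \<psi> \<longrightarrow> UC_lim OK (\<lambda>n. \<psi> (poly P n)) 0)"


section \<open>Measure-preserving systems\<close>

text \<open>
  A standard probability space is a Borel probability space whose \<open>\<sigma>\<close>-algebra is generated
  by some Polish topology on the underlying set.
\<close>

definition standard_prob_space :: "'x measure \<Rightarrow> bool" where
  "standard_prob_space M \<longleftrightarrow> prob_space M \<and>
     (\<exists>\<tau>. completely_metrizable_space \<tau> \<and> second_countable \<tau> \<and> topspace \<tau> = space M \<and>
        sets M = sigma_sets (space M) {U. openin \<tau> U})"

definition measure_preserving_system ::
    "'k::field set \<Rightarrow> 'x measure \<Rightarrow> ('k \<Rightarrow> 'x \<Rightarrow> 'x) \<Rightarrow> bool" where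
  "measure_preserving_system OK M T \<longleftrightarrow> standard_prob_space M \<and>
     (\<forall>n\<in>OK. T n \<in> measurable M M \<and> distr M M (T n) = M) \<and>
     (\<forall>x\<in>space M. T 0 x = x) \<and>
     (\<forall>m\<in>OK. \<forall>n\<in>OK. \<forall>x\<in>space M. T (m + n) x = T m (T n x))"

definition ergodic_along_ideals ::
    "'k::field set \<Rightarrow> 'x measure \<Rightarrow> ('k \<Rightarrow> 'x \<Rightarrow> 'x) \<Rightarrow> bool" where
  "ergodic_along_ideals OK M T \<longleftrightarrow>
     (\<forall>I. ideal_of OK I \<and> I \<noteq> {0} \<longrightarrow>
        (\<forall>A\<in>sets M. (\<forall>n\<in>I. T n -` A \<inter> space M = A) \<longrightarrow> measure M A = 0 \<or> measure M A = 1))"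

text \<open>
  The systems here have their points in the type \<open>'x\<close>, since a formula cannot quantify over
  types. Every standard Borel space is isomorphic to one on a set of reals, so the instance
  \<open>TYPE(real)\<close> covers all systems up to isomorphism, whereas a small type such as \<open>unit\<close>
  does not.
\<close>

definition ergodic_averages_converge ::
    "'x itself \<Rightarrow> 'k::field set \<Rightarrow> 'k poly \<Rightarrow> bool" where
  "ergodic_averages_converge _ OK P \<longleftrightarrow>
     (\<forall>(M :: 'x measure) T f.
        measure_preserving_system OK M T \<and> ergodic_along_ideals OK M T \<and> L2 M f \<longrightarrow>
        UC_lim_L2 M OK (\<lambda>n x. f (T (poly P n) x)) (\<lambda>x. \<integral>y. f y \<partial>M))"

end

theory Submission
  imports Defs "Jordan_Normal_Form.Char_Poly"
begin

text \<open>
  The square of the \<open>L\<^sup>2\<close> norm of an average of \<open>T\<^bsub>P(n)\<^esub> f\<close> is the integral, against the spectral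
  measure of \<open>f\<close> on the dual group of \<open>\<O>\<^sub>K\<close>, of the squared modulus of the average of \<open>\<chi>(P(n))\<close>.
  If \<open>f\<close> has mean \<open>0\<close>, ergodicity along the ideal \<open>m \<O>\<^sub>K\<close> makes the set of characters that are
  trivial on \<open>m \<O>\<^sub>K\<close> a null set; as \<open>\<O>\<^sub>K\<close> is countable, almost every character is irrational, and
  dominated convergence applies. Conversely, an irrational character \<open>\<chi>\<close> defines the rotation by
  \<open>\<chi>(n)\<close> on the circle (characteristic \<open>0\<close>) or on the group of \<open>p\<close>-th roots of unity
  (characteristic \<open>p\<close>), which is ergodic along ideals and has the identity as an eigenfunction.

  The spectral measure is constructed as a measure on the real line: a space-filling curve turns the
  characters of a countable group into images of real parameters, and Helly's selection theorem
  provides a weak limit of Fejer approximations.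
\<close>

section \<open>Integral closures\<close>

text \<open>What number fields and function fields contribute is one fact: the ring of integers is a
  countable subring of K. The dual group never appears as a space. A real parameter t and functions
  \<open>X a t\<close> of modulus 1 stand in for it, multiplicative only almost everywhere; the
  relations of the group are recovered from integrals, because a function of modulus 1 with integral
  1 equals 1 almost everywhere. The obstacle in the forward direction is that ergodicity speaks
  about invariant sets while the spectral side knows only L2 norms; the bridge is an L2 limit of
  averages, which is invariant merely up to null sets. The converse needs two rotations because in
  characteristic p every character takes values in the p-th roots of unity: on the whole circle the
  action would factor through a finite group and could not be ergodic. In characteristic 0 an
  irrational character takes infinitely many values on each nonzero ideal, which yields arbitrarily
  small rotations. Both systems are modelled on subsets of [0,1), so that their points are real
  numbers.\<close>

definition is_subring :: "'k::field set \<Rightarrow> bool" where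
  "is_subring R \<longleftrightarrow> 1 \<in> R \<and> (\<forall>a\<in>R. \<forall>b\<in>R. a - b \<in> R \<and> a * b \<in> R)"

lemma
  assumes "is_subring R"
  shows subring_1: "1 \<in> R"
    and subring_diff: "\<And>a b. a \<in> R \<Longrightarrow> b \<in> R \<Longrightarrow> a - b \<in> R"
    and subring_mult: "\<And>a b. a \<in> R \<Longrightarrow> b \<in> R \<Longrightarrow> a * b \<in> R"
    and subring_0: "0 \<in> R"
    and subring_uminus: "\<And>a. a \<in> R \<Longrightarrow> - a \<in> R"
    and subring_add: "\<And>a b. a \<in> R \<Longrightarrow> b \<in> R \<Longrightarrow> a + b \<in> R"
proof -
  show 1: "1 \<in> R" and d: "\<And>a b. a \<in> R \<Longrightarrow> b \<in> R \<Longrightarrow> a - b \<in> R"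
    and "\<And>a b. a \<in> R \<Longrightarrow> b \<in> R \<Longrightarrow> a * b \<in> R"
    using assms by (auto simp: is_subring_def)
  show 0: "0 \<in> R" using d[OF 1 1] by simp
  show u: "- a \<in> R" if "a \<in> R" for a using d[OF 0 that] by simp
  show "a + b \<in> R" if "a \<in> R" "b \<in> R" for a b using d[OF that(1) u[OF that(2)]] by simp
qed

lemma subring_sum:
  assumes "is_subring R" "\<And>i. i \<in> I \<Longrightarrow> f i \<in> R"
  shows "sum f I \<in> R"
  using assms(2) by (induction I rule: infinite_finite_induct)
    (auto intro: subring_0[OF assms(1)] subring_add[OF assms(1)])

lemma subring_power: "is_subring R \<Longrightarrow> a \<in> R \<Longrightarrow> a ^ n \<in> R"
  by (induction n) (auto intro: subring_1 subring_mult)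

lemma subring_of_nat: "is_subring R \<Longrightarrow> of_nat n \<in> R"
  by (induction n) (auto intro: subring_0 subring_1 subring_add)

lemma poly_in_subring:
  assumes "is_subring R" "p \<in> polys_over R" "x \<in> R"
  shows "poly p x \<in> R"
  using assms unfolding poly_altdef polys_over_def
  by (auto intro!: subring_sum subring_mult subring_power)

lemma polys_over_0: "is_subring R \<Longrightarrow> 0 \<in> polys_over R"
  and polys_over_1: "is_subring R \<Longrightarrow> 1 \<in> polys_over R"
  by (auto simp: polys_over_def coeff_1 subring_0 subring_1)

lemma polys_over_add: "is_subring R \<Longrightarrow> p \<in> polys_over R \<Longrightarrow> q \<in> polys_over R \<Longrightarrow> p + q \<in> polys_over R"
  and polys_over_diff: "is_subring R \<Longrightarrow> p \<in> polys_over R \<Longrightarrow> q \<in> polys_over R \<Longrightarrow> p - q \<in> polys_over R"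
  and polys_over_uminus: "is_subring R \<Longrightarrow> p \<in> polys_over R \<Longrightarrow> - p \<in> polys_over R"
  by (auto simp: polys_over_def subring_add subring_diff subring_uminus)

lemma polys_over_mult: "is_subring R \<Longrightarrow> p \<in> polys_over R \<Longrightarrow> q \<in> polys_over R \<Longrightarrow> p * q \<in> polys_over R"
  by (auto simp: polys_over_def coeff_mult intro!: subring_sum subring_mult)

lemma polys_over_pCons: "is_subring R \<Longrightarrow> a \<in> R \<Longrightarrow> p \<in> polys_over R \<Longrightarrow> pCons a p \<in> polys_over R"
  by (auto simp: polys_over_def coeff_pCons split: nat.split)

lemma polys_over_sum:
  assumes "is_subring R" "\<And>i. i \<in> I \<Longrightarrow> f i \<in> polys_over R"
  shows "sum f I \<in> polys_over R"
  using assms(2) by (induction I rule: infinite_finite_induct)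
    (auto intro: polys_over_0[OF assms(1)] polys_over_add[OF assms(1)])

lemma polys_over_prod:
  assumes "is_subring R" "\<And>i. i \<in> I \<Longrightarrow> f i \<in> polys_over R"
  shows "prod f I \<in> polys_over R"
  using assms(2) by (induction I rule: infinite_finite_induct)
    (auto intro: polys_over_1[OF assms(1)] polys_over_mult[OF assms(1)])

text \<open>The Leibniz formula builds the determinant from signs, sums and products, none of which
  leaves the polynomials over R.\<close>

lemma char_poly_in_polys_over:
  fixes A :: "'k::field mat"
  assumes R: "is_subring R" and A: "A \<in> carrier_mat n n"
    and ent: "\<And>i j. i < n \<Longrightarrow> j < n \<Longrightarrow> A $$ (i, j) \<in> R"
  shows "char_poly A \<in> polys_over R"
proof -
  have C: "char_poly_matrix A \<in> carrier_mat n n"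
    using A by simp
  have e: "char_poly_matrix A $$ (i, j) \<in> polys_over R" if "i < n" "j < n" for i j
    using A ent[OF that] that R
    by (auto simp: char_poly_matrix_def intro!: polys_over_pCons polys_over_0 polys_over_1 subring_0 subring_1 subring_uminus)
  have s: "signof p \<in> polys_over R" for p
    using R by (auto simp: sign_def intro: polys_over_1 polys_over_uminus)
  show ?thesis
    unfolding char_poly_def det_def'[OF C] using R
    by (intro polys_over_sum polys_over_mult polys_over_prod s e) (auto simp: permutes_in_image)
qed

text \<open>An element acting on a finitely generated module \<open>\<noteq> 0\<close> is a root of the characteristic
  polynomial of a matrix of the action.\<close>

lemma integral_if_acts_on_generators:
  fixes g :: "'i \<Rightarrow> 'k::field"
  assumes R: "is_subring R" and fin: "finite B" and nz: "b0 \<in> B" "g b0 \<noteq> 0"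
    and act: "\<And>b. b \<in> B \<Longrightarrow> \<exists>c. (\<forall>j\<in>B. c j \<in> R) \<and> z * g b = (\<Sum>j\<in>B. c j * g j)"
  shows "z \<in> integral_closure R"
proof -
  obtain h where h: "bij_betw h {0..<card B} B"
    using ex_bij_betw_nat_finite[OF fin] by blast
  obtain c where c: "\<And>b j. b \<in> B \<Longrightarrow> j \<in> B \<Longrightarrow> c b j \<in> R"
      "\<And>b. b \<in> B \<Longrightarrow> z * g b = (\<Sum>j\<in>B. c b j * g j)"
    using act by metis
  define n where "n = card B"
  define A where "A = mat n n (\<lambda>(i, j). c (h i) (h j))"
  \<comment> \<open>The vector of generators is itself the eigenvector for \<open>z\<close>; its
    entry belonging to \<open>b0\<close> keeps it from vanishing.\<close>
  define v where "v = vec n (\<lambda>i. g (h i))"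
  have hB: "h i \<in> B" if "i < n" for i using h that by (auto simp: bij_betw_def n_def)
  have A: "A \<in> carrier_mat n n" by (simp add: A_def)
  have v: "v \<in> carrier_vec n" by (simp add: v_def)
  obtain i0 where i0: "i0 < n" "h i0 = b0"
    using h nz(1) by (metis atLeast0LessThan bij_betw_imp_surj_on imageE lessThan_iff n_def)
  have "v \<noteq> 0\<^sub>v n"
  proof
    assume "v = 0\<^sub>v n"
    hence "vec_index v i0 = vec_index (0\<^sub>v n) i0" by simp
    thus False using i0 nz by (simp add: v_def)
  qed
  moreover have "A *\<^sub>v v = z \<cdot>\<^sub>v v"
  proof (rule eq_vecI)
    fix i assume "i < dim_vec (z \<cdot>\<^sub>v v)"
    hence i: "i < n" by (simp add: v_def)
    have "vec_index (A *\<^sub>v v) i = (\<Sum>j\<in>{0..<n}. c (h i) (h j) * g (h j))"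
      using i by (simp add: A_def v_def scalar_prod_def)
    also have "\<dots> = (\<Sum>j\<in>B. c (h i) j * g j)"
      using sum.reindex_bij_betw[OF h, of "\<lambda>j. c (h i) j * g j"] by (simp add: n_def)
    also have "\<dots> = z * g (h i)" using c(2)[OF hB[OF i]] by simp
    finally show "vec_index (A *\<^sub>v v) i = vec_index (z \<cdot>\<^sub>v v) i" using i by (simp add: v_def)
  qed (simp add: A_def v_def)
  ultimately have "eigenvalue A z"
    using A v by (auto simp: eigenvalue_def eigenvector_def)
  hence "poly (char_poly A) z = 0"
    using eigenvalue_root_char_poly[OF A] by simp
  moreover have "char_poly A \<in> polys_over R"
    by (rule char_poly_in_polys_over[OF R A]) (auto simp: A_def intro!: c hB)
  moreover have "lead_coeff (char_poly A) = 1"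
    using degree_monic_char_poly[OF A] by auto
  ultimately show ?thesis by (auto simp: integral_closure_def)
qed

text \<open>The monic equation as a rewriting rule for the top power. A monic constant is 1 and has
  no root, hence \<open>n > 0\<close>; this puts \<open>x ^ 0\<close> among the generators used for
  the integral closure.\<close>

lemma integral_power_reduction:
  assumes R: "is_subring R" and x: "x \<in> integral_closure R"
  obtains n c where "n > 0" "\<And>i. i < n \<Longrightarrow> c i \<in> R" "x ^ n = (\<Sum>i<n. c i * x ^ i)"
proof -
  obtain p where p: "p \<in> polys_over R" "lead_coeff p = 1" "poly p x = 0"
    using x by (auto simp: integral_closure_def)
  define n where "n = degree p"
  have "n > 0"
  proof (rule ccontr)
    assume "\<not> n > 0"
    then obtain a where "p = [:a:]" by (metis degree_eq_zeroE n_def neq0_conv)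
    with p show False by auto
  qed
  moreover have "x ^ n = (\<Sum>i<n. - coeff p i * x ^ i)"
    using p(2,3) by (simp add: poly_altdef lessThan_Suc_atMost[symmetric] n_def sum_negf add_eq_0_iff)
  moreover have "- coeff p i \<in> R" for i
    using p(1) R by (auto simp: polys_over_def subring_uminus)
  ultimately show ?thesis using that[of n "\<lambda>i. - coeff p i"] by blast
qed

text \<open>No equation for \<open>x - y\<close> or \<open>x * y\<close> has to be exhibited: the
  R-module \<open>S\<close> spanned by the finitely many \<open>x ^ i * y ^ j\<close> is stable
  under multiplication by x and by y, hence by \<open>x - y\<close> and \<open>x * y\<close>. At the
  top exponents the equations of x and y lead back into the span.\<close>

lemma is_subring_integral_closure:
  assumes R: "is_subring R"
  shows "is_subring (integral_closure R)" "R \<subseteq> integral_closure R"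
proof -
  show sub: "R \<subseteq> integral_closure R"
  proof
    fix x assume x: "x \<in> R"
    have "[:- x, 1:] \<in> polys_over R"
      using R x by (intro polys_over_pCons polys_over_0 subring_uminus subring_1) auto
    thus "x \<in> integral_closure R"
      by (auto simp: integral_closure_def intro!: bexI[of _ "[:- x, 1:]"])
  qed
  have "x - y \<in> integral_closure R \<and> x * y \<in> integral_closure R"
    if x: "x \<in> integral_closure R" and y: "y \<in> integral_closure R" for x y
  proof -
    obtain n c where n: "n > 0" "\<And>i. i < n \<Longrightarrow> c i \<in> R" "x ^ n = (\<Sum>i<n. c i * x ^ i)"
      using integral_power_reduction[OF R x] by blast
    obtain m d where m: "m > 0" "\<And>i. i < m \<Longrightarrow> d i \<in> R" "y ^ m = (\<Sum>i<m. d i * y ^ i)"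
      using integral_power_reduction[OF R y] by blast
    define B where "B = {..<n} \<times> {..<m}"
    define g where "g = (\<lambda>(i, j). x ^ i * y ^ j)"
    define S where "S = {\<Sum>b\<in>B. a b * g b | a. \<forall>b\<in>B. a b \<in> R}"
    have fin: "finite B" by (simp add: B_def)
    have S_diff: "s - t \<in> S" if st: "s \<in> S" "t \<in> S" for s t
    proof -
      obtain a b where "\<forall>i\<in>B. a i \<in> R" "s = (\<Sum>i\<in>B. a i * g i)" "\<forall>i\<in>B. b i \<in> R" "t = (\<Sum>i\<in>B. b i * g i)"
        using st by (auto simp: S_def)
      thus ?thesis
        unfolding S_def using R
        by (intro CollectI exI[of _ "\<lambda>i. a i - b i"]) (auto simp: subring_diff sum_subtractf algebra_simps)
    qed
    have S_scale: "r * s \<in> S" if "r \<in> R" and s: "s \<in> S" for r s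
    proof -
      obtain a where "\<forall>i\<in>B. a i \<in> R" "s = (\<Sum>i\<in>B. a i * g i)"
        using s by (auto simp: S_def)
      thus ?thesis
        unfolding S_def using R \<open>r \<in> R\<close>
        by (intro CollectI exI[of _ "\<lambda>i. r * a i"]) (auto simp: subring_mult sum_distrib_left algebra_simps)
    qed
    have S_g: "g b \<in> S" if "b \<in> B" for b
      unfolding S_def using that R fin
      by (intro CollectI exI[of _ "\<lambda>i. if i = b then 1 else 0"])
        (auto simp: subring_0 subring_1 if_distrib[of "\<lambda>t. t * _"] cong: if_cong)
    have S_0: "0 \<in> S" using S_diff[OF S_g S_g, of "(0,0)" "(0,0)"] n m by (simp add: B_def)
    have S_add: "s + t \<in> S" if "s \<in> S" "t \<in> S" for s t
      using S_diff[OF that(1) S_diff[OF S_0 that(2)]] by simp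
    have S_sum: "sum f I \<in> S" if "\<And>i. i \<in> I \<Longrightarrow> f i \<in> S" for f and I :: "(nat \<times> nat) set"
      using that by (induction I rule: infinite_finite_induct) (auto intro: S_0 S_add)
    have S_sum_nat: "sum f I \<in> S" if "\<And>i. i \<in> I \<Longrightarrow> f i \<in> S" for f and I :: "nat set"
      using that by (induction I rule: infinite_finite_induct) (auto intro: S_0 S_add)
    have lift: "z * s \<in> S" if zg: "\<And>b. b \<in> B \<Longrightarrow> z * g b \<in> S" and s: "s \<in> S" for z s
    proof -
      obtain a where a: "\<forall>i\<in>B. a i \<in> R" "s = (\<Sum>i\<in>B. a i * g i)"
        using s by (auto simp: S_def)
      have "z * s = (\<Sum>i\<in>B. a i * (z * g i))" unfolding a(2) by (simp add: sum_distrib_left mult_ac)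
      also have "\<dots> \<in> S" using a by (intro S_sum S_scale[OF _ zg]) auto
      finally show ?thesis .
    qed
    have xg: "x * g b \<in> S" if bB: "b \<in> B" for b
    proof -
      obtain i j where b: "b = (i, j)" "i < n" "j < m" using bB by (auto simp: B_def)
      show ?thesis
      proof (cases "Suc i < n")
        case True
        thus ?thesis using S_g[of "(Suc i, j)"] b by (simp add: B_def g_def mult_ac)
      next
        case False
        hence "n = Suc i" using b by simp
        hence "x * g b = x ^ n * y ^ j" by (simp add: b g_def mult_ac)
        also have "\<dots> = (\<Sum>k<n. c k * g (k, j))"
          unfolding n(3) g_def by (simp add: sum_distrib_right sum_distrib_left mult_ac)
        also have "\<dots> \<in> S" using b n by (intro S_sum_nat S_scale S_g) (auto simp: B_def)
        finally show ?thesis .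
      qed
    qed
    have yg: "y * g b \<in> S" if bB: "b \<in> B" for b
    proof -
      obtain i j where b: "b = (i, j)" "i < n" "j < m" using bB by (auto simp: B_def)
      show ?thesis
      proof (cases "Suc j < m")
        case True
        thus ?thesis using S_g[of "(i, Suc j)"] b by (simp add: B_def g_def mult_ac)
      next
        case False
        hence "m = Suc j" using b by simp
        hence "y * g b = x ^ i * y ^ m" by (simp add: b g_def mult_ac)
        also have "\<dots> = (\<Sum>k<m. d k * g (i, k))"
          unfolding m(3) g_def by (simp add: sum_distrib_left mult_ac)
        also have "\<dots> \<in> S" using b m by (intro S_sum_nat S_scale S_g) (auto simp: B_def)
        finally show ?thesis .
      qed
    qed
    have crit: "z \<in> integral_closure R" if "\<And>s. s \<in> S \<Longrightarrow> z * s \<in> S" for z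
    proof (rule integral_if_acts_on_generators[OF R fin, of "(0, 0)" g])
      show "(0, 0) \<in> B" "g (0, 0) \<noteq> 0" using n m by (auto simp: B_def g_def)
      show "\<exists>c. (\<forall>j\<in>B. c j \<in> R) \<and> z * g b = (\<Sum>j\<in>B. c j * g j)" if "b \<in> B" for b
        using \<open>\<And>s. s \<in> S \<Longrightarrow> z * s \<in> S\<close>[OF S_g[OF that]] by (auto simp: S_def)
    qed
    have "(x - y) * s \<in> S" "(x * y) * s \<in> S" if "s \<in> S" for s
      using S_diff[OF lift[OF xg that] lift[OF yg that]] lift[OF xg lift[OF yg that]]
      by (auto simp: algebra_simps)
    thus ?thesis using crit by blast
  qed
  moreover have "1 \<in> integral_closure R" using sub subring_1[OF R] by blast
  ultimately show "is_subring (integral_closure R)" by (auto simp: is_subring_def)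
qed

section \<open>Countability of the ring of integers\<close>

lemma countable_polys_over:
  assumes "countable R"
  shows "countable (polys_over R)"
proof -
  have "polys_over R \<subseteq> Poly ` lists R"
  proof
    fix p assume p: "p \<in> polys_over R"
    have "coeffs p \<in> lists R"
      using p by (auto simp: polys_over_def coeffs_def)
    thus "p \<in> Poly ` lists R" by (metis Poly_coeffs image_eqI)
  qed
  thus ?thesis using assms by (meson countable_image countable_lists countable_subset)
qed

lemma countable_integral_closure:
  assumes "countable R"
  shows "countable (integral_closure R)"
proof -
  have "integral_closure R \<subseteq> (\<Union>p \<in> polys_over R - {0}. {x. poly p x = 0})"
    by (fastforce simp: integral_closure_def)
  moreover have "countable \<dots>"
    using countable_polys_over[OF assms] by (intro countable_UN) (auto intro: countable_finite poly_roots_finite)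
  ultimately show ?thesis by (rule countable_subset)
qed

text \<open>The interface between the field theory and the analysis: closure keeps
  \<open>poly P n\<close> and \<open>m * n\<close> in the acting group, and countability lets
  almost-everywhere statements be combined over all ring elements.\<close>

lemma global_field_integers_subring:
  fixes OK :: "'k::field set"
  assumes "global_field_integers OK"
  shows "is_subring OK" "countable OK"
proof -
  obtain R :: "'k set" where R: "is_subring R" "countable R" "OK = integral_closure R"
  proof (cases "number_field_integers OK")
    case True
    have "countable (\<int> :: 'k set)" by (simp add: Ints_def)
    thus ?thesis using True that[of \<int>] by (auto simp: number_field_integers_def is_subring_def)
  next
    case False
    then obtain F t where F: "finite_subfield F" and OK: "OK = integral_closure (adjoin_ring F t)"
      using assms by (auto simp: global_field_integers_def function_field_integers_def)
    have F_ring: "is_subring F" using F by (auto simp: finite_subfield_def is_subring_def)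
    have "is_subring (adjoin_ring F t)"
      unfolding is_subring_def adjoin_ring_def
    proof (intro conjI ballI)
      show "1 \<in> {poly p t |p. p \<in> polys_over F}"
        using polys_over_1[OF F_ring] by (auto intro!: exI[of _ 1])
    next
      fix a b assume "a \<in> {poly p t |p. p \<in> polys_over F}" "b \<in> {poly p t |p. p \<in> polys_over F}"
      then obtain p q where "a = poly p t" "p \<in> polys_over F" "b = poly q t" "q \<in> polys_over F" by auto
      thus "a - b \<in> {poly p t |p. p \<in> polys_over F}" "a * b \<in> {poly p t |p. p \<in> polys_over F}"
        using polys_over_diff[OF F_ring] polys_over_mult[OF F_ring]
        by (auto intro: exI[of _ "p - q"] exI[of _ "p * q"])
    qed
    moreover have "countable (adjoin_ring F t)"
    proof -
      have "adjoin_ring F t = (\<lambda>p. poly p t) ` polys_over F" by (auto simp: adjoin_ring_def)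
      thus ?thesis using F countable_polys_over[of F]
        by (simp add: finite_subfield_def countable_finite)
    qed
    ultimately show ?thesis using that OK by blast
  qed
  thus "is_subring OK" "countable OK"
    using is_subring_integral_closure(1) countable_integral_closure by auto
qed

section \<open>Schoenberg's space-filling curve\<close>

text \<open>Schoenberg's even function of period 2 with the value 0 on [0, 1/3] and 1 on [2/3, 1];
  truncating a cosine gives the plateaus, continuity and periodicity in one formula.\<close>

definition schoenberg_step :: "real \<Rightarrow> real" where
  "schoenberg_step u = max 0 (min 1 (1 / 2 - cos (pi * u)))"

text \<open>The i-th coordinate of a continuous curve in the Hilbert cube. The pairing function
  splits the ternary digits of t into infinitely many disjoint sequences, one for each coordinate,
  so that all coordinates can be prescribed independently.\<close>

definition schoenberg :: "nat \<Rightarrow> real \<Rightarrow> real" where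
  "schoenberg i t = (\<Sum>k. schoenberg_step (3 ^ prod_encode (i, k) * t) / 2 ^ Suc k)"

lemma continuous_schoenberg: "continuous_on UNIV (schoenberg i)"
proof -
  have lim: "uniform_limit UNIV (\<lambda>n t. \<Sum>k<n. schoenberg_step (3 ^ prod_encode (i, k) * t) / 2 ^ Suc k)
      (schoenberg i) sequentially"
    unfolding schoenberg_def
  proof (rule Weierstrass_m_test)
    show "norm (schoenberg_step (3 ^ prod_encode (i, k) * t) / 2 ^ Suc k) \<le> (1 / 2) ^ Suc k" for k t
      by (auto simp: schoenberg_step_def power_one_over field_simps)
    show "summable (\<lambda>k. (1 / 2) ^ Suc k :: real)"
      by (subst summable_Suc_iff) (rule summable_geometric, simp)
  qed
  show ?thesis
    by (rule uniform_limit_theorem[OF _ lim])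
      (auto simp: schoenberg_step_def intro!: always_eventually continuous_intros)
qed

text \<open>The point of Cantor's set with ternary digits \<open>2 * a k\<close> has coordinates with the binary
  digits \<open>a (prod_encode (i, k))\<close>.\<close>

lemma schoenberg_step_cantor:
  fixes a :: "nat \<Rightarrow> nat"
  assumes a: "\<And>k. a k \<le> 1"
  shows "schoenberg_step (3 ^ j * (\<Sum>k. 2 * real (a k) / 3 ^ Suc k)) = real (a j)"
    and "(\<Sum>k. 2 * real (a k) / 3 ^ Suc k) \<in> {0..1}"
proof -
  define T where "T j = (\<Sum>k. 2 * real (a (k + j)) / 3 ^ Suc k)" for j
  have le: "2 * real (a k) / 3 ^ Suc l \<le> 2 / 3 * (1 / 3) ^ l" for k l
    using a[of k] by (auto simp: power_one_over field_simps)
  have geo: "summable (\<lambda>l. 2 / 3 * (1 / 3) ^ l :: real)"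
    by (intro summable_mult summable_geometric) simp
  have smb: "summable (\<lambda>k. 2 * real (a (k + j)) / 3 ^ Suc k)" for j
    by (rule summable_comparison_test'[OF geo, of 0]) (use le in auto)
  have T01: "0 \<le> T j" "T j \<le> 1" for j
  proof -
    show "0 \<le> T j" unfolding T_def by (rule suminf_nonneg[OF smb]) simp
    have "T j \<le> (\<Sum>l. 2 / 3 * (1 / 3) ^ l)"
      unfolding T_def by (rule suminf_le[OF le smb geo])
    also have "\<dots> = 1" by (subst suminf_mult) (auto simp: suminf_geometric)
    finally show "T j \<le> 1" .
  qed
  have rec: "T j = (2 * real (a j) + T (Suc j)) / 3" for j
  proof -
    have "T j = (\<Sum>k. 2 * real (a (Suc k + j)) / 3 ^ Suc (Suc k)) + 2 * real (a (0 + j)) / 3 ^ Suc 0"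
      using suminf_split_head[OF smb[of j]] by (simp add: T_def)
    also have "(\<Sum>k. 2 * real (a (Suc k + j)) / 3 ^ Suc (Suc k)) = (\<Sum>k. (1 / 3) * (2 * real (a (k + Suc j)) / 3 ^ Suc k))"
      by simp
    also have "\<dots> = (1 / 3) * T (Suc j)"
      unfolding T_def by (rule suminf_mult[OF smb])
    finally show ?thesis by (simp add: field_simps)
  qed
  \<comment> \<open>Multiplying by \<open>3 ^ j\<close> moves the first j digits into the integer
    part. They are 0 or 2, so this integer is even and disappears in the period 2 of
    \<open>schoenberg_step\<close>.\<close>
  have shift: "\<exists>m::nat. 3 ^ j * T 0 = 2 * real m + T j" for j
  proof (induction j)
    case (Suc j)
    then obtain m where "3 ^ j * T 0 = 2 * real m + T j" by blast
    hence "3 ^ Suc j * T 0 = 2 * real (3 * m + a j) + T (Suc j)"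
      using rec[of j] unfolding power_Suc mult.assoc by simp
    thus ?case by blast
  qed (auto intro: exI[of _ 0])
  obtain m :: nat where m: "3 ^ j * T 0 = 2 * real m + T j" using shift by blast
  have "cos (pi * (2 * real m + T j)) = cos (pi * T j + 2 * real m * pi)"
    by (simp add: algebra_simps)
  also have "\<dots> = cos (pi * T j)"
    by (simp add: cos_add)
  finally have c: "schoenberg_step (3 ^ j * T 0) = schoenberg_step (T j)"
    by (simp add: schoenberg_step_def m)
  have "schoenberg_step (T j) = real (a j)"
  proof (cases "a j = 0")
    case True
    hence "T j \<le> 1 / 3" using rec[of j] T01[of "Suc j"] by simp
    hence "cos (pi / 3) \<le> cos (pi * T j)"
      using T01[of j] by (intro cos_monotone_0_pi_le) auto
    thus ?thesis using True by (simp add: schoenberg_step_def cos_60)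
  next
    case False
    hence aj: "a j = 1" using a[of j] by simp
    hence "2 / 3 \<le> T j" using rec[of j] T01[of "Suc j"] by simp
    hence "cos (pi * T j) \<le> cos (pi - pi / 3)"
      using T01[of j] by (intro cos_monotone_0_pi_le) auto
    also have "cos (pi - pi / 3) = - (1 / 2)" by (subst cos_pi_minus) (simp add: cos_60)
    finally have "cos (pi * T j) \<le> - (1 / 2)" .
    thus ?thesis using aj by (simp add: schoenberg_step_def)
  qed
  thus "schoenberg_step (3 ^ j * (\<Sum>k. 2 * real (a k) / 3 ^ Suc k)) = real (a j)"
    using c by (simp add: T_def)
  show "(\<Sum>k. 2 * real (a k) / 3 ^ Suc k) \<in> {0..1}"
    using T01[of 0] by (simp add: T_def)
qed

text \<open>The partial sums are the truncations \<open>\<lfloor>2 ^ n * x\<rfloor> / 2 ^ n\<close>,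
  and \<open>x < 1\<close> makes the initial integer part vanish.\<close>

lemma binary_expansion:
  fixes x :: real
  assumes "0 \<le> x" "x < 1"
  shows "(\<lambda>k. real_of_int (\<lfloor>2 ^ Suc k * x\<rfloor> mod 2) / 2 ^ Suc k) sums x"
proof -
  have part: "(\<Sum>k<n. real_of_int (\<lfloor>2 ^ Suc k * x\<rfloor> mod 2) / 2 ^ Suc k) = real_of_int \<lfloor>2 ^ n * x\<rfloor> / 2 ^ n" for n
  proof (induction n)
    case 0
    have "\<lfloor>x\<rfloor> = 0" using assms by (simp add: floor_eq_iff)
    thus ?case by simp
  next
    case (Suc n)
    have "\<lfloor>2 ^ Suc n * x\<rfloor> div 2 = \<lfloor>2 ^ n * x\<rfloor>"
      using floor_divide_real_eq_div[of 2 "2 ^ Suc n * x"] by simp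
    hence "\<lfloor>2 ^ Suc n * x\<rfloor> = 2 * \<lfloor>2 ^ n * x\<rfloor> + \<lfloor>2 ^ Suc n * x\<rfloor> mod 2"
      by (metis mult_div_mod_eq)
    hence "real_of_int \<lfloor>2 ^ Suc n * x\<rfloor> = 2 * real_of_int \<lfloor>2 ^ n * x\<rfloor> + real_of_int (\<lfloor>2 ^ Suc n * x\<rfloor> mod 2)"
      by linarith
    thus ?case using Suc by (simp add: field_simps)
  qed
  have "(\<lambda>n. real_of_int \<lfloor>2 ^ n * x\<rfloor> / 2 ^ n) \<longlonglongrightarrow> x"
  proof (rule LIM_zero_cancel, rule Lim_null_comparison[where g = "\<lambda>n. (1 / 2) ^ n :: real"])
    show "(\<lambda>n. (1 / 2) ^ n :: real) \<longlonglongrightarrow> 0" by (rule LIMSEQ_power_zero) simp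
    show "\<forall>\<^sub>F n in sequentially. norm (real_of_int \<lfloor>2 ^ n * x\<rfloor> / 2 ^ n - x) \<le> (1 / 2) ^ n"
    proof (rule always_eventually, rule allI)
      fix n
      have "\<bar>real_of_int \<lfloor>2 ^ n * x\<rfloor> - 2 ^ n * x\<bar> \<le> 1" by linarith
      hence "\<bar>real_of_int \<lfloor>2 ^ n * x\<rfloor> - 2 ^ n * x\<bar> / 2 ^ n \<le> 1 / 2 ^ n"
        by (intro divide_right_mono) auto
      moreover have "real_of_int \<lfloor>2 ^ n * x\<rfloor> / 2 ^ n - x = (real_of_int \<lfloor>2 ^ n * x\<rfloor> - 2 ^ n * x) / 2 ^ n"
        by (simp add: field_simps)
      ultimately show "norm (real_of_int \<lfloor>2 ^ n * x\<rfloor> / 2 ^ n - x) \<le> (1 / 2) ^ n"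
        by (simp add: power_one_over)
    qed
  qed
  thus ?thesis unfolding sums_def by (simp only: part)
qed

text \<open>The coordinates serve as angles modulo 1, so the half-open range already covers the
  whole infinite torus.\<close>

lemma schoenberg_surj:
  fixes x :: "nat \<Rightarrow> real"
  assumes "\<And>i. 0 \<le> x i" "\<And>i. x i < 1"
  obtains t where "t \<in> {0..1}" "\<And>i. schoenberg i t = x i"
proof -
  define a where "a n = (case prod_decode n of (i, k) \<Rightarrow> nat (\<lfloor>2 ^ Suc k * x i\<rfloor> mod 2))" for n
  have a1: "a n \<le> 1" for n
  proof -
    have "nat (z mod 2) \<le> 1" for z :: int by linarith
    thus ?thesis by (simp add: a_def split: prod.split)
  qed
  define t where "t = (\<Sum>k. 2 * real (a k) / 3 ^ Suc k)"
  have "schoenberg i t = x i" for i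
  proof -
    have "schoenberg_step (3 ^ prod_encode (i, k) * t) = real_of_int (\<lfloor>2 ^ Suc k * x i\<rfloor> mod 2)" for k
      unfolding t_def by (subst schoenberg_step_cantor(1)[OF a1]) (simp add: a_def)
    thus ?thesis
      using sums_unique[OF binary_expansion[of "x i"]] assms by (simp add: schoenberg_def)
  qed
  moreover have "t \<in> {0..1}" unfolding t_def by (rule schoenberg_step_cantor(2)[OF a1])
  ultimately show ?thesis using that by blast
qed

section \<open>The Herglotz--Bochner theorem for countable groups\<close>

text \<open>The points \<open>p i\<close> may coincide. This matters for the Fejer weights, where
  different exponent vectors can give the same group element. Membership in the nonnegative reals
  asserts reality and sign of a complex number together.\<close>

definition positive_definite_on :: "'k::ab_group_add set \<Rightarrow> ('k \<Rightarrow> complex) \<Rightarrow> bool" where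
  "positive_definite_on G \<phi> \<longleftrightarrow>
     (\<forall>(N::nat) p c. (\<forall>i<N. p i \<in> G) \<longrightarrow>
        (\<Sum>i<N. \<Sum>j<N. c i * cnj (c j) * \<phi> (p i - p j)) \<in> \<real>\<^sub>\<ge>\<^sub>0)"

lemma positive_definite_on_family:
  assumes "positive_definite_on G \<phi>" "finite A" "\<And>a. a \<in> A \<Longrightarrow> p a \<in> G"
  shows "(\<Sum>a\<in>A. \<Sum>b\<in>A. c a * cnj (c b) * \<phi> (p a - p b)) \<in> \<real>\<^sub>\<ge>\<^sub>0"
proof -
  obtain h where h: "bij_betw h {0..<card A} A"
    using ex_bij_betw_nat_finite[OF assms(2)] by blast
  hence h': "bij_betw h {..<card A} A" by (simp add: atLeast0LessThan)
  have "(\<Sum>i<card A. \<Sum>j<card A. c (h i) * cnj (c (h j)) * \<phi> (p (h i) - p (h j))) \<in> \<real>\<^sub>\<ge>\<^sub>0"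
    using assms(1)[unfolded positive_definite_on_def, rule_format, of "card A" "\<lambda>i. p (h i)" "\<lambda>i. c (h i)"]
      bij_betwE[OF h'] assms(3) by auto
  also have "(\<lambda>i. \<Sum>j<card A. c (h i) * cnj (c (h j)) * \<phi> (p (h i) - p (h j)))
      = (\<lambda>i. \<Sum>b\<in>A. c (h i) * cnj (c b) * \<phi> (p (h i) - p b))"
    using sum.reindex_bij_betw[OF h'] by (intro ext) fast
  also have "(\<Sum>i<card A. \<Sum>b\<in>A. c (h i) * cnj (c b) * \<phi> (p (h i) - p b))
      = (\<Sum>a\<in>A. \<Sum>b\<in>A. c a * cnj (c b) * \<phi> (p a - p b))"
    using sum.reindex_bij_betw[OF h'] by fast
  finally show ?thesis .
qed

section \<open>Discrete Fourier analysis on finite tori\<close>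

text \<open>A geometric series in a 2n-th root of unity, whose ratio is 1 only if 2n divides m; the
  bound on m leaves only \<open>m = 0\<close>.\<close>

lemma sum_roots_of_unity:
  fixes n :: nat and m :: int
  assumes n: "n > 0" and m: "\<bar>m\<bar> < 2 * int n"
  shows "(\<Sum>t<2 * n. cis (pi * (real_of_int m * real t) / real n)) = (if m = 0 then of_nat (2 * n) else 0)"
proof (cases "m = 0")
  case False
  define z where "z = cis (pi * real_of_int m / real n)"
  have "z \<noteq> 1"
  proof
    assume "z = 1"
    hence "cos (pi * real_of_int m / real n) = 1" by (simp add: z_def complex_eq_iff)
    then obtain l :: int where "pi * real_of_int m / real n = real_of_int l * 2 * pi"
      by (auto simp: cos_one_2pi_int)
    hence "real_of_int m = real_of_int (2 * l * int n)" using n by (simp add: field_simps)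
    hence ml: "m = 2 * l * int n" by (simp only: of_int_eq_iff)
    hence "l \<noteq> 0" using False by auto
    hence "2 * int n \<le> \<bar>m\<bar>" unfolding ml abs_mult using n by (simp add: mult_le_cancel_right1)
    thus False using m by simp
  qed
  moreover have "z ^ (2 * n) = 1"
  proof -
    have "z ^ (2 * n) = cis (2 * pi * real_of_int m)"
      unfolding z_def Complex.DeMoivre using n by (intro arg_cong[of _ _ cis]) (simp add: field_simps)
    also have "\<dots> = 1" by (rule cis_multiple_2pi) simp
    finally show ?thesis .
  qed
  moreover have "cis (pi * (real_of_int m * real t) / real n) = z ^ t" for t
    by (simp add: z_def Complex.DeMoivre mult_ac)
  ultimately show ?thesis using False by (simp add: geometric_sum)
qed simp

text \<open>The autocorrelation of an interval of n integers; its values are the triangular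
  coefficients of the Fejer kernel.\<close>

lemma sum_shift_indicator:
  fixes n :: nat and k :: int
  assumes "\<bar>k\<bar> \<le> int n"
  shows "(\<Sum>a<n. \<Sum>b<n. if int a = int b + k then 1 else 0 :: real) = real n - real_of_int \<bar>k\<bar>"
proof -
  have "(\<Sum>a<n. \<Sum>b<n. if int a = int b + k then 1 else 0 :: real)
      = (\<Sum>b<n. \<Sum>a<n. if int a = int b + k then 1 else 0)"
    by (rule sum.swap)
  also have "\<dots> = (\<Sum>b<n. if b \<in> {nat (- k)..<nat (int n - k)} then 1 else 0)"
  proof (rule sum.cong)
    fix b
    have "(\<Sum>a<n. if int a = int b + k then 1 else 0 :: real)
        = (\<Sum>a<n. if a = nat (int b + k) then (if 0 \<le> int b + k then 1 else 0) else 0)"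
      by (intro sum.cong) auto
    also have "\<dots> = (if b \<in> {nat (- k)..<nat (int n - k)} then 1 else 0)"
      by (subst sum.delta) auto
    finally show "(\<Sum>a<n. if int a = int b + k then 1 else 0 :: real)
        = (if b \<in> {nat (- k)..<nat (int n - k)} then 1 else 0)" .
  qed simp
  also have "\<dots> = real (card ({..<n} \<inter> {nat (- k)..<nat (int n - k)}))"
    by (simp add: sum.If_cases) (rule arg_cong[of _ _ card], auto)
  also have "{..<n} \<inter> {nat (- k)..<nat (int n - k)} = {nat (- k)..<min n (nat (int n - k))}"
    by auto
  also have "real (card \<dots>) = real n - real_of_int \<bar>k\<bar>"
    using assms by (auto simp: min_def of_nat_diff nat_le_eq_zle split: if_splits)
  finally show ?thesis .
qed

lemma sum_PiE_indicator:
  fixes n :: nat and k :: "nat \<Rightarrow> int"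
  assumes "\<And>i. i < n \<Longrightarrow> \<bar>k i\<bar> \<le> int n"
  defines "F \<equiv> PiE {..<n} (\<lambda>_. {..<n})"
  shows "(\<Sum>a\<in>F. \<Sum>b\<in>F. \<Prod>i<n. if int (a i) = int (b i) + k i then 1 else 0 :: real)
    = (\<Prod>i<n. real n - real_of_int \<bar>k i\<bar>)"
proof -
  have "(\<Sum>a\<in>F. \<Sum>b\<in>F. \<Prod>i<n. if int (a i) = int (b i) + k i then 1 else 0 :: real)
    = (\<Sum>a\<in>F. \<Prod>i<n. \<Sum>b<n. if int (a i) = int b + k i then 1 else 0)"
    unfolding F_def by (subst prod_sum_PiE) auto
  also have "\<dots> = (\<Prod>i<n. \<Sum>a<n. \<Sum>b<n. if int a = int b + k i then 1 else 0)"
    unfolding F_def by (subst prod_sum_PiE) auto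
  also have "\<dots> = (\<Prod>i<n. real n - real_of_int \<bar>k i\<bar>)"
    using assms(1) by (intro prod.cong sum_shift_indicator) auto
  finally show ?thesis .
qed

text \<open>The weights are a Fejer mean of \<open>\<phi>\<close> on the group \<open>(\<int>/2n)\<^sup>n\<close>; the range \<open>2n\<close> is large enough
  to prevent aliasing of frequencies \<open>k\<close> with entries at most \<open>n\<close>.\<close>

lemma fejer_weights:
  fixes \<phi> :: "'k::comm_ring_1 \<Rightarrow> complex" and g :: "nat \<Rightarrow> 'k"
  assumes pd: "positive_definite_on G \<phi>" and n: "n > 0"
    and g: "\<And>a :: nat \<Rightarrow> nat. (\<Sum>i<n. of_nat (a i) * g i) \<in> G"
  defines "\<Theta> \<equiv> PiE {..<n} (\<lambda>_. {..<2 * n})"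
  obtains w :: "(nat \<Rightarrow> nat) \<Rightarrow> real" where
    "\<And>\<theta>. w \<theta> \<ge> 0"
    "\<And>k :: nat \<Rightarrow> int. (\<And>i. i < n \<Longrightarrow> \<bar>k i\<bar> \<le> int n) \<Longrightarrow>
      (\<Sum>\<theta>\<in>\<Theta>. of_real (w \<theta>) * (\<Prod>i<n. cis (pi * (real_of_int (k i) * real (\<theta> i)) / real n)))
      = \<phi> (\<Sum>i<n. of_int (k i) * g i) * of_real (\<Prod>i<n. 1 - real_of_int \<bar>k i\<bar> / real n)"
proof -
  define F where "F = PiE {..<n} (\<lambda>_. {..<n})"
  define \<pi> where "\<pi> a = (\<Sum>i<n. of_nat (a i) * g i)" for a :: "nat \<Rightarrow> nat"
  define e where "e x = cis (pi * x / real n)" for x :: real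
  have e_add: "e (x + y) = e x * e y" for x y
    by (simp add: e_def cis_mult add_divide_distrib distrib_left)
  have e_cnj: "cnj (e x) = e (- x)" for x by (simp add: e_def cis_cnj)
  \<comment> \<open>The positive definite form at the points \<open>\<pi> a\<close>, with a in the
    box \<open>F\<close> and the conjugate of the character \<theta> as coefficients. This makes
    \<open>W \<theta>\<close> nonnegative whatever relations hold among the
    \<open>g i\<close>.\<close>
  define W where "W \<theta> = (\<Sum>a\<in>F. \<Sum>b\<in>F. \<phi> (\<pi> a - \<pi> b) *
      (\<Prod>i<n. e ((real (b i) - real (a i)) * real (\<theta> i))))" for \<theta> :: "nat \<Rightarrow> nat"
  \<comment> \<open>The factor \<open>(2 * n) ^ n\<close> comes from the orthogonality of
    characters, the factor \<open>n ^ n\<close> from the size of the box \<open>F\<close>.\<close>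
  define N where "N = real n ^ n * real (2 * n) ^ n"
  have N: "N > 0" using n by (simp add: N_def)
  have F: "finite F" by (simp add: F_def finite_PiE)
  have W_nonneg: "W \<theta> \<in> \<real>\<^sub>\<ge>\<^sub>0" for \<theta>
  proof -
    define c where "c a = (\<Prod>i<n. e (- (real (a i) * real (\<theta> i))))" for a :: "nat \<Rightarrow> nat"
    have "c a * cnj (c b) = (\<Prod>i<n. e ((real (b i) - real (a i)) * real (\<theta> i)))" for a b
      unfolding c_def cnj_prod e_cnj prod.distrib[symmetric] e_add[symmetric]
      by (simp add: algebra_simps)
    hence "W \<theta> = (\<Sum>a\<in>F. \<Sum>b\<in>F. c a * cnj (c b) * \<phi> (\<pi> a - \<pi> b))"
      by (simp add: W_def mult_ac)
    thus ?thesis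
      using positive_definite_on_family[OF pd F, of \<pi> c] g by (simp add: \<pi>_def)
  qed
  define w where "w \<theta> = Re (W \<theta>) / N" for \<theta>
  have w: "of_real (w \<theta>) = W \<theta> / of_real N" for \<theta>
    using W_nonneg[of \<theta>] by (auto simp: w_def nonneg_Reals_def)
  \<comment> \<open>Entries of a and b differ by at most n - 1 and \<open>k i\<close> is at most n
    in absolute value, so each combined frequency stays below 2n and orthogonality detects exactly
    \<open>a = b + k\<close>.\<close>
  have ind: "(\<Sum>\<theta>\<in>\<Theta>. \<Prod>i<n. e (real_of_int (k i + int (b i) - int (a i)) * real (\<theta> i)))
      = of_real (real (2 * n) ^ n * (\<Prod>i<n. if int (a i) = int (b i) + k i then 1 else 0))"
    if k: "\<And>i. i < n \<Longrightarrow> \<bar>k i\<bar> \<le> int n" and ab: "a \<in> F" "b \<in> F" for k a b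
  proof -
    have "(\<Sum>\<theta>\<in>\<Theta>. \<Prod>i<n. e (real_of_int (k i + int (b i) - int (a i)) * real (\<theta> i)))
        = (\<Prod>i<n. \<Sum>t<2 * n. e (real_of_int (k i + int (b i) - int (a i)) * real t))"
      unfolding \<Theta>_def by (subst prod_sum_PiE) auto
    also have "\<dots> = (\<Prod>i<n. of_nat (2 * n) * (if int (a i) = int (b i) + k i then 1 else 0))"
    proof (rule prod.cong)
      fix i assume i: "i \<in> {..<n}"
      have "a i < n" "b i < n" using ab i by (auto simp: F_def PiE_iff)
      hence "\<bar>k i + int (b i) - int (a i)\<bar> < 2 * int n" using k[of i] i by auto
      from sum_roots_of_unity[OF n this]
      show "(\<Sum>t<2 * n. e (real_of_int (k i + int (b i) - int (a i)) * real t))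
          = of_nat (2 * n) * (if int (a i) = int (b i) + k i then 1 else 0)"
        unfolding e_def by auto
    qed simp
    also have "\<dots> = of_real (\<Prod>i<n. real (2 * n) * (if int (a i) = int (b i) + k i then 1 else 0))"
      unfolding of_real_prod by (intro prod.cong) auto
    finally show ?thesis by (simp add: prod.distrib)
  qed
  have "(\<Sum>\<theta>\<in>\<Theta>. of_real (w \<theta>) * (\<Prod>i<n. cis (pi * (real_of_int (k i) * real (\<theta> i)) / real n)))
      = \<phi> (\<Sum>i<n. of_int (k i) * g i) * of_real (\<Prod>i<n. 1 - real_of_int \<bar>k i\<bar> / real n)"
    (is "?L = ?R") if k: "\<And>i. i < n \<Longrightarrow> \<bar>k i\<bar> \<le> int n" for k :: "nat \<Rightarrow> int"
  proof -
    let ?I = "\<lambda>a b. \<Prod>i<n. if int (a i) = int (b i) + k i then 1 else 0 :: real"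
    have "?L = (\<Sum>\<theta>\<in>\<Theta>. W \<theta> * (\<Prod>i<n. e (real_of_int (k i) * real (\<theta> i)))) / of_real N"
      by (simp add: w e_def sum_divide_distrib)
    also have "(\<Sum>\<theta>\<in>\<Theta>. W \<theta> * (\<Prod>i<n. e (real_of_int (k i) * real (\<theta> i))))
      = (\<Sum>\<theta>\<in>\<Theta>. \<Sum>a\<in>F. \<Sum>b\<in>F. \<phi> (\<pi> a - \<pi> b) *
          (\<Prod>i<n. e (real_of_int (k i + int (b i) - int (a i)) * real (\<theta> i))))"
    proof (rule sum.cong)
      fix \<theta>
      have "(\<Prod>i<n. e (real_of_int (k i + int (b i) - int (a i)) * real (\<theta> i)))
        = (\<Prod>i<n. e ((real (b i) - real (a i)) * real (\<theta> i))) * (\<Prod>i<n. e (real_of_int (k i) * real (\<theta> i)))" for a b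
        unfolding prod.distrib[symmetric] e_add[symmetric]
        by (intro prod.cong refl arg_cong[of _ _ e]) (simp add: algebra_simps)
      thus "W \<theta> * (\<Prod>i<n. e (real_of_int (k i) * real (\<theta> i))) = (\<Sum>a\<in>F. \<Sum>b\<in>F. \<phi> (\<pi> a - \<pi> b) *
          (\<Prod>i<n. e (real_of_int (k i + int (b i) - int (a i)) * real (\<theta> i))))"
        by (simp add: W_def sum_distrib_right mult.assoc)
    qed simp
    also have "\<dots> = (\<Sum>a\<in>F. \<Sum>b\<in>F. \<phi> (\<pi> a - \<pi> b) *
        (\<Sum>\<theta>\<in>\<Theta>. \<Prod>i<n. e (real_of_int (k i + int (b i) - int (a i)) * real (\<theta> i))))"
      unfolding sum_distrib_left
      by (rule trans[OF sum.swap]) (intro sum.cong refl sum.swap)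
    also have "\<dots> = (\<Sum>a\<in>F. \<Sum>b\<in>F. \<phi> (\<pi> a - \<pi> b) * of_real (real (2 * n) ^ n * ?I a b))"
      using ind[OF k] by (intro sum.cong) auto
    \<comment> \<open>Only pairs with \<open>a = b + k\<close> survive. For all of them
      \<open>\<pi> a - \<pi> b\<close> is the same element, so \<phi> can be taken out of the
      sum.\<close>
    also have "\<dots> = (\<Sum>a\<in>F. \<Sum>b\<in>F. \<phi> (\<Sum>i<n. of_int (k i) * g i) * of_real (real (2 * n) ^ n * ?I a b))"
    proof (intro sum.cong refl)
      fix a b
      show "\<phi> (\<pi> a - \<pi> b) * of_real (real (2 * n) ^ n * ?I a b)
          = \<phi> (\<Sum>i<n. of_int (k i) * g i) * of_real (real (2 * n) ^ n * ?I a b)"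
      proof (cases "\<forall>i<n. int (a i) = int (b i) + k i")
        case True
        have "of_nat (a i) = (of_nat (b i) + of_int (k i) :: 'k)" if "i < n" for i
          using True that by (metis of_int_add of_int_of_nat_eq)
        hence "\<pi> a - \<pi> b = (\<Sum>i<n. of_int (k i) * g i)"
          unfolding \<pi>_def sum_subtractf[symmetric] by (intro sum.cong) (auto simp: algebra_simps)
        thus ?thesis by simp
      next
        case False
        hence "?I a b = 0" by (simp add: prod_zero_iff) blast
        thus ?thesis by simp
      qed
    qed
    also have "\<dots> = \<phi> (\<Sum>i<n. of_int (k i) * g i) * of_real (real (2 * n) ^ n * (\<Sum>a\<in>F. \<Sum>b\<in>F. ?I a b))"
      by (simp only: sum_distrib_left of_real_sum)
    also have "(\<Sum>a\<in>F. \<Sum>b\<in>F. ?I a b) = (\<Prod>i<n. real n - real_of_int \<bar>k i\<bar>)"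
      unfolding F_def by (rule sum_PiE_indicator[OF k])
    also have "\<dots> = (\<Prod>i<n. real n * (1 - real_of_int \<bar>k i\<bar> / real n))"
      using n by (intro prod.cong) (auto simp: field_simps)
    also have "\<dots> = real n ^ n * (\<Prod>i<n. 1 - real_of_int \<bar>k i\<bar> / real n)"
      by (simp add: prod.distrib)
    also have "\<phi> (\<Sum>i<n. of_int (k i) * g i) * of_real (real (2 * n) ^ n *
        (real n ^ n * (\<Prod>i<n. 1 - real_of_int \<bar>k i\<bar> / real n))) / of_real N = ?R"
      using n by (simp add: N_def field_simps)
    finally show ?thesis .
  qed
  moreover have "w \<theta> \<ge> 0" for \<theta>
    using W_nonneg[of \<theta>] N by (auto simp: w_def nonneg_Reals_def)
  ultimately show ?thesis using that by blast
qed

section \<open>Fejer measures on the real line and their weak limits\<close>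

lemma cis_sum: "finite A \<Longrightarrow> cis (\<Sum>i\<in>A. f i) = (\<Prod>i\<in>A. cis (f i))"
  by (induction A rule: finite_induct) (auto simp: cis_mult[symmetric])

text \<open>The grid of angles \<open>\<theta> / (2 * n)\<close> is lifted along the curve to points
  of [0,1]. Measures on tori of growing dimension n thus become measures on one fixed compact
  interval. The frequency 0 gives total mass \<open>\<phi> 0 = 1\<close>.\<close>

lemma fejer_measure:
  fixes \<phi> :: "'k::comm_ring_1 \<Rightarrow> complex" and g :: "nat \<Rightarrow> 'k"
  assumes pd: "positive_definite_on G \<phi>" and \<phi>0: "\<phi> 0 = 1" and n: "n > 0"
    and g: "\<And>a :: nat \<Rightarrow> nat. (\<Sum>i<n. of_nat (a i) * g i) \<in> G"
  obtains \<nu> :: "real measure" where "real_distribution \<nu>" "measure \<nu> {0..1} = 1"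
    "\<And>k :: nat \<Rightarrow> int. (\<And>i. i < n \<Longrightarrow> \<bar>k i\<bar> \<le> int n) \<Longrightarrow>
      (\<integral>t. cis (2 * pi * (\<Sum>i<n. real_of_int (k i) * schoenberg i t)) \<partial>\<nu>)
      = \<phi> (\<Sum>i<n. of_int (k i) * g i) * of_real (\<Prod>i<n. 1 - real_of_int \<bar>k i\<bar> / real n)"
proof -
  define \<Theta> where "\<Theta> = PiE {..<n} (\<lambda>_. {..<2 * n})"
  obtain w :: "(nat \<Rightarrow> nat) \<Rightarrow> real" where w0: "\<And>\<theta>. w \<theta> \<ge> 0" and
    w: "\<And>k :: nat \<Rightarrow> int. (\<And>i. i < n \<Longrightarrow> \<bar>k i\<bar> \<le> int n) \<Longrightarrow>
      (\<Sum>\<theta>\<in>\<Theta>. of_real (w \<theta>) * (\<Prod>i<n. cis (pi * (real_of_int (k i) * real (\<theta> i)) / real n)))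
      = \<phi> (\<Sum>i<n. of_int (k i) * g i) * of_real (\<Prod>i<n. 1 - real_of_int \<bar>k i\<bar> / real n)"
    using fejer_weights[OF pd n g] unfolding \<Theta>_def by blast
  have fin: "finite \<Theta>" by (simp add: \<Theta>_def finite_PiE)
  have "of_real (\<Sum>\<theta>\<in>\<Theta>. w \<theta>) = (1 :: complex)"
    using w[of "\<lambda>_. 0"] \<phi>0 by simp
  hence w1: "(\<Sum>\<theta>\<in>\<Theta>. w \<theta>) = 1" by (simp only: of_real_eq_1_iff)
  have "\<exists>t. t \<in> {0..1} \<and> (\<forall>i<n. schoenberg i t = real (\<theta> i) / (2 * real n))" if "\<theta> \<in> \<Theta>" for \<theta>
  proof -
    have "\<theta> i < 2 * n" if "i < n" for i
      using \<open>\<theta> \<in> \<Theta>\<close> that by (auto simp: \<Theta>_def PiE_iff)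
    hence "real (\<theta> i) < 2 * real n" if "i < n" for i
      using that by (metis of_nat_less_iff of_nat_mult of_nat_numeral)
    hence lt: "real (\<theta> i) / (2 * real n) < 1" if "i < n" for i using n that by simp
    \<comment> \<open>The grid prescribes only the first n coordinates; the default 0 puts the
      remaining ones into the range of \<open>schoenberg_surj\<close>.\<close>
    define x where "x i = (if i < n then real (\<theta> i) / (2 * real n) else 0)" for i
    have x: "0 \<le> x i" "x i < 1" for i using lt by (simp_all add: x_def)
    obtain t where "t \<in> {0..1}" "\<And>i. schoenberg i t = x i"
      by (rule schoenberg_surj[of x, OF x], rule that)
    thus ?thesis by (auto simp: x_def intro!: exI[of _ t])
  qed
  then obtain \<tau> where \<tau>: "\<And>\<theta>. \<theta> \<in> \<Theta> \<Longrightarrow> \<tau> \<theta> \<in> {0..1}"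
    "\<And>\<theta> i. \<theta> \<in> \<Theta> \<Longrightarrow> i < n \<Longrightarrow> schoenberg i (\<tau> \<theta>) = real (\<theta> i) / (2 * real n)"
    by metis
  define D where "D = point_measure \<Theta> (\<lambda>\<theta>. ennreal (w \<theta>))"
  have \<tau>_meas: "\<tau> \<in> borel_measurable D" by (simp add: D_def)
  have "emeasure D (space D) = 1"
    using w0 w1 fin
    by (simp add: D_def emeasure_point_measure_finite space_point_measure sum_ennreal)
  hence D: "prob_space D" by (rule prob_spaceI)
  interpret D: prob_space D by (rule D)
  define \<nu> where "\<nu> = distr D borel \<tau>"
  have "real_distribution \<nu>"
    unfolding \<nu>_def using D.real_distribution_distr[OF \<tau>_meas] .
  moreover have "measure \<nu> {0..1} = 1"
  proof -
    have "\<tau> -` {0..1} \<inter> space D = space D"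
      using \<tau>(1) by (auto simp: D_def space_point_measure)
    thus ?thesis by (simp add: \<nu>_def measure_distr[OF \<tau>_meas] D.prob_space)
  qed
  moreover have "(\<integral>t. cis (2 * pi * (\<Sum>i<n. real_of_int (k i) * schoenberg i t)) \<partial>\<nu>)
      = \<phi> (\<Sum>i<n. of_int (k i) * g i) * of_real (\<Prod>i<n. 1 - real_of_int \<bar>k i\<bar> / real n)"
    if "\<And>i. i < n \<Longrightarrow> \<bar>k i\<bar> \<le> int n" for k :: "nat \<Rightarrow> int"
  proof -
    have "continuous_on UNIV (\<lambda>t. cis (2 * pi * (\<Sum>i<n. real_of_int (k i) * schoenberg i t)))"
      by (intro continuous_intros continuous_schoenberg)
    hence "(\<lambda>t. cis (2 * pi * (\<Sum>i<n. real_of_int (k i) * schoenberg i t))) \<in> borel_measurable borel"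
      by (rule borel_measurable_continuous_onI)
    hence "(\<integral>t. cis (2 * pi * (\<Sum>i<n. real_of_int (k i) * schoenberg i t)) \<partial>\<nu>)
        = (\<integral>\<theta>. cis (2 * pi * (\<Sum>i<n. real_of_int (k i) * schoenberg i (\<tau> \<theta>))) \<partial>D)"
      unfolding \<nu>_def by (rule integral_distr[OF \<tau>_meas])
    also have "\<dots> = (\<Sum>\<theta>\<in>\<Theta>. w \<theta> *\<^sub>R cis (2 * pi * (\<Sum>i<n. real_of_int (k i) * schoenberg i (\<tau> \<theta>))))"
      unfolding D_def by (rule lebesgue_integral_point_measure_finite[OF fin w0])
    also have "\<dots> = (\<Sum>\<theta>\<in>\<Theta>. of_real (w \<theta>) * (\<Prod>i<n. cis (pi * (real_of_int (k i) * real (\<theta> i)) / real n)))"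
    proof (rule sum.cong)
      fix \<theta> assume \<theta>: "\<theta> \<in> \<Theta>"
      have "2 * pi * (\<Sum>i<n. real_of_int (k i) * schoenberg i (\<tau> \<theta>))
          = (\<Sum>i<n. pi * (real_of_int (k i) * real (\<theta> i)) / real n)"
        unfolding sum_distrib_left using \<tau>(2)[OF \<theta>] by (intro sum.cong) auto
      thus "w \<theta> *\<^sub>R cis (2 * pi * (\<Sum>i<n. real_of_int (k i) * schoenberg i (\<tau> \<theta>)))
          = of_real (w \<theta>) * (\<Prod>i<n. cis (pi * (real_of_int (k i) * real (\<theta> i)) / real n))"
        by (simp add: cis_sum scaleR_conv_of_real)
    qed simp
    also have "\<dots> = \<phi> (\<Sum>i<n. of_int (k i) * g i) * of_real (\<Prod>i<n. 1 - real_of_int \<bar>k i\<bar> / real n)"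
      by (rule w[OF that])
    finally show ?thesis .
  qed
  ultimately show ?thesis using that by blast
qed

text \<open>A trigonometric monomial involves finitely many coordinates, so its frequency is
  admissible from some n on and its Fejer factors tend to 1. As the curve is continuous, the
  monomial is a bounded continuous function of t, and its integral passes to the weak limit.\<close>

lemma torus_spectral_measure:
  fixes \<phi> :: "'k::comm_ring_1 \<Rightarrow> complex" and g :: "nat \<Rightarrow> 'k"
  assumes pd: "positive_definite_on G \<phi>" and \<phi>0: "\<phi> 0 = 1"
    and g: "\<And>n (a :: nat \<Rightarrow> nat). (\<Sum>i<n. of_nat (a i) * g i) \<in> G"
  obtains \<nu> :: "real measure" where "real_distribution \<nu>"
    "\<And>m (k :: nat \<Rightarrow> int).
      (\<integral>t. cis (2 * pi * (\<Sum>i<m. real_of_int (k i) * schoenberg i t)) \<partial>\<nu>) = \<phi> (\<Sum>i<m. of_int (k i) * g i)"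
proof -
  define Q where "Q n \<nu> \<longleftrightarrow> real_distribution \<nu> \<and> measure \<nu> {0..1} = 1 \<and>
    (\<forall>k :: nat \<Rightarrow> int. (\<forall>i < n. \<bar>k i\<bar> \<le> int n) \<longrightarrow>
      (\<integral>t. cis (2 * pi * (\<Sum>i<n. real_of_int (k i) * schoenberg i t)) \<partial>\<nu>)
      = \<phi> (\<Sum>i<n. of_int (k i) * g i) * of_real (\<Prod>i<n. 1 - real_of_int \<bar>k i\<bar> / real n))" for n \<nu>
  have "\<exists>\<nu>. Q (Suc n) \<nu>" for n
  proof -
    obtain \<nu> where "real_distribution \<nu>" "measure \<nu> {0..1} = 1"
      "\<And>k :: nat \<Rightarrow> int. (\<And>i. i < Suc n \<Longrightarrow> \<bar>k i\<bar> \<le> int (Suc n)) \<Longrightarrow>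
        (\<integral>t. cis (2 * pi * (\<Sum>i<Suc n. real_of_int (k i) * schoenberg i t)) \<partial>\<nu>)
        = \<phi> (\<Sum>i<Suc n. of_int (k i) * g i) * of_real (\<Prod>i<Suc n. 1 - real_of_int \<bar>k i\<bar> / real (Suc n))"
      by (rule fejer_measure[OF pd \<phi>0 zero_less_Suc[of n] g]) blast
    thus ?thesis unfolding Q_def by blast
  qed
  then obtain \<mu> where \<mu>: "\<And>n. Q (Suc n) (\<mu> n)" by metis
  have dist: "real_distribution (\<mu> n)" for n using \<mu> by (simp add: Q_def)
  have "tight \<mu>"
    unfolding tight_def
  proof (intro conjI allI impI dist)
    fix \<epsilon> :: real assume \<epsilon>: "\<epsilon> > 0"
    \<comment> \<open>Tightness asks for an interval open on the left; starting at -1 keeps the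
      point 0 inside.\<close>
    have "1 - \<epsilon> < measure (\<mu> n) {-1<..1}" for n
    proof -
      interpret real_distribution "\<mu> n" by (rule dist)
      have "1 = measure (\<mu> n) {0..1}" using \<mu> by (simp add: Q_def)
      also have "\<dots> \<le> measure (\<mu> n) {-1<..1}" by (rule finite_measure_mono) auto
      finally show ?thesis using \<epsilon> by simp
    qed
    thus "\<exists>a b. a < b \<and> (\<forall>n. 1 - \<epsilon> < measure (\<mu> n) {a<..b})"
      by (intro exI[of _ "-1"] exI[of _ 1]) auto
  qed
  from tight_imp_convergent_subsubsequence[OF this strict_mono_id] obtain r \<nu> where
    r: "strict_mono r" and \<nu>: "real_distribution \<nu>" and conv: "weak_conv_m (\<mu> \<circ> r) \<nu>"
    by (auto simp: comp_def)
  have "(\<integral>t. cis (2 * pi * (\<Sum>i<m. real_of_int (k i) * schoenberg i t)) \<partial>\<nu>) = \<phi> (\<Sum>i<m. of_int (k i) * g i)"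
    for m and k :: "nat \<Rightarrow> int"
  proof -
    \<comment> \<open>Frequencies extended by 0 let a monomial in m coordinates be tested against
      the measures of all larger dimensions.\<close>
    define k' where "k' i = (if i < m then k i else 0)" for i
    let ?U = "\<lambda>m t. cis (2 * pi * (\<Sum>i<m. real_of_int (k' i) * schoenberg i t))"
    obtain n0 :: nat where n0: "\<And>i. i < m \<Longrightarrow> \<bar>k i\<bar> \<le> int n0"
    proof -
      define n0 where "n0 = (\<Sum>i<m. nat \<bar>k i\<bar>)"
      have "nat \<bar>k i\<bar> \<le> n0" if "i < m" for i
        unfolding n0_def using that by (intro member_le_sum) auto
      hence "\<bar>k i\<bar> \<le> int n0" if "i < m" for i using that by (simp add: nat_le_iff)
      thus ?thesis using that by blast
    qed
    have lim1: "(\<lambda>n. \<integral>t. ?U m t \<partial>(\<mu> \<circ> r) n) \<longlonglongrightarrow> (\<integral>t. ?U m t \<partial>\<nu>)"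
    proof (rule weak_conv_imp_integral_bdd_continuous_conv[OF _ \<nu> conv, where B = 1])
      have "continuous_on UNIV (?U m)"
        by (intro continuous_intros continuous_schoenberg)
      thus "isCont (?U m) t" for t by (simp add: continuous_on_eq_continuous_at)
    qed (use dist in auto)
    have split: "(\<Sum>i<n. f i) = (\<Sum>i<m. f i)" if "n \<ge> m" "\<And>i. i \<ge> m \<Longrightarrow> f i = 0"
      for n and f :: "nat \<Rightarrow> 'c::comm_monoid_add"
      using that by (intro sum.mono_neutral_right) auto
    have ev: "\<forall>\<^sub>F n in sequentially. (\<integral>t. ?U m t \<partial>(\<mu> \<circ> r) n)
        = \<phi> (\<Sum>i<m. of_int (k' i) * g i) * of_real (\<Prod>i<m. 1 - real_of_int \<bar>k i\<bar> / real (Suc (r n)))"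
      using eventually_ge_at_top[of "max m n0"]
    proof eventually_elim
      case (elim n)
      have rn: "n \<le> r n" by (rule seq_suble[OF r])
      define s where "s = Suc (r n)"
      have s: "m \<le> s" "n0 \<le> s" using elim rn by (auto simp: s_def)
      have "(\<integral>t. ?U m t \<partial>(\<mu> \<circ> r) n) = (\<integral>t. ?U s t \<partial>\<mu> (r n))"
        unfolding comp_def
        by (intro Bochner_Integration.integral_cong refl arg_cong[of _ _ cis] arg_cong2[of _ _ _ _ "(*)"]
            split[symmetric] s) (simp add: k'_def)
      also have "\<dots> = \<phi> (\<Sum>i<s. of_int (k' i) * g i) * of_real (\<Prod>i<s. 1 - real_of_int \<bar>k' i\<bar> / real s)"
      proof -
        have "\<forall>i<s. \<bar>k' i\<bar> \<le> int s" using n0 s by (force simp: k'_def)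
        thus ?thesis using \<mu>[of "r n"] by (simp add: Q_def s_def)
      qed
      also have "(\<Sum>i<s. of_int (k' i) * g i) = (\<Sum>i<m. of_int (k' i) * g i)"
        by (rule split[OF s(1)]) (simp add: k'_def)
      also have "(\<Prod>i<s. 1 - real_of_int \<bar>k' i\<bar> / real s) = (\<Prod>i<m. 1 - real_of_int \<bar>k' i\<bar> / real s)"
        using s by (intro prod.mono_neutral_right) (auto simp: k'_def)
      also have "\<dots> = (\<Prod>i<m. 1 - real_of_int \<bar>k i\<bar> / real s)"
        by (intro prod.cong) (auto simp: k'_def)
      finally show ?case by (simp add: s_def)
    qed
    have "(\<lambda>n. real_of_int \<bar>k i\<bar> / real (Suc n)) \<longlonglongrightarrow> 0" for i
      using LIMSEQ_Suc[OF lim_const_over_n[of "real_of_int \<bar>k i\<bar>"]] by simp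
    hence "(\<lambda>n. real_of_int \<bar>k i\<bar> / real (Suc (r n))) \<longlonglongrightarrow> 0" for i
      using LIMSEQ_subseq_LIMSEQ[OF _ r] by (force simp: comp_def)
    hence "(\<lambda>n. \<phi> (\<Sum>i<m. of_int (k' i) * g i) * of_real (\<Prod>i<m. 1 - real_of_int \<bar>k i\<bar> / real (Suc (r n))))
       \<longlonglongrightarrow> \<phi> (\<Sum>i<m. of_int (k' i) * g i) * of_real (\<Prod>i<m. 1 - 0)"
      by (intro tendsto_intros)
    hence "(\<lambda>n. \<integral>t. ?U m t \<partial>(\<mu> \<circ> r) n) \<longlonglongrightarrow> \<phi> (\<Sum>i<m. of_int (k' i) * g i)"
      using tendsto_cong[OF ev] by simp
    from LIMSEQ_unique[OF lim1 this] show ?thesis by (simp add: k'_def)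
  qed
  thus ?thesis using that \<nu> by blast
qed

text \<open>The equality case of the triangle inequality: \<open>1 - Re (U x)\<close> is nonnegative
  with integral 0, and on the unit circle real part 1 forces the value 1.\<close>

lemma (in prob_space) AE_eq_1_if_integral_eq_1:
  fixes U :: "'a \<Rightarrow> complex"
  assumes [measurable]: "U \<in> borel_measurable M" and U: "\<And>x. norm (U x) = 1" and int: "(\<integral>x. U x \<partial>M) = 1"
  shows "AE x in M. U x = 1"
proof -
  have iU: "integrable M U"
    by (rule integrable_const_bound[of _ 1]) (use U in auto)
  have Re_le: "Re (U x) \<le> 1" for x using complex_Re_le_cmod[of "U x"] U[of x] by simp
  have "(\<integral>x. 1 - Re (U x) \<partial>M) = 0"
    using iU int by (simp add: prob_space integral_Re)
  hence "AE x in M. 1 - Re (U x) = 0"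
    using iU Re_le by (subst (asm) integral_nonneg_eq_0_iff_AE) auto
  thus ?thesis
  proof eventually_elim
    case (elim x)
    hence "Re (U x) = 1" by simp
    moreover have "(Re (U x))\<^sup>2 + (Im (U x))\<^sup>2 = 1" using U[of x] by (simp add: cmod_def)
    ultimately show ?case by (simp add: complex_eq_iff)
  qed
qed

text \<open>All elements of G are taken as generators, which presents G through a free abelian group
  whose dual is the infinite torus. Each relation \<open>a + b - (a + b) = 0\<close> is a monomial
  with integral \<open>\<phi> 0 = 1\<close>, hence equal to 1 almost everywhere; so the measure is
  carried by the parameters that respect the relations of G.\<close>

theorem herglotz_bochner:
  fixes \<phi> :: "'k::comm_ring_1 \<Rightarrow> complex"
  assumes G: "countable G" "0 \<in> G" "\<And>a b. a \<in> G \<Longrightarrow> b \<in> G \<Longrightarrow> a + b \<in> G"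
    and pd: "positive_definite_on G \<phi>" and \<phi>0: "\<phi> 0 = 1"
  obtains \<nu> :: "real measure" and X :: "'k \<Rightarrow> real \<Rightarrow> complex" where
    "real_distribution \<nu>" "\<And>a. X a \<in> borel_measurable borel" "\<And>a t. norm (X a t) = 1"
    "AE t in \<nu>. \<forall>a\<in>G. \<forall>b\<in>G. X (a + b) t = X a t * X b t"
    "\<And>a. a \<in> G \<Longrightarrow> \<phi> a = (\<integral>t. X a t \<partial>\<nu>)"
proof -
  define g where "g = from_nat_into G"
  have gG: "g i \<in> G" for i unfolding g_def by (rule from_nat_into) (use G in auto)
  have mult: "of_nat n * a \<in> G" if "a \<in> G" for n a
    by (induction n) (use G that in \<open>auto simp: distrib_right\<close>)
  have comb: "(\<Sum>i<n. of_nat (a i) * g i) \<in> G" for n and a :: "nat \<Rightarrow> nat"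
    by (induction n) (use G mult gG in auto)
  obtain \<nu> :: "real measure" where \<nu>: "real_distribution \<nu>" and
    int: "\<And>m (k :: nat \<Rightarrow> int).
      (\<integral>t. cis (2 * pi * (\<Sum>i<m. real_of_int (k i) * schoenberg i t)) \<partial>\<nu>) = \<phi> (\<Sum>i<m. of_int (k i) * g i)"
    using torus_spectral_measure[OF pd \<phi>0 comb] by blast
  interpret real_distribution \<nu> by (rule \<nu>)
  define d where "d = to_nat_on G"
  have gd: "g (d a) = a" if "a \<in> G" for a
    using G(1) that by (simp add: g_def d_def)
  define X where "X a t = cis (2 * pi * schoenberg (d a) t)" for a t
  have X_meas [measurable]: "X a \<in> borel_measurable borel" for a
    unfolding X_def by (intro borel_measurable_continuous_onI continuous_intros continuous_schoenberg)
  have "\<phi> a = (\<integral>t. X a t \<partial>\<nu>)" if "a \<in> G" for a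
    using int[of "\<lambda>i. if i = d a then 1 else 0" "Suc (d a)"] gd[OF that]
    by (simp add: X_def if_distrib[of "\<lambda>x. x * _"] if_distrib[of real_of_int] if_distrib[of of_int] cong: if_cong)
  moreover have "AE t in \<nu>. X (a + b) t = X a t * X b t" if ab: "a \<in> G" "b \<in> G" for a b
  proof -
    \<comment> \<open>A sum of indicators rather than a case distinction, since the three indices
      may coincide.\<close>
    define k :: "nat \<Rightarrow> int" where
      "k i = (if i = d a then 1 else 0) + (if i = d b then 1 else 0) - (if i = d (a + b) then 1 else 0)" for i
    define m where "m = Suc (max (d a) (max (d b) (d (a + b))))"
    have m: "d a < m" "d b < m" "d (a + b) < m" by (auto simp: m_def)
    have k_sum: "(\<Sum>i<m. of_int (k i) * h i) = h (d a) + h (d b) - h (d (a + b))" for h :: "nat \<Rightarrow> 'c::comm_ring_1"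
    proof -
      have "(\<Sum>i<m. of_int (k i) * h i) = (\<Sum>i<m. (if i = d a then h i else 0) + (if i = d b then h i else 0) - (if i = d (a + b) then h i else 0))"
        by (intro sum.cong) (auto simp: k_def)
      thus ?thesis using m by (simp add: sum.distrib sum_subtractf)
    qed
    have "(\<integral>t. cis (2 * pi * (\<Sum>i<m. real_of_int (k i) * schoenberg i t)) \<partial>\<nu>) = 1"
    proof -
      have "(\<Sum>i<m. of_int (k i) * g i) = 0" unfolding k_sum using gd ab G(3) by simp
      thus ?thesis using int[of k m] \<phi>0 by simp
    qed
    moreover have "(\<lambda>t. cis (2 * pi * (\<Sum>i<m. real_of_int (k i) * schoenberg i t))) \<in> borel_measurable borel"
      by (intro borel_measurable_continuous_onI continuous_intros continuous_schoenberg)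
    hence "(\<lambda>t. cis (2 * pi * (\<Sum>i<m. real_of_int (k i) * schoenberg i t))) \<in> borel_measurable \<nu>"
      by (simp add: measurable_cong_sets[OF events_eq_borel refl])
    ultimately have "AE t in \<nu>. cis (2 * pi * (\<Sum>i<m. real_of_int (k i) * schoenberg i t)) = 1"
      by (intro AE_eq_1_if_integral_eq_1) auto
    thus ?thesis
    proof eventually_elim
      case (elim t)
      have "cis (2 * pi * (schoenberg (d a) t + schoenberg (d b) t - schoenberg (d (a + b)) t)) = X a t * X b t / X (a + b) t"
        by (simp add: X_def cis_mult cis_divide algebra_simps)
      moreover have "X (a + b) t \<noteq> 0" by (simp add: X_def)
      ultimately show ?case using elim unfolding k_sum by (simp add: divide_eq_1_iff)
    qed
  qed
  hence "AE t in \<nu>. \<forall>a\<in>G. \<forall>b\<in>G. X (a + b) t = X a t * X b t"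
    using G(1) by (simp add: AE_ball_countable)
  ultimately show ?thesis
    using that[OF \<nu>, of X] by (simp add: X_def)
qed

section \<open>Completeness of \<open>L\<^sup>2\<close>\<close>

lemma norm_add_sq_le: "(norm (a + b))\<^sup>2 \<le> 2 * (norm a)\<^sup>2 + 2 * (norm (b :: 'a::real_normed_vector))\<^sup>2"
proof -
  have "(norm (a + b))\<^sup>2 \<le> (norm a + norm b)\<^sup>2"
    by (intro power_mono norm_triangle_ineq) simp
  also have "\<dots> \<le> 2 * (norm a)\<^sup>2 + 2 * (norm b)\<^sup>2"
    using zero_le_power2[of "norm a - norm b"] by (simp add: power2_eq_square algebra_simps)
  finally show ?thesis .
qed

text \<open>Stands in for the Cauchy-Schwarz inequality: integrated over a probability space, it
  bounds an L1 norm by a squared L2 norm, with \<epsilon> left free for optimisation.\<close>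

lemma le_eps_plus_sq: 
  fixes x \<epsilon> :: real
  assumes "\<epsilon> > 0"
  shows "x \<le> \<epsilon> + x\<^sup>2 / \<epsilon>"
proof (cases "x \<le> \<epsilon>")
  case False
  hence "x * \<epsilon> \<le> x * x" using assms by (intro mult_left_mono) auto
  hence "x \<le> x\<^sup>2 / \<epsilon>" using assms by (simp add: field_simps power2_eq_square)
  thus ?thesis using assms by simp
qed (use assms in \<open>simp add: add_increasing2\<close>)

text \<open>The Riesz-Fischer argument: a subsequence with summable L1 increments converges almost
  everywhere, and Fatou's lemma turns the Cauchy estimate into convergence of the whole sequence to
  its limit.\<close>

lemma (in prob_space) L2_complete:
  fixes h :: "nat \<Rightarrow> 'a \<Rightarrow> complex"
  assumes [measurable]: "\<And>k. h k \<in> borel_measurable M"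
    and Cauchy: "\<And>\<epsilon>. \<epsilon> > 0 \<Longrightarrow> \<exists>N. \<forall>i\<ge>N. \<forall>j\<ge>N. (\<integral>\<^sup>+x. ennreal ((norm (h i x - h j x))\<^sup>2) \<partial>M) \<le> ennreal \<epsilon>"
  obtains g where "g \<in> borel_measurable M"
    "(\<lambda>i. \<integral>\<^sup>+x. ennreal ((norm (h i x - g x))\<^sup>2) \<partial>M) \<longlonglongrightarrow> 0"
proof -
  have "\<exists>N. \<forall>i\<ge>N. \<forall>j\<ge>N. (\<integral>\<^sup>+x. ennreal ((norm (h i x - h j x))\<^sup>2) \<partial>M) \<le> ennreal ((1/4) ^ k)" for k
    by (rule Cauchy) simp
  then obtain N where N: "\<And>k i j. N k \<le> i \<Longrightarrow> N k \<le> j \<Longrightarrow>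
      (\<integral>\<^sup>+x. ennreal ((norm (h i x - h j x))\<^sup>2) \<partial>M) \<le> ennreal ((1/4) ^ k)"
    by metis
  \<comment> \<open>A partial sum dominates each of its terms, so all \<open>r l\<close> with
    \<open>l \<ge> k\<close> lie beyond \<open>N k\<close>.\<close>
  define r where "r k = (\<Sum>l\<le>k. N l)" for k
  have r_ge: "N k \<le> r l" if "k \<le> l" for k l
    unfolding r_def using that by (intro member_le_sum) auto
  define d where "d k x = norm (h (r (Suc k)) x - h (r k) x)" for k x
  have [measurable]: "d k \<in> borel_measurable M" for k unfolding d_def by measurable
  have d_int: "(\<integral>\<^sup>+x. ennreal (d k x) \<partial>M) \<le> ennreal (2 * (1/2) ^ k)" for k
  proof -
    have "(\<integral>\<^sup>+x. ennreal (d k x) \<partial>M) \<le> (\<integral>\<^sup>+x. ennreal ((1/2) ^ k) + ennreal (2 ^ k) * ennreal ((d k x)\<^sup>2) \<partial>M)"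
    proof (rule nn_integral_mono)
      fix x
      \<comment> \<open>For squared distances of at most (1/4)^k, the choice \<epsilon> = (1/2)^k
        makes both terms contribute (1/2)^k.\<close>
      have "d k x \<le> (1/2) ^ k + 2 ^ k * (d k x)\<^sup>2"
        using le_eps_plus_sq[of "(1/2) ^ k" "d k x"] by (simp add: power_one_over field_simps)
      thus "ennreal (d k x) \<le> ennreal ((1/2) ^ k) + ennreal (2 ^ k) * ennreal ((d k x)\<^sup>2)"
        by (simp add: ennreal_mult[symmetric] ennreal_plus[symmetric] ennreal_leI del: ennreal_plus)
    qed
    also have "\<dots> = ennreal ((1/2) ^ k) + ennreal (2 ^ k) * (\<integral>\<^sup>+x. ennreal ((d k x)\<^sup>2) \<partial>M)"
      by (subst nn_integral_add) (auto simp: nn_integral_cmult emeasure_space_1)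
    also have "\<dots> \<le> ennreal ((1/2) ^ k) + ennreal (2 ^ k) * ennreal ((1/4) ^ k)"
      unfolding d_def by (intro add_left_mono mult_left_mono N r_ge) auto
    also have "ennreal (2 ^ k) * ennreal ((1/4) ^ k) = ennreal ((1/2) ^ k)"
      by (subst ennreal_mult[symmetric]) (auto simp: power_mult_distrib[symmetric])
    also have "ennreal ((1/2) ^ k) + ennreal ((1/2) ^ k) = ennreal (2 * (1/2) ^ k)"
      by (subst ennreal_plus[symmetric]) auto
    finally show ?thesis .
  qed
  have "(\<integral>\<^sup>+x. (\<Sum>k. ennreal (d k x)) \<partial>M) = (\<Sum>k. \<integral>\<^sup>+x. ennreal (d k x) \<partial>M)"
    by (rule nn_integral_suminf) measurable
  also have "\<dots> \<le> (\<Sum>k. ennreal (2 * (1/2) ^ k))"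
    by (intro suminf_le d_int) auto
  also have "\<dots> = ennreal (\<Sum>k. 2 * (1/2) ^ k)"
    by (intro suminf_ennreal2 summable_mult summable_geometric) auto
  also have "\<dots> < \<infinity>" by simp
  finally have "AE x in M. (\<Sum>k. ennreal (d k x)) \<noteq> \<infinity>"
    by (intro nn_integral_PInf_AE) auto
  hence conv: "AE x in M. convergent (\<lambda>k. h (r k) x)"
  proof eventually_elim
    case (elim x)
    have "summable (\<lambda>k. d k x)"
      by (rule summable_suminf_not_top) (use elim in \<open>auto simp: d_def\<close>)
    hence "summable (\<lambda>k. h (r (Suc k)) x - h (r k) x)"
      unfolding d_def by (rule summable_norm_cancel)
    hence "convergent (\<lambda>n. \<Sum>k<n. h (r (Suc k)) x - h (r k) x)"
      by (simp add: summable_iff_convergent)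
    hence "convergent (\<lambda>n. h (r n) x - h (r 0) x)"
      by (simp add: sum_lessThan_telescope[of "\<lambda>k. h (r k) x"])
    from convergent_add[OF this convergent_const[of "h (r 0) x"]] show ?case by simp
  qed
  define g where "g x = lim (\<lambda>k. h (r k) x)" for x
  have [measurable]: "g \<in> borel_measurable M"
    unfolding g_def by (rule borel_measurable_lim_metric) measurable
  have bound: "(\<integral>\<^sup>+x. ennreal ((norm (h i x - g x))\<^sup>2) \<partial>M) \<le> ennreal ((1/4) ^ k)" if i: "i \<ge> N k" for i k
  proof -
    have "(\<integral>\<^sup>+x. ennreal ((norm (h i x - g x))\<^sup>2) \<partial>M)
        = (\<integral>\<^sup>+x. liminf (\<lambda>j. ennreal ((norm (h i x - h (r j) x))\<^sup>2)) \<partial>M)"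
    proof (rule nn_integral_cong_AE)
      show "AE x in M. ennreal ((norm (h i x - g x))\<^sup>2) = liminf (\<lambda>j. ennreal ((norm (h i x - h (r j) x))\<^sup>2))"
        using conv
      proof eventually_elim
        case (elim x)
        hence "(\<lambda>j. h (r j) x) \<longlonglongrightarrow> g x" by (simp add: g_def convergent_LIMSEQ_iff)
        hence "(\<lambda>j. ennreal ((norm (h i x - h (r j) x))\<^sup>2)) \<longlonglongrightarrow> ennreal ((norm (h i x - g x))\<^sup>2)"
          by (intro tendsto_intros)
        thus ?case by (intro lim_imp_Liminf[symmetric]) auto
      qed
    qed
    also have "\<dots> \<le> liminf (\<lambda>j. \<integral>\<^sup>+x. ennreal ((norm (h i x - h (r j) x))\<^sup>2) \<partial>M)"
      by (rule nn_integral_liminf) measurable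
    also have "\<dots> \<le> limsup (\<lambda>j. \<integral>\<^sup>+x. ennreal ((norm (h i x - h (r j) x))\<^sup>2) \<partial>M)"
      by (rule Liminf_le_Limsup) simp
    also have "\<dots> \<le> ennreal ((1/4) ^ k)"
    proof (rule Limsup_bounded)
      show "\<forall>\<^sub>F j in sequentially. (\<integral>\<^sup>+x. ennreal ((norm (h i x - h (r j) x))\<^sup>2) \<partial>M) \<le> ennreal ((1/4) ^ k)"
        using eventually_ge_at_top[of k] by eventually_elim (intro N i r_ge)
    qed
    finally show ?thesis .
  qed
  have "(\<lambda>i. \<integral>\<^sup>+x. ennreal ((norm (h i x - g x))\<^sup>2) \<partial>M) \<longlonglongrightarrow> 0"
  proof (rule order_tendstoI)
    fix e :: ennreal assume e: "0 < e"
    have "(\<lambda>k. ennreal ((1/4) ^ k)) \<longlonglongrightarrow> ennreal 0"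
      by (intro tendsto_ennrealI LIMSEQ_power_zero) simp
    hence "\<forall>\<^sub>F k in sequentially. ennreal ((1/4) ^ k) < e"
      using e by (intro order_tendstoD(2)) auto
    then obtain k where k: "ennreal ((1/4) ^ k) < e" by (auto simp: eventually_sequentially)
    show "\<forall>\<^sub>F i in sequentially. (\<integral>\<^sup>+x. ennreal ((norm (h i x - g x))\<^sup>2) \<partial>M) < e"
      using eventually_ge_at_top[of "N k"] by eventually_elim (use bound k in \<open>auto intro: le_less_trans\<close>)
  qed simp
  thus ?thesis by (rule that[rotated]) measurable
qed

section \<open>Spectral measures of measure-preserving systems\<close>

text \<open>Shifting the set by n multiplies the sum by \<open>\<psi> n\<close> and changes it by at
  most the size of the symmetric difference; since \<open>\<psi> n \<noteq> 1\<close>, the factor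
  \<open>\<psi> n - 1\<close> can be divided out.\<close>

lemma folner_average_character:
  assumes \<Phi>: "folner R \<Phi>" and \<psi>: "add_character R \<psi>" and n: "n \<in> R" "\<psi> n \<noteq> 1"
  shows "(\<lambda>N. average (\<Phi> N) \<psi>) \<longlonglongrightarrow> 0"
proof -
  have fin: "finite (\<Phi> N)" and ne: "\<Phi> N \<noteq> {}" and sub: "x \<in> \<Phi> N \<Longrightarrow> x \<in> R" for N x
    using \<Phi> by (auto simp: folner_def)
  define q where "q N = real (card (sym_diff (\<Phi> N) ((\<lambda>x. x + n) ` \<Phi> N))) / real (card (\<Phi> N))" for N
  have q: "q \<longlonglongrightarrow> 0" using \<Phi> n(1) unfolding q_def folner_def by blast
  have est: "norm ((\<psi> n - 1) * average (\<Phi> N) \<psi>) \<le> q N" for N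
  proof -
    define B where "B = (\<lambda>x. x + n) ` \<Phi> N"
    have finB: "finite B" using fin by (simp add: B_def)
    have norm1: "norm (\<psi> x) \<le> 1" if "x \<in> \<Phi> N \<union> B" for x
    proof (cases "x \<in> \<Phi> N")
      case True
      hence "x \<in> R" by (rule sub)
      thus ?thesis using \<psi> by (auto simp: add_character_def)
    next
      case False
      then obtain y where "y \<in> \<Phi> N" "x = y + n" using \<open>x \<in> \<Phi> N \<union> B\<close> by (auto simp: B_def)
      hence "\<psi> x = \<psi> y * \<psi> n" "norm (\<psi> y) = 1" "norm (\<psi> n) = 1"
        using \<psi> sub n by (auto simp: add_character_def)
      thus ?thesis by (simp add: norm_mult)
    qed
    have "(\<Sum>x\<in>B. \<psi> x) = (\<Sum>x\<in>\<Phi> N. \<psi> (x + n))"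
      unfolding B_def by (subst sum.reindex) (auto simp: inj_on_def)
    also have "\<dots> = (\<Sum>x\<in>\<Phi> N. \<psi> n * \<psi> x)"
      using \<psi> sub n by (intro sum.cong) (auto simp: add_character_def mult.commute)
    finally have "(\<Sum>x\<in>B. \<psi> x) = \<psi> n * (\<Sum>x\<in>\<Phi> N. \<psi> x)"
      by (simp only: sum_distrib_left)
    hence "(\<psi> n - 1) * (\<Sum>x\<in>\<Phi> N. \<psi> x) = (\<Sum>x\<in>B. \<psi> x) - (\<Sum>x\<in>\<Phi> N. \<psi> x)"
      by (simp add: algebra_simps)
    also have "\<dots> = (\<Sum>x\<in>B - \<Phi> N. \<psi> x) - (\<Sum>x\<in>\<Phi> N - B. \<psi> x)"
      using sum.Int_Diff[OF finB, of \<psi> "\<Phi> N"] sum.Int_Diff[OF fin, of \<psi> N B] by (simp add: Int_commute)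
    also have "norm \<dots> \<le> real (card (B - \<Phi> N)) + real (card (\<Phi> N - B))"
    proof -
      have "norm (\<Sum>x\<in>B - \<Phi> N. \<psi> x) \<le> (\<Sum>x\<in>B - \<Phi> N. 1)"
        by (rule sum_norm_le) (use norm1 in auto)
      moreover have "norm (\<Sum>x\<in>\<Phi> N - B. \<psi> x) \<le> (\<Sum>x\<in>\<Phi> N - B. 1)"
        by (rule sum_norm_le) (use norm1 in auto)
      ultimately show ?thesis
        using norm_triangle_ineq4[of "\<Sum>x\<in>B - \<Phi> N. \<psi> x" "\<Sum>x\<in>\<Phi> N - B. \<psi> x"] by simp
    qed
    also have "\<dots> = real (card (sym_diff (\<Phi> N) B))"
      using fin finB by (subst card_Un_disjoint) auto
    finally have "norm ((\<psi> n - 1) * (\<Sum>x\<in>\<Phi> N. \<psi> x)) \<le> real (card (sym_diff (\<Phi> N) B))" .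
    hence "norm ((\<psi> n - 1) * (\<Sum>x\<in>\<Phi> N. \<psi> x)) / real (card (\<Phi> N)) \<le> q N"
      by (auto simp: q_def B_def intro: divide_right_mono)
    thus ?thesis by (simp add: average_def norm_divide norm_mult)
  qed
  have "(\<lambda>N. (\<psi> n - 1) * average (\<Phi> N) \<psi>) \<longlonglongrightarrow> 0"
    by (rule Lim_null_comparison[OF _ q]) (use est in auto)
  thus ?thesis using n(2) by (subst (asm) tendsto_mult_left_iff[of "\<psi> n - 1" _ 0, simplified]) auto
qed

section \<open>Gram matrices and isometries between L2 spaces\<close>

lemma L2_integrable_mult_cnj:
  assumes "L2 M u" "L2 M v"
  shows "integrable M (\<lambda>x. u x * cnj (v x))"
proof (rule Bochner_Integration.integrable_bound)
  show "integrable M (\<lambda>x. (norm (u x))\<^sup>2 + (norm (v x))\<^sup>2)"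
    using assms by (auto simp: L2_def)
  show "(\<lambda>x. u x * cnj (v x)) \<in> borel_measurable M"
    using assms by (auto simp: L2_def intro!: borel_measurable_times borel_measurable_continuous_on[of cnj] continuous_intros)
  have "norm (u x * cnj (v x)) \<le> (norm (u x))\<^sup>2 + (norm (v x))\<^sup>2" for x
    using sum_squares_bound[of "norm (u x)" "norm (v x)"] zero_le_power2[of "norm (u x)"] zero_le_power2[of "norm (v x)"]
    unfolding norm_mult complex_mod_cnj using mult_nonneg_nonneg[of "norm (u x)" "norm (v x)"] by linarith
  thus "AE x in M. norm (u x * cnj (v x)) \<le> norm ((norm (u x))\<^sup>2 + (norm (v x))\<^sup>2)" by simp
qed

lemma integral_norm_sum_sq:
  assumes "finite J" and L2: "\<And>i. i \<in> J \<Longrightarrow> L2 M (u i)"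
  shows "integrable M (\<lambda>x. (norm (\<Sum>i\<in>J. c i * u i x))\<^sup>2)"
    and "of_real (\<integral>x. (norm (\<Sum>i\<in>J. c i * u i x))\<^sup>2 \<partial>M)
      = (\<Sum>i\<in>J. \<Sum>j\<in>J. c i * cnj (c j) * (\<integral>x. u i x * cnj (u j x) \<partial>M))"
proof -
  have eq: "of_real ((norm (\<Sum>i\<in>J. c i * u i x))\<^sup>2) = (\<Sum>i\<in>J. \<Sum>j\<in>J. c i * cnj (c j) * (u i x * cnj (u j x)))" for x
    unfolding complex_norm_square by (simp add: sum_product mult_ac)
  have int: "integrable M (\<lambda>x. \<Sum>i\<in>J. \<Sum>j\<in>J. c i * cnj (c j) * (u i x * cnj (u j x)))"
    using L2 by (intro Bochner_Integration.integrable_sum integrable_mult_right L2_integrable_mult_cnj)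
  hence "integrable M (\<lambda>x. of_real ((norm (\<Sum>i\<in>J. c i * u i x))\<^sup>2) :: complex)"
    unfolding eq .
  thus "integrable M (\<lambda>x. (norm (\<Sum>i\<in>J. c i * u i x))\<^sup>2)"
    by (simp only: complex_of_real_integrable_eq)
  have "of_real (\<integral>x. (norm (\<Sum>i\<in>J. c i * u i x))\<^sup>2 \<partial>M)
      = (\<integral>x. of_real ((norm (\<Sum>i\<in>J. c i * u i x))\<^sup>2) \<partial>M :: complex)" by (rule integral_complex_of_real[symmetric])
  also have "\<dots> = (\<Sum>i\<in>J. \<Sum>j\<in>J. c i * cnj (c j) * (\<integral>x. u i x * cnj (u j x) \<partial>M))"
    unfolding eq using L2
    by (simp add: Bochner_Integration.integral_sum Bochner_Integration.integrable_sum L2_integrable_mult_cnj)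
  finally show "of_real (\<integral>x. (norm (\<Sum>i\<in>J. c i * u i x))\<^sup>2 \<partial>M)
      = (\<Sum>i\<in>J. \<Sum>j\<in>J. c i * cnj (c j) * (\<integral>x. u i x * cnj (u j x) \<partial>M))" .
qed

text \<open>Norms of linear combinations depend only on the Gram matrix. This carries every estimate
  from the system to the spectral side; the factor s is there because \<nu> will be normalised to
  mass 1.\<close>

lemma L2_isometry:
  fixes s :: real
  assumes "finite J" "\<And>i. i \<in> J \<Longrightarrow> L2 M (u i)" "\<And>i. i \<in> J \<Longrightarrow> L2 \<nu> (v i)"
    and eq: "\<And>i j. i \<in> J \<Longrightarrow> j \<in> J \<Longrightarrow>
      (\<integral>x. u i x * cnj (u j x) \<partial>M) = of_real s * (\<integral>x. v i x * cnj (v j x) \<partial>\<nu>)"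
  shows "(\<integral>\<^sup>+x. ennreal ((norm (\<Sum>i\<in>J. c i * u i x))\<^sup>2) \<partial>M)
    = ennreal (s * (\<integral>x. (norm (\<Sum>i\<in>J. c i * v i x))\<^sup>2 \<partial>\<nu>))"
proof -
  have "of_real (\<integral>x. (norm (\<Sum>i\<in>J. c i * u i x))\<^sup>2 \<partial>M)
      = (of_real (s * (\<integral>x. (norm (\<Sum>i\<in>J. c i * v i x))\<^sup>2 \<partial>\<nu>)) :: complex)"
    using assms by (simp add: integral_norm_sum_sq(2) sum_distrib_left mult_ac)
  hence "(\<integral>x. (norm (\<Sum>i\<in>J. c i * u i x))\<^sup>2 \<partial>M) = s * (\<integral>x. (norm (\<Sum>i\<in>J. c i * v i x))\<^sup>2 \<partial>\<nu>)"
    by (simp only: of_real_eq_iff)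
  thus ?thesis
    using integral_norm_sum_sq(1)[OF assms(1,2)] by (simp add: nn_integral_eq_integral)
qed

section \<open>Correlations, spectral measures and the zero-one law\<close>

locale ring_system =
  fixes R :: "'k::field set" and M :: "'x measure" and T :: "'k \<Rightarrow> 'x \<Rightarrow> 'x"
  assumes R: "is_subring R" and cR: "countable R" and sys: "measure_preserving_system R M T"
begin

sublocale prob_space M
  using sys by (simp add: measure_preserving_system_def standard_prob_space_def)

lemma T_measurable: "n \<in> R \<Longrightarrow> T n \<in> measurable M M"
  and T_distr: "n \<in> R \<Longrightarrow> distr M M (T n) = M"
  and T_0: "x \<in> space M \<Longrightarrow> T 0 x = x"
  and T_add: "m \<in> R \<Longrightarrow> n \<in> R \<Longrightarrow> x \<in> space M \<Longrightarrow> T (m + n) x = T m (T n x)"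
  using sys by (auto simp: measure_preserving_system_def)

lemma nn_integral_T:
  assumes "n \<in> R" "g \<in> borel_measurable M"
  shows "(\<integral>\<^sup>+x. g (T n x) \<partial>M) = (\<integral>\<^sup>+x. g x \<partial>M)"
  using nn_integral_distr[OF T_measurable[OF assms(1)], of g] assms by (simp add: T_distr)

lemma integral_T:
  fixes g :: "'x \<Rightarrow> complex"
  assumes "n \<in> R" "g \<in> borel_measurable M"
  shows "(\<integral>x. g (T n x) \<partial>M) = (\<integral>x. g x \<partial>M)"
  using integral_distr[OF T_measurable[OF assms(1)], of g] assms by (simp add: T_distr)

lemma L2_T:
  assumes "n \<in> R" "L2 M f"
  shows "L2 M (\<lambda>x. f (T n x))"
proof -
  have f: "f \<in> borel_measurable M" "integrable M (\<lambda>x. (norm (f x))\<^sup>2)" using assms by (auto simp: L2_def)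
  have "integrable (distr M M (T n)) (\<lambda>x. (norm (f x))\<^sup>2)" using f assms by (simp add: T_distr)
  hence "integrable M (\<lambda>x. (norm (f (T n x)))\<^sup>2)"
    by (rule integrable_distr[OF T_measurable[OF assms(1)]])
  moreover have "(\<lambda>x. f (T n x)) \<in> borel_measurable M"
    using measurable_compose[OF T_measurable[OF assms(1)] f(1)] .
  ultimately show ?thesis by (simp add: L2_def)
qed

lemma correlation:
  assumes f: "L2 M f" and ab: "a \<in> R" "b \<in> R"
  shows "(\<integral>x. f (T a x) * cnj (f (T b x)) \<partial>M) = (\<integral>x. f (T (a - b) x) * cnj (f x) \<partial>M)"
proof -
  have c: "a - b \<in> R" using subring_diff[OF R] ab by blast
  have "(\<integral>x. f (T (a - b) x) * cnj (f x) \<partial>M) = (\<integral>x. f (T (a - b) (T b x)) * cnj (f (T b x)) \<partial>M)"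
    using L2_integrable_mult_cnj[OF L2_T[OF c f] f]
    by (intro integral_T[symmetric] ab) (rule borel_measurable_integrable)
  also have "\<dots> = (\<integral>x. f (T a x) * cnj (f (T b x)) \<partial>M)"
    using T_add[OF c ab(2)] by (intro Bochner_Integration.integral_cong) auto
  finally show ?thesis by simp
qed

text \<open>The correlations of f form a positive definite function of \<open>a - b\<close>, because
  its quadratic forms are squared norms of combinations of translates. Its value \<open>s\<close> at
  0, the squared norm of f, is divided out before the Herglotz-Bochner theorem is applied.\<close>

lemma spectral_representation:
  assumes f: "L2 M f"
  obtains \<nu> :: "real measure" and X :: "'k \<Rightarrow> real \<Rightarrow> complex" and s :: real where
    "real_distribution \<nu>" "\<And>a. X a \<in> borel_measurable borel" "\<And>a t. norm (X a t) = 1"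
    "AE t in \<nu>. \<forall>a\<in>R. \<forall>b\<in>R. X (a + b) t = X a t * X b t" "s \<ge> 0"
    "\<And>a b. a \<in> R \<Longrightarrow> b \<in> R \<Longrightarrow>
      (\<integral>x. f (T a x) * cnj (f (T b x)) \<partial>M) = of_real s * (\<integral>t. X a t * cnj (X b t) \<partial>\<nu>)"
proof -
  define \<phi> where "\<phi> a = (\<integral>x. f (T a x) * cnj (f x) \<partial>M)" for a
  define s where "s = (\<integral>x. (norm (f x))\<^sup>2 \<partial>M)"
  have fm: "f \<in> borel_measurable M" and fi: "integrable M (\<lambda>x. (norm (f x))\<^sup>2)" using f by (auto simp: L2_def)
  have s: "s \<ge> 0" unfolding s_def by (rule Bochner_Integration.integral_nonneg) simp
  have "\<phi> 0 = (\<integral>x. of_real ((norm (f x))\<^sup>2) \<partial>M)"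
    unfolding \<phi>_def by (intro Bochner_Integration.integral_cong refl) (simp only: T_0 complex_norm_square)
  hence \<phi>0: "\<phi> 0 = of_real s"
    unfolding s_def by (simp only: integral_complex_of_real)
  note R0 = subring_0[OF R] and Rdiff = subring_diff[OF R]
  show ?thesis
  proof (cases "s = 0")
    \<comment> \<open>Now f vanishes almost everywhere, and normalisation is impossible; a point
      mass with trivial characters serves, since the factor 0 annihilates the right-hand
      side.\<close>
    case True
    hence "AE x in M. (norm (f x))\<^sup>2 = 0"
      using integral_nonneg_eq_0_iff_AE[OF fi] by (simp add: s_def)
    hence "AE x in M. f (T a x) * cnj (f x) = 0" for a by eventually_elim simp
    hence "\<phi> a = 0" for a unfolding \<phi>_def by (rule integral_eq_zero_AE)
    moreover have "prob_space (return borel (0::real))"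
      by (rule prob_space_return) simp
    ultimately show ?thesis
      using correlation[OF f]
      by (intro that[of "return borel 0" "\<lambda>_ _. 1" 0])
        (simp_all add: \<phi>_def real_distribution_def real_distribution_axioms_def)
  next
    case False
    have "positive_definite_on R (\<lambda>a. \<phi> a / of_real s)"
      unfolding positive_definite_on_def
    proof (intro allI impI)
      fix N :: nat and p :: "nat \<Rightarrow> 'k" and c :: "nat \<Rightarrow> complex"
      assume p: "\<forall>i<N. p i \<in> R"
      have "(\<Sum>i<N. \<Sum>j<N. c i * cnj (c j) * (\<phi> (p i - p j) / of_real s))
          = (\<Sum>i<N. \<Sum>j<N. c i * cnj (c j) * (\<integral>x. f (T (p i) x) * cnj (f (T (p j) x)) \<partial>M)) / of_real s"
        using p by (simp add: sum_divide_distrib correlation[OF f] \<phi>_def)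
      also have "\<dots> = of_real ((\<integral>x. (norm (\<Sum>i<N. c i * f (T (p i) x)))\<^sup>2 \<partial>M) / s)"
        using p integral_norm_sum_sq(2)[of "{..<N}" M "\<lambda>i x. f (T (p i) x)" c] L2_T[OF _ f]
        by (simp only: of_real_divide finite_lessThan lessThan_iff)
      also have "\<dots> \<in> \<real>\<^sub>\<ge>\<^sub>0"
        using s by (simp only: nonneg_Reals_of_real_iff) (intro divide_nonneg_nonneg Bochner_Integration.integral_nonneg, auto)
      finally show "(\<Sum>i<N. \<Sum>j<N. c i * cnj (c j) * (\<phi> (p i - p j) / of_real s)) \<in> \<real>\<^sub>\<ge>\<^sub>0" .
    qed
    then obtain \<nu> :: "real measure" and X :: "'k \<Rightarrow> real \<Rightarrow> complex" where \<nu>: "real_distribution \<nu>"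
      and Xm: "\<And>a. X a \<in> borel_measurable borel" and X1: "\<And>a t. norm (X a t) = 1"
      and mult: "AE t in \<nu>. \<forall>a\<in>R. \<forall>b\<in>R. X (a + b) t = X a t * X b t"
      and int: "\<And>a. a \<in> R \<Longrightarrow> \<phi> a / of_real s = (\<integral>t. X a t \<partial>\<nu>)"
      using herglotz_bochner[OF cR R0 subring_add[OF R], of "\<lambda>a. \<phi> a / of_real s"] \<phi>0 False by auto
    interpret \<nu>: real_distribution \<nu> by (rule \<nu>)
    have "(\<integral>x. f (T a x) * cnj (f (T b x)) \<partial>M) = of_real s * (\<integral>t. X a t * cnj (X b t) \<partial>\<nu>)"
      if ab: "a \<in> R" "b \<in> R" for a b
    proof -
      have Xm': "X a \<in> borel_measurable \<nu>" for a using Xm by simp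
      have "(\<integral>t. X (a - b) t \<partial>\<nu>) = (\<integral>t. X a t * cnj (X b t) \<partial>\<nu>)"
      proof (rule integral_cong_AE)
        show "AE t in \<nu>. X (a - b) t = X a t * cnj (X b t)"
          using mult
        proof eventually_elim
          case (elim t)
          hence "X a t = X (a - b) t * X b t"
            using Rdiff[OF ab] ab by (metis diff_add_cancel)
          hence "X a t * cnj (X b t) = X (a - b) t * (X b t * cnj (X b t))" by simp
          also have "X b t * cnj (X b t) = 1" using X1[of b t] by (simp add: complex_norm_square[symmetric])
          finally show ?case by simp
        qed
      next
        show "(\<lambda>t. X a t * cnj (X b t)) \<in> borel_measurable \<nu>"
          by (intro borel_measurable_times Xm' borel_measurable_continuous_on[of cnj] continuous_intros)
      qed (rule Xm')
      hence "\<phi> (a - b) = of_real s * (\<integral>t. X a t * cnj (X b t) \<partial>\<nu>)"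
        using int[OF Rdiff[OF ab]] False by (simp add: divide_eq_eq mult.commute)
      thus ?thesis by (simp only: correlation[OF f ab] \<phi>_def)
    qed
    thus ?thesis using that[OF \<nu> Xm X1 mult s] by blast
  qed
qed

text \<open>The zero-one law for a function that is only almost everywhere invariant: its level sets are
  made invariant by quantifying over the orbit.\<close>

lemma zero_one_law:
  fixes h :: "'x \<Rightarrow> complex"
  assumes erg: "ergodic_along_ideals R M T" and m: "m \<in> R" "m \<noteq> 0"
    and [measurable]: "h \<in> borel_measurable M" and inv: "\<And>n. n \<in> R \<Longrightarrow> AE x in M. h (T (m * n) x) = h x"
    and S [measurable]: "S \<in> sets borel"
  shows "(AE x in M. h x \<in> S) \<or> (AE x in M. h x \<notin> S)"
proof -
  note Rmult = subring_mult[OF R] and Radd = subring_add[OF R] and Rdiff = subring_diff[OF R] and R0 = subring_0[OF R]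
  define I where "I = (\<lambda>n. m * n) ` R"
  have I: "ideal_of R I"
    unfolding ideal_of_def I_def
  proof (intro conjI ballI)
    show "(*) m ` R \<subseteq> R" using Rmult m by auto
    show "0 \<in> (*) m ` R" using R0 by (intro image_eqI[of _ _ 0]) auto
    fix a assume a: "a \<in> (*) m ` R"
    show "a + b \<in> (*) m ` R" if "b \<in> (*) m ` R" for b
      using a that Radd by (auto simp: distrib_left[symmetric])
    show "r * a \<in> (*) m ` R" if "r \<in> R" for r
      using a that Rmult by (auto simp: mult.left_commute)
  qed
  have "m \<in> I" unfolding I_def using subring_1[OF R] by (intro image_eqI[of _ _ 1]) auto
  hence I0: "I \<noteq> {0}" using m by auto
  define A where "A = {x \<in> space M. \<forall>n\<in>R. h (T (m * n) x) \<in> S}"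
  have A: "A \<in> sets M"
  proof -
    have "(\<lambda>x. h (T (m * n) x)) \<in> borel_measurable M" if "n \<in> R" for n
      using measurable_compose[OF T_measurable[of "m * n"], of h] Rmult[OF m(1) that] by simp
    hence "(\<lambda>x. h (T (m * n) x)) -` S \<inter> space M \<in> sets M" if "n \<in> R" for n
      using that S by (auto intro: measurable_sets)
    hence "(\<Inter>n\<in>R. (\<lambda>x. h (T (m * n) x)) -` S \<inter> space M) \<in> sets M"
      using cR R0 by (intro sets.countable_INT') auto
    also have "(\<Inter>n\<in>R. (\<lambda>x. h (T (m * n) x)) -` S \<inter> space M) = A"
      using R0 by (auto simp: A_def)
    finally show ?thesis .
  qed
  have "T k -` A \<inter> space M = A" if kI: "k \<in> I" for k
  proof -
    obtain n0 where n0: "k = m * n0" "n0 \<in> R" using kI by (auto simp: I_def)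
    have k: "k \<in> R" using n0 Rmult m by auto
    have sp: "T k x \<in> space M" if "x \<in> space M" for x
      using measurable_space[OF T_measurable[OF k] that] .
    have eq: "T (m * n) (T k x) = T (m * (n + n0)) x" if "n \<in> R" "x \<in> space M" for n x
      using T_add[of "m * n" k x] Rmult[OF m(1)] that k by (simp add: n0(1) distrib_left)
    have "T k x \<in> A \<longleftrightarrow> x \<in> A" if x: "x \<in> space M" for x
    proof -
      have "T k x \<in> A \<longleftrightarrow> (\<forall>n\<in>R. h (T (m * (n + n0)) x) \<in> S)"
        using sp[OF x] eq[OF _ x] by (simp add: A_def)
      also have "\<dots> \<longleftrightarrow> (\<forall>n\<in>R. h (T (m * n) x) \<in> S)"
      proof safe
        fix n assume H: "\<forall>n\<in>R. h (T (m * (n + n0)) x) \<in> S" and "n \<in> R"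
        hence "n - n0 \<in> R" using Rdiff n0 by auto
        from H[rule_format, OF this] show "h (T (m * n) x) \<in> S" by simp
      qed (use Radd n0 in auto)
      finally show ?thesis using x by (simp add: A_def)
    qed
    moreover have "A \<subseteq> space M" by (auto simp: A_def)
    ultimately show ?thesis by blast
  qed
  hence "prob A = 0 \<or> prob A = 1"
    using erg[unfolded ergodic_along_ideals_def, rule_format, of I A] I I0 A by blast
  moreover have "AE x in M. \<forall>n\<in>R. h (T (m * n) x) = h x"
    using inv cR by (simp add: AE_ball_countable)
  hence AE_A: "AE x in M. x \<in> A \<longleftrightarrow> h x \<in> S"
    using AE_space by eventually_elim (use R0 in \<open>auto simp: A_def\<close>)
  ultimately show ?thesis
  proof (elim disjE)
    assume "prob A = 0"
    hence "AE x in M. x \<notin> A" using prob_eq_0[OF A] by simp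
    hence "AE x in M. h x \<notin> S" using AE_A by eventually_elim simp
    thus ?thesis ..
  next
    assume "prob A = 1"
    hence "AE x in M. x \<in> A" using prob_eq_1[OF A] by simp
    hence "AE x in M. h x \<in> S" using AE_A by eventually_elim simp
    thus ?thesis ..
  qed
qed

text \<open>The zero-one law is applied to the four half-planes where the real or imaginary part, or
  its negative, is positive. A half-plane containing almost all values would contradict the mean 0,
  so almost no value lies in any of them.\<close>

lemma invariant_mean_zero:
  fixes h :: "'x \<Rightarrow> complex"
  assumes erg: "ergodic_along_ideals R M T" and m: "m \<in> R" "m \<noteq> 0"
    and h: "integrable M h" and inv: "\<And>n. n \<in> R \<Longrightarrow> AE x in M. h (T (m * n) x) = h x"
    and int: "(\<integral>x. h x \<partial>M) = 0"
  shows "AE x in M. h x = 0"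
proof -
  have hm: "h \<in> borel_measurable M" using h by (rule borel_measurable_integrable)
  have real: "AE x in M. \<not> g (h x) > 0"
    if g: "integrable M (\<lambda>x. g (h x))" "(\<integral>x. g (h x) \<partial>M) = 0" "continuous_on UNIV g" for g :: "complex \<Rightarrow> real"
  proof -
    have "open {z. g z > 0}" using open_Collect_less[of "\<lambda>_. 0" g] g(3) by simp
    hence "{z. g z > 0} \<in> sets borel" by simp
    from zero_one_law[OF erg m hm inv this]
    show ?thesis
    proof
      assume pos: "AE x in M. h x \<in> {z. g z > 0}"
      hence "AE x in M. 0 \<le> g (h x)" by eventually_elim simp
      hence "AE x in M. g (h x) = 0"
        using integral_nonneg_eq_0_iff_AE[OF g(1)] g(2) by blast
      hence "AE x in M. False" using pos by eventually_elim simp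
      thus ?thesis by eventually_elim simp
    next
      assume "AE x in M. h x \<notin> {z. g z > 0}"
      thus ?thesis by eventually_elim simp
    qed
  qed
  have c: "continuous_on UNIV (\<lambda>z. Re z)" "continuous_on UNIV (\<lambda>z. - Re z)"
    "continuous_on UNIV (\<lambda>z. Im z)" "continuous_on UNIV (\<lambda>z. - Im z)"
    by (intro continuous_intros)+
  have "AE x in M. \<not> Re (h x) > 0" "AE x in M. \<not> - Re (h x) > 0"
    "AE x in M. \<not> Im (h x) > 0" "AE x in M. \<not> - Im (h x) > 0"
    using c real[of Re] real[of "\<lambda>z. - Re z"] real[of Im] real[of "\<lambda>z. - Im z"] h int
    by (simp_all add: integral_Re integral_Im)
  thus ?thesis by eventually_elim (simp add: complex_eq_iff)
qed

end

section \<open>Averages along ideals\<close>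

lemma (in prob_space) L2_imp_integrable:
  assumes "L2 M f"
  shows "integrable M f"
proof (rule Bochner_Integration.integrable_bound)
  show "integrable M (\<lambda>x. 1 + (norm (f x))\<^sup>2)" using assms by (simp add: L2_def)
  show "f \<in> borel_measurable M" using assms by (simp add: L2_def)
  show "AE x in M. norm (f x) \<le> norm (1 + (norm (f x))\<^sup>2)"
  proof (rule AE_I2)
    fix x
    show "norm (f x) \<le> norm (1 + (norm (f x))\<^sup>2)"
      using le_eps_plus_sq[of 1 "norm (f x)"] by simp
  qed
qed

context ring_system
begin

text \<open>A difference of two averages covers the Cauchy estimate and the comparison with a
  shifted average; with \<open>B = {}\<close> it gives a single average, because the empty average
  is 0 / 0 = 0.\<close>

lemma spectral_average:
  assumes f: "L2 M f" and \<nu>: "real_distribution \<nu>"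
    and X: "\<And>a. X a \<in> borel_measurable borel" "\<And>a t. norm (X a t) = 1"
    and cor: "\<And>a b. a \<in> R \<Longrightarrow> b \<in> R \<Longrightarrow>
      (\<integral>x. f (T a x) * cnj (f (T b x)) \<partial>M) = of_real s * (\<integral>t. X a t * cnj (X b t) \<partial>\<nu>)"
    and A: "finite A" "\<And>n. n \<in> A \<Longrightarrow> p n \<in> R" and B: "finite B" "\<And>n. n \<in> B \<Longrightarrow> q n \<in> R"
  shows "(\<integral>\<^sup>+x. ennreal ((norm (average A (\<lambda>n. f (T (p n) x)) - average B (\<lambda>n. f (T (q n) x))))\<^sup>2) \<partial>M)
    = ennreal (s * (\<integral>t. (norm (average A (\<lambda>n. X (p n) t) - average B (\<lambda>n. X (q n) t)))\<^sup>2 \<partial>\<nu>))"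
proof -
  interpret \<nu>: real_distribution \<nu> by (rule \<nu>)
  \<comment> \<open>The disjoint union separates the terms of the two averages, whose index sets may
    overlap.\<close>
  define J where "J = A <+> B"
  define r where "r = case_sum p q"
  define c :: "'a + 'b \<Rightarrow> complex" where "c = case_sum (\<lambda>_. 1 / of_nat (card A)) (\<lambda>_. - 1 / of_nat (card B))"
  have r: "r i \<in> R" if "i \<in> J" for i using that A B by (auto simp: J_def r_def)
  have av: "average A (\<lambda>n. u (p n)) - average B (\<lambda>n. u (q n)) = (\<Sum>i\<in>J. c i * u (r i))" for u :: "'k \<Rightarrow> complex"
    unfolding J_def sum.Plus[OF A(1) B(1)]
    by (simp add: average_def c_def r_def sum_divide_distrib sum_negf)
  have L2X: "L2 \<nu> (X a)" for a
    using X by (simp add: L2_def)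
  show ?thesis
    unfolding av[of "\<lambda>n. f (T n _)"] av[of "\<lambda>n. X n _"]
  proof (rule L2_isometry)
    show "finite J" using A B by (simp add: J_def)
    show "L2 M (\<lambda>x. f (T (r i) x))" if "i \<in> J" for i by (rule L2_T[OF r[OF that] f])
    show "L2 \<nu> (X (r i))" for i by (rule L2X)
    show "(\<integral>x. f (T (r i) x) * cnj (f (T (r j) x)) \<partial>M) = of_real s * (\<integral>t. X (r i) t * cnj (X (r j) t) \<partial>\<nu>)"
      if "i \<in> J" "j \<in> J" for i j by (rule cor[OF r[OF that(1)] r[OF that(2)]])
  qed
qed

text \<open>The averages of \<open>f\<close> along the ideal \<open>m R\<close> converge to an invariant function, which is \<open>0\<close> by
  ergodicity. On the spectral side they converge to the indicator function of the characters that
  are trivial on \<open>m R\<close>.\<close>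

lemma trivial_characters_null:
  assumes erg: "ergodic_along_ideals R M T" and \<Phi>: "folner R \<Phi>"
    and f: "L2 M f" and f0: "(\<integral>x. f x \<partial>M) = 0" and \<nu>: "real_distribution \<nu>"
    and X: "\<And>a. X a \<in> borel_measurable borel" "\<And>a t. norm (X a t) = 1"
    and mult: "AE t in \<nu>. \<forall>a\<in>R. \<forall>b\<in>R. X (a + b) t = X a t * X b t"
    and s: "s > 0"
    and cor: "\<And>a b. a \<in> R \<Longrightarrow> b \<in> R \<Longrightarrow>
      (\<integral>x. f (T a x) * cnj (f (T b x)) \<partial>M) = of_real s * (\<integral>t. X a t * cnj (X b t) \<partial>\<nu>)"
    and m: "m \<in> R" "m \<noteq> 0"
  shows "AE t in \<nu>. \<exists>n\<in>R. X (m * n) t \<noteq> 1"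
proof -
  interpret \<nu>: real_distribution \<nu> by (rule \<nu>)
  note Rmult = subring_mult[OF R] and Radd = subring_add[OF R] and R0 = subring_0[OF R]
  have fm [measurable]: "f \<in> borel_measurable M" using f by (simp add: L2_def)
  have X_meas [measurable]: "X a \<in> borel_measurable \<nu>" for a using X by simp
  have fin: "finite (\<Phi> N)" and ne: "\<Phi> N \<noteq> {}" and sub: "n \<in> \<Phi> N \<Longrightarrow> n \<in> R" for N n
    using \<Phi> by (auto simp: folner_def)
  have mR: "m * n \<in> R" if "n \<in> R" for n using Rmult m that by blast
  define A where "A = {t. \<forall>n\<in>R. X (m * n) t = 1}"
  have A: "A \<in> sets \<nu>"
  proof -
    have "X (m * n) -` {1} \<inter> space \<nu> \<in> sets \<nu>" for n
      by (rule measurable_sets[OF X_meas]) simp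
    hence "(\<Inter>n\<in>R. X (m * n) -` {1} \<inter> space \<nu>) \<in> sets \<nu>"
      using cR R0 by (intro sets.countable_INT') auto
    also have "(\<Inter>n\<in>R. X (m * n) -` {1} \<inter> space \<nu>) = A" using R0 by (auto simp: A_def)
    finally show ?thesis .
  qed
  define I :: "real \<Rightarrow> complex" where "I = indicator A"
  have I_meas [measurable]: "I \<in> borel_measurable \<nu>" unfolding I_def using A by measurable
  define a where "a k t = average (\<Phi> k) (\<lambda>n. X (m * n) t)" for k t
  have avg_meas: "(\<lambda>t. average F (\<lambda>n. X (p n) t)) \<in> borel_measurable \<nu>" for F :: "'k set" and p
    unfolding average_def by measurable
  have a_meas [measurable]: "a k \<in> borel_measurable \<nu>" for k unfolding a_def by (rule avg_meas)
  have a_bound: "norm (average (\<Phi> k) (\<lambda>n. X (p n) t)) \<le> 1" for k p t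
  proof -
    have "norm (\<Sum>n\<in>\<Phi> k. X (p n) t) \<le> (\<Sum>n\<in>\<Phi> k. 1)" by (rule sum_norm_le) (simp add: X)
    thus ?thesis using fin[of k] ne[of k]
      by (simp add: average_def norm_divide divide_le_eq card_gt_0_iff)
  qed
  \<comment> \<open>For almost every t, the map \<open>n \<mapsto> X (m * n) t\<close> is itself a
    character of R, nontrivial exactly when t lies outside \<open>A\<close>.\<close>
  have a_lim: "AE t in \<nu>. (\<lambda>k. a k t) \<longlonglongrightarrow> I t"
    using mult
  proof eventually_elim
    case (elim t)
    show ?case
    proof (cases "t \<in> A")
      case True
      have "a k t = 1" for k
      proof -
        have "(\<Sum>n\<in>\<Phi> k. X (m * n) t) = (\<Sum>n\<in>\<Phi> k. 1)"
          using True sub by (intro sum.cong) (auto simp: A_def)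
        thus ?thesis using fin[of k] ne[of k] by (simp add: a_def average_def)
      qed
      thus ?thesis using True by (simp add: I_def)
    next
      case False
      then obtain n where n: "n \<in> R" "X (m * n) t \<noteq> 1" by (auto simp: A_def)
      have "add_character R (\<lambda>n. X (m * n) t)"
        using elim X(2) mR by (simp add: add_character_def distrib_left)
      from folner_average_character[OF \<Phi> this n]
      show ?thesis using False by (simp add: a_def I_def)
    qed
  qed
  have a_I: "(\<lambda>k. \<integral>t. (norm (a k t - I t))\<^sup>2 \<partial>\<nu>) \<longlonglongrightarrow> (\<integral>t. 0 \<partial>\<nu>)"
  proof (rule integral_dominated_convergence[where w = "\<lambda>_. 4"])
    show "AE t in \<nu>. (\<lambda>k. (norm (a k t - I t))\<^sup>2) \<longlonglongrightarrow> 0"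
      using a_lim by eventually_elim (auto intro!: tendsto_eq_intros)
    show "AE t in \<nu>. norm ((norm (a k t - I t))\<^sup>2) \<le> 4" for k
    proof (rule AE_I2)
      fix t
      have "norm (I t) \<le> 1" by (simp add: I_def indicator_def)
      hence "norm (a k t - I t) \<le> 2"
        using a_bound[of k "\<lambda>n. m * n" t] norm_triangle_ineq4[of "a k t" "I t"] by (simp add: a_def)
      hence "(norm (a k t - I t))\<^sup>2 \<le> 2\<^sup>2" by (intro power_mono) auto
      thus "norm ((norm (a k t - I t))\<^sup>2) \<le> 4" by simp
    qed
  qed (simp_all, measurable)
  have aI_int: "integrable \<nu> (\<lambda>t. (norm (a k t - I t))\<^sup>2)" for k
  proof (rule \<nu>.integrable_const_bound[where B = 4], rule AE_I2)
    fix t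
    have "norm (I t) \<le> 1" by (simp add: I_def indicator_def)
    hence "norm (a k t - I t) \<le> 2"
      using a_bound[of k "\<lambda>n. m * n" t] norm_triangle_ineq4[of "a k t" "I t"] by (simp add: a_def)
    hence "(norm (a k t - I t))\<^sup>2 \<le> 2\<^sup>2" by (intro power_mono) auto
    thus "norm ((norm (a k t - I t))\<^sup>2) \<le> 4" by simp
  qed measurable
  define h where "h k x = average (\<Phi> k) (\<lambda>n. f (T (m * n) x))" for k x
  have fT_meas: "(\<lambda>x. f (T n x)) \<in> borel_measurable M" if "n \<in> R" for n
    using L2_T[OF that f] by (simp add: L2_def)
  have h_meas [measurable]: "h k \<in> borel_measurable M" for k
    unfolding h_def average_def by (intro borel_measurable_divide borel_measurable_sum fT_meas mR sub) auto
  have h_diff: "(\<integral>\<^sup>+x. ennreal ((norm (h i x - h j x))\<^sup>2) \<partial>M) = ennreal (s * (\<integral>t. (norm (a i t - a j t))\<^sup>2 \<partial>\<nu>))" for i j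
    unfolding h_def a_def by (rule spectral_average[OF f \<nu> X cor]) (auto intro: fin mR sub)
  \<comment> \<open>Passing through the limit \<open>I\<close> costs two terms with factor 2 each;
    the bound \<open>\<epsilon> / (4 * s)\<close> for both makes the total
    \<open>\<epsilon> / s\<close>, and \<open>h_diff\<close> multiplies by s.\<close>
  have h_Cauchy: "\<exists>N. \<forall>i\<ge>N. \<forall>j\<ge>N. (\<integral>\<^sup>+x. ennreal ((norm (h i x - h j x))\<^sup>2) \<partial>M) \<le> ennreal \<epsilon>" if \<epsilon>: "\<epsilon> > 0" for \<epsilon>
  proof -
    have "\<forall>\<^sub>F k in sequentially. (\<integral>t. (norm (a k t - I t))\<^sup>2 \<partial>\<nu>) < \<epsilon> / (4 * s)"
      using a_I \<epsilon> s by (intro order_tendstoD(2)[OF a_I]) auto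
    then obtain N where N: "\<And>k. k \<ge> N \<Longrightarrow> (\<integral>t. (norm (a k t - I t))\<^sup>2 \<partial>\<nu>) < \<epsilon> / (4 * s)"
      by (auto simp: eventually_sequentially)
    have "(\<integral>\<^sup>+x. ennreal ((norm (h i x - h j x))\<^sup>2) \<partial>M) \<le> ennreal \<epsilon>" if "i \<ge> N" "j \<ge> N" for i j
    proof -
      have "(\<integral>t. (norm (a i t - a j t))\<^sup>2 \<partial>\<nu>) \<le> (\<integral>t. 2 * (norm (a i t - I t))\<^sup>2 + 2 * (norm (a j t - I t))\<^sup>2 \<partial>\<nu>)"
      proof (rule integral_mono')
        show "integrable \<nu> (\<lambda>t. 2 * (norm (a i t - I t))\<^sup>2 + 2 * (norm (a j t - I t))\<^sup>2)" using aI_int by simp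
        show "(norm (a i t - a j t))\<^sup>2 \<le> 2 * (norm (a i t - I t))\<^sup>2 + 2 * (norm (a j t - I t))\<^sup>2" for t
          using norm_add_sq_le[of "a i t - I t" "I t - a j t"] by (simp add: norm_minus_commute)
      qed simp
      also have "\<dots> = 2 * (\<integral>t. (norm (a i t - I t))\<^sup>2 \<partial>\<nu>) + 2 * (\<integral>t. (norm (a j t - I t))\<^sup>2 \<partial>\<nu>)"
        using aI_int by simp
      also have "\<dots> \<le> \<epsilon> / s" using N[OF that(1)] N[OF that(2)] by (simp add: field_simps)
      finally show ?thesis unfolding h_diff using s by (intro ennreal_leI) (simp add: field_simps)
    qed
    thus ?thesis by blast
  qed
  obtain g where g_meas [measurable]: "g \<in> borel_measurable M"
    and g: "(\<lambda>k. \<integral>\<^sup>+x. ennreal ((norm (h k x - g x))\<^sup>2) \<partial>M) \<longlonglongrightarrow> 0"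
    using L2_complete[OF h_meas h_Cauchy] by blast
  \<comment> \<open>Spectrally, composing with \<open>T (m * n)\<close> multiplies
    \<open>a k\<close> by \<open>X (m * n)\<close>, which is 1 on the set \<open>A\<close> that
    carries the limit. So the averages become invariant asymptotically, and g inherits this.\<close>
  have inv: "AE x in M. g (T (m * n) x) = g x" if n: "n \<in> R" for n
  proof -
    have mn: "m * n \<in> R" by (rule mR[OF n])
    define b where "b k t = average (\<Phi> k) (\<lambda>l. X (m * l + m * n) t)" for k t
    have T_meas: "T (m * n) \<in> measurable M M" by (rule T_measurable[OF mn])
    have gT_meas [measurable]: "(\<lambda>x. g (T (m * n) x)) \<in> borel_measurable M"
      by (rule measurable_compose[OF T_meas g_meas])
    have hT_meas [measurable]: "(\<lambda>x. h k (T (m * n) x)) \<in> borel_measurable M" for k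
      by (rule measurable_compose[OF T_meas h_meas])
    have "(\<integral>\<^sup>+x. ennreal ((norm (h k (T (m * n) x) - h k x))\<^sup>2) \<partial>M) = ennreal (s * (\<integral>t. (norm (b k t - a k t))\<^sup>2 \<partial>\<nu>))" for k
    proof -
      have "(\<integral>\<^sup>+x. ennreal ((norm (h k (T (m * n) x) - h k x))\<^sup>2) \<partial>M) =
        (\<integral>\<^sup>+x. ennreal ((norm (average (\<Phi> k) (\<lambda>l. f (T (m * l + m * n) x)) - average (\<Phi> k) (\<lambda>l. f (T (m * l) x))))\<^sup>2) \<partial>M)"
      proof (rule nn_integral_cong)
        fix x assume x: "x \<in> space M"
        have "h k (T (m * n) x) = average (\<Phi> k) (\<lambda>l. f (T (m * l + m * n) x))"
          unfolding h_def average_def using sub x mR mn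
          by (intro arg_cong2[of _ _ _ _ "(/)"] sum.cong) (auto simp: T_add)
        thus "ennreal ((norm (h k (T (m * n) x) - h k x))\<^sup>2) =
          ennreal ((norm (average (\<Phi> k) (\<lambda>l. f (T (m * l + m * n) x)) - average (\<Phi> k) (\<lambda>l. f (T (m * l) x))))\<^sup>2)"
          by (simp add: h_def)
      qed
      also have "\<dots> = ennreal (s * (\<integral>t. (norm (b k t - a k t))\<^sup>2 \<partial>\<nu>))"
        unfolding a_def b_def
        by (rule spectral_average[OF f \<nu> X cor]) (auto intro: fin mR sub Radd mn)
      finally show ?thesis .
    qed
    moreover have "(\<lambda>k. \<integral>t. (norm (b k t - a k t))\<^sup>2 \<partial>\<nu>) \<longlonglongrightarrow> (\<integral>t. 0 \<partial>\<nu>)"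
    proof (rule integral_dominated_convergence[where w = "\<lambda>_. 4"])
      show "AE t in \<nu>. (\<lambda>k. (norm (b k t - a k t))\<^sup>2) \<longlonglongrightarrow> 0"
        using a_lim mult
      proof eventually_elim
        case (elim t)
        have b: "b k t = a k t * X (m * n) t" for k
        proof -
          have "(\<Sum>l\<in>\<Phi> k. X (m * l + m * n) t) = (\<Sum>l\<in>\<Phi> k. X (m * l) t * X (m * n) t)"
            using elim(2) sub mR mn by (intro sum.cong) auto
          thus ?thesis by (simp add: a_def b_def average_def sum_distrib_right[symmetric])
        qed
        have "(\<lambda>k. (norm (b k t - a k t))\<^sup>2) \<longlonglongrightarrow> (norm (I t * X (m * n) t - I t))\<^sup>2"
          unfolding b by (intro tendsto_intros elim(1))
        also have "I t * X (m * n) t - I t = 0"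
          using n by (cases "t \<in> A") (auto simp: I_def A_def)
        finally show ?case by simp
      qed
      show "AE t in \<nu>. norm ((norm (b k t - a k t))\<^sup>2) \<le> 4" for k
      proof (rule AE_I2)
        fix t
        have "norm (b k t - a k t) \<le> 2"
          using a_bound[of k "\<lambda>l. m * l + m * n" t] a_bound[of k "\<lambda>n. m * n" t] norm_triangle_ineq4[of "b k t" "a k t"]
          by (simp add: a_def b_def)
        hence "(norm (b k t - a k t))\<^sup>2 \<le> 2\<^sup>2" by (intro power_mono) auto
        thus "norm ((norm (b k t - a k t))\<^sup>2) \<le> 4" by simp
      qed
      have "b k \<in> borel_measurable \<nu>" for k unfolding b_def by (rule avg_meas)
      thus "(\<lambda>t. (norm (b k t - a k t))\<^sup>2) \<in> borel_measurable \<nu>" for k by measurable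
    qed simp_all
    ultimately have hT_h: "(\<lambda>k. \<integral>\<^sup>+x. ennreal ((norm (h k (T (m * n) x) - h k x))\<^sup>2) \<partial>M) \<longlonglongrightarrow> 0"
      using tendsto_ennrealI[OF tendsto_mult_right_zero[of _ sequentially s]] by simp
    have gT_hT: "(\<integral>\<^sup>+x. ennreal ((norm (h k (T (m * n) x) - g (T (m * n) x)))\<^sup>2) \<partial>M)
        = (\<integral>\<^sup>+x. ennreal ((norm (h k x - g x))\<^sup>2) \<partial>M)" for k
      by (rule nn_integral_T[OF mn, of "\<lambda>x. ennreal ((norm (h k x - g x))\<^sup>2)"]) measurable
    \<comment> \<open>The difference is split at \<open>h k (T (m * n) x)\<close> and
      \<open>h k x\<close>; the first and last parts have equal norms because T preserves the
      measure.\<close>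
    have le: "(\<integral>\<^sup>+x. ennreal ((norm (g (T (m * n) x) - g x))\<^sup>2) \<partial>M)
      \<le> 2 * (\<integral>\<^sup>+x. ennreal ((norm (h k x - g x))\<^sup>2) \<partial>M) +
        (4 * (\<integral>\<^sup>+x. ennreal ((norm (h k (T (m * n) x) - h k x))\<^sup>2) \<partial>M) + 4 * (\<integral>\<^sup>+x. ennreal ((norm (h k x - g x))\<^sup>2) \<partial>M))" for k
    proof -
      have "(\<integral>\<^sup>+x. ennreal ((norm (g (T (m * n) x) - g x))\<^sup>2) \<partial>M)
        \<le> (\<integral>\<^sup>+x. 2 * ennreal ((norm (h k (T (m * n) x) - g (T (m * n) x)))\<^sup>2) +
            (4 * ennreal ((norm (h k (T (m * n) x) - h k x))\<^sup>2) + 4 * ennreal ((norm (h k x - g x))\<^sup>2)) \<partial>M)"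
      proof (rule nn_integral_mono)
        fix x
        let ?u = "g (T (m * n) x) - h k (T (m * n) x)" and ?v = "h k (T (m * n) x) - h k x" and ?w = "h k x - g x"
        have "(norm (?u + (?v + ?w)))\<^sup>2 \<le> 2 * (norm ?u)\<^sup>2 + (4 * (norm ?v)\<^sup>2 + 4 * (norm ?w)\<^sup>2)"
          using norm_add_sq_le[of ?u "?v + ?w"] norm_add_sq_le[of ?v ?w] by simp
        hence "ennreal ((norm (g (T (m * n) x) - g x))\<^sup>2) \<le> ennreal (2 * (norm ?u)\<^sup>2 + (4 * (norm ?v)\<^sup>2 + 4 * (norm ?w)\<^sup>2))"
          by (intro ennreal_leI) simp
        also have "\<dots> = 2 * ennreal ((norm ?u)\<^sup>2) + (4 * ennreal ((norm ?v)\<^sup>2) + 4 * ennreal ((norm ?w)\<^sup>2))"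
          by (simp add: ennreal_plus ennreal_mult)
        finally show "ennreal ((norm (g (T (m * n) x) - g x))\<^sup>2)
          \<le> 2 * ennreal ((norm (h k (T (m * n) x) - g (T (m * n) x)))\<^sup>2) +
            (4 * ennreal ((norm (h k (T (m * n) x) - h k x))\<^sup>2) + 4 * ennreal ((norm (h k x - g x))\<^sup>2))"
          by (simp add: norm_minus_commute)
      qed
      also have "\<dots> = 2 * (\<integral>\<^sup>+x. ennreal ((norm (h k (T (m * n) x) - g (T (m * n) x)))\<^sup>2) \<partial>M) +
        (4 * (\<integral>\<^sup>+x. ennreal ((norm (h k (T (m * n) x) - h k x))\<^sup>2) \<partial>M) + 4 * (\<integral>\<^sup>+x. ennreal ((norm (h k x - g x))\<^sup>2) \<partial>M))"
        by (simp add: nn_integral_add nn_integral_cmult)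
      finally show ?thesis unfolding gT_hT .
    qed
    have "(\<lambda>k. 2 * (\<integral>\<^sup>+x. ennreal ((norm (h k x - g x))\<^sup>2) \<partial>M) +
        (4 * (\<integral>\<^sup>+x. ennreal ((norm (h k (T (m * n) x) - h k x))\<^sup>2) \<partial>M) + 4 * (\<integral>\<^sup>+x. ennreal ((norm (h k x - g x))\<^sup>2) \<partial>M)))
      \<longlonglongrightarrow> 2 * 0 + (4 * 0 + 4 * 0)"
      by (intro tendsto_add ennreal_tendsto_cmult g hT_h) auto
    hence "(\<integral>\<^sup>+x. ennreal ((norm (g (T (m * n) x) - g x))\<^sup>2) \<partial>M) \<le> 0"
    proof (rule LIMSEQ_le_const[THEN order_trans], intro exI allI impI)
      show "2 * 0 + (4 * 0 + 4 * 0) \<le> (0 :: ennreal)" by simp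
    qed (rule le)
    hence "AE x in M. ennreal ((norm (g (T (m * n) x) - g x))\<^sup>2) = 0"
      by (subst nn_integral_0_iff_AE[symmetric]) auto
    thus ?thesis by eventually_elim simp
  qed
  have h_int: "integrable M (h k)" "(\<integral>x. h k x \<partial>M) = 0" for k
  proof -
    have i: "integrable M (\<lambda>x. f (T n x))" if "n \<in> R" for n
      by (rule L2_imp_integrable[OF L2_T[OF that f]])
    have z: "(\<integral>x. f (T n x) \<partial>M) = 0" if "n \<in> R" for n
      using integral_T[OF that fm] f0 by simp
    show "integrable M (h k)" unfolding h_def average_def
      by (intro integrable_divide Bochner_Integration.integrable_sum i mR sub)
    have "(\<integral>x. h k x \<partial>M) = (\<Sum>n\<in>\<Phi> k. \<integral>x. f (T (m * n) x) \<partial>M) / of_nat (card (\<Phi> k))"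
      unfolding h_def average_def using i mR sub by (simp add: Bochner_Integration.integral_sum)
    also have "\<dots> = 0" using z mR sub by simp
    finally show "(\<integral>x. h k x \<partial>M) = 0" .
  qed
  have diff_int: "integrable M (\<lambda>x. (norm (h k x - g x))\<^sup>2) \<and> (\<integral>x. (norm (h k x - g x))\<^sup>2 \<partial>M) < \<epsilon>"
    if "(\<integral>\<^sup>+x. ennreal ((norm (h k x - g x))\<^sup>2) \<partial>M) < ennreal \<epsilon>" for k \<epsilon>
  proof
    show i: "integrable M (\<lambda>x. (norm (h k x - g x))\<^sup>2)"
      by (rule integrableI_bounded) (use that in \<open>auto intro: less_trans\<close>)
    have "ennreal (\<integral>x. (norm (h k x - g x))\<^sup>2 \<partial>M) < ennreal \<epsilon>"
      using that nn_integral_eq_integral[OF i] by simp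
    thus "(\<integral>x. (norm (h k x - g x))\<^sup>2 \<partial>M) < \<epsilon>" by (simp add: ennreal_less_iff)
  qed
  have ex_k: "\<exists>k. (\<integral>\<^sup>+x. ennreal ((norm (h k x - g x))\<^sup>2) \<partial>M) < ennreal \<epsilon>" if "\<epsilon> > 0" for \<epsilon>
    using order_tendstoD(2)[OF g, of "ennreal \<epsilon>"] that by (auto simp: eventually_sequentially)
  have hg_int: "integrable M (\<lambda>x. h k x - g x)" if "integrable M (\<lambda>x. (norm (h k x - g x))\<^sup>2)" for k
    by (rule L2_imp_integrable) (use that in \<open>simp add: L2_def\<close>)
  have g_int: "integrable M g"
  proof -
    obtain k where "(\<integral>\<^sup>+x. ennreal ((norm (h k x - g x))\<^sup>2) \<partial>M) < ennreal 1"
      using ex_k[of 1] by (auto simp del: ennreal_1)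
    hence "integrable M (\<lambda>x. (norm (h k x - g x))\<^sup>2)" using diff_int by blast
    from Bochner_Integration.integrable_diff[OF h_int(1)[of k] hg_int[OF this]] show ?thesis by simp
  qed
  have g0: "(\<integral>x. g x \<partial>M) = 0"
  proof -
    have "norm (\<integral>x. g x \<partial>M) \<le> 0 + \<epsilon>" if \<epsilon>: "\<epsilon> > 0" for \<epsilon>
    proof -
      \<comment> \<open>With the squared norm below \<open>\<delta> * \<delta>\<close>, both terms
        of \<open>le_eps_plus_sq\<close> are at most \<delta>.\<close>
      define \<delta> where "\<delta> = \<epsilon> / 2"
      have \<delta>: "\<delta> > 0" using \<epsilon> by (simp add: \<delta>_def)
      obtain k where k: "integrable M (\<lambda>x. (norm (h k x - g x))\<^sup>2)" "(\<integral>x. (norm (h k x - g x))\<^sup>2 \<partial>M) < \<delta> * \<delta>"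
        using ex_k[of "\<delta> * \<delta>"] diff_int mult_pos_pos[OF \<delta> \<delta>] by blast
      have "norm (\<integral>x. g x \<partial>M) = norm (\<integral>x. h k x - g x \<partial>M)"
        using h_int g_int by simp
      also have "\<dots> \<le> (\<integral>x. norm (h k x - g x) \<partial>M)" by (rule integral_norm_bound)
      also have "\<dots> \<le> (\<integral>x. \<delta> + (norm (h k x - g x))\<^sup>2 / \<delta> \<partial>M)"
        using h_int g_int k(1) \<delta> by (intro integral_mono le_eps_plus_sq) auto
      also have "\<dots> = \<delta> + (\<integral>x. (norm (h k x - g x))\<^sup>2 \<partial>M) / \<delta>"
        using k(1) by (simp add: prob_space)
      also have "\<dots> \<le> \<delta> + \<delta>" using k(2) \<delta> by (simp add: field_simps)
      finally show ?thesis by (simp add: \<delta>_def)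
    qed
    hence "norm (\<integral>x. g x \<partial>M) \<le> 0" by (rule field_le_epsilon)
    thus ?thesis by simp
  qed
  have "AE x in M. g x = 0"
    by (rule invariant_mean_zero[OF erg m g_int inv g0])
  hence "(\<integral>\<^sup>+x. ennreal ((norm (h k x - g x))\<^sup>2) \<partial>M) = (\<integral>\<^sup>+x. ennreal ((norm (h k x))\<^sup>2) \<partial>M)" for k
    by (intro nn_integral_cong_AE) (auto elim!: eventually_mono)
  moreover have "(\<integral>\<^sup>+x. ennreal ((norm (h k x))\<^sup>2) \<partial>M) = ennreal (s * (\<integral>t. (norm (a k t))\<^sup>2 \<partial>\<nu>))" for k
  proof -
    have "average {} u = 0" for u :: "'k \<Rightarrow> complex" by (simp add: average_def)
    thus ?thesis
      using spectral_average[OF f \<nu> X cor, of "\<Phi> k" "\<lambda>n. m * n" "{}" "\<lambda>n. n"] fin mR sub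
      by (simp add: h_def a_def)
  qed
  ultimately have "(\<lambda>k. ennreal (s * (\<integral>t. (norm (a k t))\<^sup>2 \<partial>\<nu>))) \<longlonglongrightarrow> ennreal 0" using g by simp
  hence "(\<lambda>k. s * (\<integral>t. (norm (a k t))\<^sup>2 \<partial>\<nu>)) \<longlonglongrightarrow> 0"
    using s by (subst (asm) tendsto_ennreal_iff) (auto intro!: always_eventually mult_nonneg_nonneg Bochner_Integration.integral_nonneg)
  \<comment> \<open>Computed spectrally, the same norms tend to s times the measure of
    \<open>A\<close>; as they also tend to 0, the set of characters trivial on \<open>m R\<close> is
    null.\<close>
  moreover have "(\<lambda>k. s * (\<integral>t. (norm (a k t))\<^sup>2 \<partial>\<nu>)) \<longlonglongrightarrow> s * (\<integral>t. (norm (I t))\<^sup>2 \<partial>\<nu>)"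
  proof (intro tendsto_mult tendsto_const integral_dominated_convergence[where w = "\<lambda>_. 1"])
    show "AE t in \<nu>. (\<lambda>k. (norm (a k t))\<^sup>2) \<longlonglongrightarrow> (norm (I t))\<^sup>2"
      using a_lim by eventually_elim (intro tendsto_intros)
    show "AE t in \<nu>. norm ((norm (a k t))\<^sup>2) \<le> 1" for k
      using a_bound[of k "\<lambda>n. m * n"] by (auto simp: a_def power_le_one)
  qed (simp_all, measurable)
  ultimately have "s * (\<integral>t. (norm (I t))\<^sup>2 \<partial>\<nu>) = 0" by (rule LIMSEQ_unique[symmetric])
  moreover have "(\<integral>t. (norm (I t))\<^sup>2 \<partial>\<nu>) = measure \<nu> A"
  proof -
    have "(norm (I t))\<^sup>2 = indicator A t" for t by (simp add: I_def indicator_def)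
    thus ?thesis using A by simp
  qed
  ultimately have "measure \<nu> A = 0" using s by simp
  hence "AE t in \<nu>. t \<notin> A" using \<nu>.prob_eq_0[OF A] by simp
  thus ?thesis by eventually_elim (auto simp: A_def)
qed

section \<open>Mean convergence along polynomials\<close>

theorem polynomial_averages_converge:
  assumes erg: "ergodic_along_ideals R M T" and P: "P \<in> polys_over R"
    and good: "good_for_irrational_equidistribution R P" and f: "L2 M f"
  shows "UC_lim_L2 M R (\<lambda>n x. f (T (poly P n) x)) (\<lambda>x. \<integral>y. f y \<partial>M)"
  unfolding UC_lim_L2_def
proof (intro allI impI)
  fix \<Phi> assume \<Phi>: "folner R \<Phi>"
  have fin: "finite (\<Phi> N)" and ne: "\<Phi> N \<noteq> {}" and sub: "n \<in> \<Phi> N \<Longrightarrow> n \<in> R" for N n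
    using \<Phi> by (auto simp: folner_def)
  define c where "c = (\<integral>y. f y \<partial>M)"
  \<comment> \<open>Removing the mean discards the trivial character; the averages of the constant
    are c itself, as the sets of the sequence are nonempty.\<close>
  define f' where "f' x = f x - c" for x
  have fm [measurable]: "f \<in> borel_measurable M" and fi: "integrable M (\<lambda>x. (norm (f x))\<^sup>2)"
    using f by (auto simp: L2_def)
  have "integrable M f" by (rule L2_imp_integrable[OF f])
  hence f'0: "(\<integral>x. f' x \<partial>M) = 0" by (simp add: f'_def c_def prob_space)
  have [measurable]: "f' \<in> borel_measurable M" unfolding f'_def by measurable
  have f': "L2 M f'"
    unfolding L2_def
  proof
    show "f' \<in> borel_measurable M" by measurable
    show "integrable M (\<lambda>x. (norm (f' x))\<^sup>2)"
    proof (rule Bochner_Integration.integrable_bound)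
      show "integrable M (\<lambda>x. 2 * (norm (f x))\<^sup>2 + 2 * (norm c)\<^sup>2)" using fi by simp
      show "AE x in M. norm ((norm (f' x))\<^sup>2) \<le> norm (2 * (norm (f x))\<^sup>2 + 2 * (norm c)\<^sup>2)"
        using norm_add_sq_le[of "f _" "- c"] by (auto simp: f'_def)
    qed measurable
  qed
  obtain \<nu> :: "real measure" and X :: "'k \<Rightarrow> real \<Rightarrow> complex" and s :: real where
    \<nu>: "real_distribution \<nu>" and X: "\<And>a. X a \<in> borel_measurable borel" "\<And>a t. norm (X a t) = 1"
    and mult: "AE t in \<nu>. \<forall>a\<in>R. \<forall>b\<in>R. X (a + b) t = X a t * X b t" and s: "s \<ge> 0"
    and cor: "\<And>a b. a \<in> R \<Longrightarrow> b \<in> R \<Longrightarrow>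
      (\<integral>x. f' (T a x) * cnj (f' (T b x)) \<partial>M) = of_real s * (\<integral>t. X a t * cnj (X b t) \<partial>\<nu>)"
    by (rule spectral_representation[OF f'], rule that)
  interpret \<nu>: real_distribution \<nu> by (rule \<nu>)
  have X_meas [measurable]: "X a \<in> borel_measurable \<nu>" for a using X by simp
  have PR: "poly P n \<in> R" if "n \<in> R" for n by (rule poly_in_subring[OF R P that])
  define a where "a N t = average (\<Phi> N) (\<lambda>n. X (poly P n) t)" for N t
  have "(\<integral>\<^sup>+x. ennreal ((norm (average (\<Phi> N) (\<lambda>n. f (T (poly P n) x)) - c))\<^sup>2) \<partial>M)
      = ennreal (s * (\<integral>t. (norm (a N t))\<^sup>2 \<partial>\<nu>))" for N
  proof -
    have "average (\<Phi> N) (\<lambda>n. f' (T (poly P n) x)) = average (\<Phi> N) (\<lambda>n. f (T (poly P n) x)) - c" for x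
      using fin[of N] ne[of N] by (simp add: f'_def average_def sum_subtractf diff_divide_distrib)
    moreover have "average {} u = 0" for u :: "'k \<Rightarrow> complex" by (simp add: average_def)
    ultimately show ?thesis
      using spectral_average[OF f' \<nu> X cor, of "\<Phi> N" "poly P" "{}" "\<lambda>n. n"] fin PR sub
      by (simp add: a_def)
  qed
  moreover have "(\<lambda>N. s * (\<integral>t. (norm (a N t))\<^sup>2 \<partial>\<nu>)) \<longlonglongrightarrow> 0"
  proof (cases "s = 0")
    case False
    hence s: "s > 0" using s by simp
    have "AE t in \<nu>. \<forall>m\<in>R - {0}. \<exists>n\<in>R. X (m * n) t \<noteq> 1"
      using cR trivial_characters_null[OF erg \<Phi> f' f'0 \<nu> X mult s cor]
      by (subst AE_ball_countable) auto
    hence lim: "AE t in \<nu>. (\<lambda>N. a N t) \<longlonglongrightarrow> 0"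
      using mult
    proof eventually_elim
      case (elim t)
      have ch: "add_character R (\<lambda>n. X n t)" using elim(2) X(2) by (simp add: add_character_def)
      \<comment> \<open>Periodicity modulo m, read at r = 0, says that the character is trivial on
        \<open>m R\<close>, which is excluded for this t.\<close>
      have "\<not> rational_character R (\<lambda>n. X n t)"
      proof
        assume "rational_character R (\<lambda>n. X n t)"
        then obtain m where m: "m \<in> R - {0}" "\<And>n r. n \<in> R \<Longrightarrow> r \<in> R \<Longrightarrow> X (m * n + r) t = X r t"
          by (auto simp: rational_character_def)
        obtain n where n: "n \<in> R" "X (m * n) t \<noteq> 1" using elim(1) m(1) by blast
        have "X 0 t = X 0 t * X 0 t" using elim(2)[rule_format, of 0 0] subring_0[OF R] by simp
        hence "X 0 t = 1" using X(2)[of 0 t] by auto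
        thus False using m(2)[OF n(1) subring_0[OF R]] n(2) by simp
      qed
      hence "irrational_character R (\<lambda>n. X n t)" using ch by (simp add: irrational_character_def)
      hence "UC_lim R (\<lambda>n. X (poly P n) t) 0"
        using good unfolding good_for_irrational_equidistribution_def by blast
      thus ?case using \<Phi> by (simp add: UC_lim_def a_def)
    qed
    have "(\<lambda>N. \<integral>t. (norm (a N t))\<^sup>2 \<partial>\<nu>) \<longlonglongrightarrow> (\<integral>t. 0 \<partial>\<nu>)"
    proof (rule integral_dominated_convergence[where w = "\<lambda>_. 1"])
      show "AE t in \<nu>. (\<lambda>N. (norm (a N t))\<^sup>2) \<longlonglongrightarrow> 0"
        using lim by eventually_elim (auto intro!: tendsto_eq_intros)
      show "AE t in \<nu>. norm ((norm (a N t))\<^sup>2) \<le> 1" for N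
      proof (rule AE_I2)
        fix t
        have "norm (\<Sum>n\<in>\<Phi> N. X (poly P n) t) \<le> (\<Sum>n\<in>\<Phi> N. 1)" by (rule sum_norm_le) (simp add: X)
        hence "norm (a N t) \<le> 1" using fin[of N] ne[of N]
          by (simp add: a_def average_def norm_divide divide_le_eq card_gt_0_iff)
        thus "norm ((norm (a N t))\<^sup>2) \<le> 1" by (simp add: power_le_one)
      qed
      show "(\<lambda>t. (norm (a N t))\<^sup>2) \<in> borel_measurable \<nu>" for N unfolding a_def average_def by measurable
    qed simp_all
    thus ?thesis using tendsto_mult_right_zero by simp
  qed simp
  hence "(\<lambda>N. ennreal (s * (\<integral>t. (norm (a N t))\<^sup>2 \<partial>\<nu>))) \<longlonglongrightarrow> ennreal 0" by (rule tendsto_ennrealI)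
  ultimately show "(\<lambda>N. \<integral>\<^sup>+x. ennreal ((norm (average (\<Phi> N) (\<lambda>n. f (T (poly P n) x)) - (\<integral>y. f y \<partial>M)))\<^sup>2) \<partial>M) \<longlonglongrightarrow> 0"
    by (simp add: c_def)
qed

end

lemma ergodic_averages_converge_if_good:
  assumes "is_subring R" "countable R" "P \<in> polys_over R" "good_for_irrational_equidistribution R P"
  shows "ergodic_averages_converge TYPE('x) R P"
  unfolding ergodic_averages_converge_def
proof (intro allI impI)
  fix M :: "'x measure" and T f
  assume A: "measure_preserving_system R M T \<and> ergodic_along_ideals R M T \<and> L2 M f"
  interpret ring_system R M T
    by (rule ring_system.intro) (use A assms in auto)
  show "UC_lim_L2 M R (\<lambda>n x. f (T (poly P n) x)) (\<lambda>x. \<integral>y. f y \<partial>M)"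
    using A assms by (intro polynomial_averages_converge) auto
qed

section \<open>Rotations\<close>

definition angle :: "('k \<Rightarrow> complex) \<Rightarrow> 'k \<Rightarrow> real" where
  "angle \<psi> n = Arg2pi (\<psi> n) / (2 * pi)"

text \<open>The circle, measured in full turns, is represented by [0,1), so that the system has real
  points and fits the instance \<open>TYPE(real)\<close> of the convergence hypothesis.\<close>

definition rotation :: "('k \<Rightarrow> complex) \<Rightarrow> 'k \<Rightarrow> real \<Rightarrow> real" where
  "rotation \<psi> n x = frac (x + angle \<psi> n)"

lemma cis_frac: "cis (2 * pi * frac x) = cis (2 * pi * x)"
proof -
  have "cis (2 * pi * x) = cis (2 * pi * frac x + 2 * pi * of_int \<lfloor>x\<rfloor>)"
    by (simp add: frac_def algebra_simps)
  also have "\<dots> = cis (2 * pi * frac x)"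
    by (simp add: cis_mult[symmetric] cis_multiple_2pi)
  finally show ?thesis by simp
qed

text \<open>Reduces equations between points of [0,1) to multiplicative identities on the unit
  circle, where no fractional parts occur.\<close>

lemma cis_2pi_inj:
  assumes "x \<in> {0..<1}" "y \<in> {0..<1}" "cis (2 * pi * x) = cis (2 * pi * y)"
  shows "x = y"
proof -
  have "cis (2 * pi * x - 2 * pi * y) = 1"
    using assms(3) by (simp add: cis_divide[symmetric])
  hence "cos (2 * pi * (x - y)) = 1" by (simp add: complex_eq_iff algebra_simps)
  then obtain l :: int where "2 * pi * (x - y) = real_of_int l * 2 * pi"
    by (auto simp: cos_one_2pi_int)
  hence l: "x - y = real_of_int l" by simp
  hence "\<bar>real_of_int l\<bar> < 1" using assms by auto
  hence "l = 0" by linarith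
  thus ?thesis using l by simp
qed

lemma angle_range: "angle \<psi> n \<in> {0..<1}"
  using Arg2pi_ge_0[of "\<psi> n"] Arg2pi_lt_2pi[of "\<psi> n"] by (simp add: angle_def)

lemma cis_angle: "norm (\<psi> n) = 1 \<Longrightarrow> cis (2 * pi * angle \<psi> n) = \<psi> n"
  using complex_norm_eq_1_exp[of "\<psi> n"] by (simp add: angle_def cis_conv_exp)

lemma rotation_range: "rotation \<psi> n x \<in> {0..<1}"
  by (simp add: rotation_def frac_ge_0 frac_lt_1)

lemma cis_rotation: "norm (\<psi> n) = 1 \<Longrightarrow> cis (2 * pi * rotation \<psi> n x) = \<psi> n * cis (2 * pi * x)"
  by (simp add: rotation_def cis_frac cis_angle distrib_left cis_mult[symmetric])

section \<open>Additive characters\<close>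

lemma add_character_0:
  assumes "is_subring R" "add_character R \<psi>"
  shows "\<psi> 0 = 1"
proof -
  have "\<psi> (0 + 0) = \<psi> 0 * \<psi> 0" "norm (\<psi> 0) = 1"
    using assms subring_0[OF assms(1)] unfolding add_character_def by blast+
  thus ?thesis by auto
qed

lemma add_character_of_nat_mult:
  assumes "is_subring R" "add_character R \<psi>" "a \<in> R"
  shows "\<psi> (of_nat j * a) = \<psi> a ^ j"
proof (induction j)
  case 0
  thus ?case using add_character_0[OF assms(1,2)] by simp
next
  case (Suc j)
  have "of_nat j * a \<in> R" using assms by (intro subring_mult subring_of_nat)
  hence "\<psi> (a + of_nat j * a) = \<psi> a * \<psi> (of_nat j * a)"
    using assms by (auto simp: add_character_def)
  thus ?case using Suc by (simp add: distrib_right)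
qed

lemma add_character_diff:
  assumes "is_subring R" "add_character R \<psi>" "a \<in> R" "b \<in> R"
  shows "\<psi> (a - b) * \<psi> b = \<psi> a"
proof -
  have "\<psi> (a - b + b) = \<psi> (a - b) * \<psi> b"
    using assms subring_diff[OF assms(1)] unfolding add_character_def by blast
  thus ?thesis by simp
qed

text \<open>Used contrapositively: an irrational character is nontrivial on each \<open>m R\<close>
  with \<open>m \<noteq> 0\<close>, which is the source of ergodicity for rotations.\<close>

lemma rational_characterI:
  assumes R: "is_subring R" and \<psi>: "add_character R \<psi>" and m: "m \<in> R" "m \<noteq> 0"
    and triv: "\<And>n. n \<in> R \<Longrightarrow> \<psi> (m * n) = 1"
  shows "rational_character R \<psi>"
  unfolding rational_character_def
proof (intro conjI \<psi> bexI[of _ m] ballI)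
  fix n r assume "n \<in> R" "r \<in> R"
  moreover from this have "m * n \<in> R" using subring_mult[OF R] m by blast
  ultimately show "\<psi> (m * n + r) = \<psi> r" using \<psi> triv by (simp add: add_character_def)
qed (use m in auto)

lemma rotation_add:
  assumes "add_character R \<psi>" "m \<in> R" "n \<in> R" "is_subring R"
  shows "rotation \<psi> (m + n) x = rotation \<psi> m (rotation \<psi> n x)"
proof (rule cis_2pi_inj[OF rotation_range rotation_range])
  have "norm (\<psi> m) = 1" "norm (\<psi> n) = 1" "norm (\<psi> (m + n)) = 1" "\<psi> (m + n) = \<psi> m * \<psi> n"
    using assms subring_add[OF assms(4)] by (auto simp: add_character_def norm_mult)
  thus "cis (2 * pi * rotation \<psi> (m + n) x) = cis (2 * pi * rotation \<psi> m (rotation \<psi> n x))"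
    by (simp add: cis_rotation)
qed

lemma rotation_0:
  assumes "is_subring R" "add_character R \<psi>" "x \<in> {0..<1}"
  shows "rotation \<psi> 0 x = x"
  by (rule cis_2pi_inj[OF rotation_range assms(3)])
    (simp add: cis_rotation add_character_0[OF assms(1,2)])

lemma second_countable_euclidean: "second_countable (euclidean :: 'a::second_countable_topology topology)"
proof -
  obtain B :: "'a set set" where B: "countable B" "topological_basis B"
    using ex_countable_basis by blast
  show ?thesis
    unfolding second_countable_def
  proof (intro exI[of _ B] conjI B(1) ballI allI impI)
    show "openin euclidean V" if "V \<in> B" for V
      using topological_basis_open[OF B(2) that] by simp
    show "\<exists>V\<in>B. x \<in> V \<and> V \<subseteq> U" if "openin euclidean U \<and> x \<in> U" for U x
    proof -
      have "open U" "x \<in> U" using that by auto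
      from topological_basisE[OF B(2) this] obtain V where "V \<in> B" "x \<in> V" "V \<subseteq> U" .
      thus ?thesis by blast
    qed
  qed
qed

lemma standard_prob_space_real:
  fixes S :: "real set"
  assumes M: "prob_space M" and sets: "sets M = sets (restrict_space borel S)" and S: "S \<in> sets borel"
    and cm: "completely_metrizable_space (top_of_set S)"
  shows "standard_prob_space M"
  unfolding standard_prob_space_def
proof (intro conjI M exI[of _ "top_of_set S"] cm)
  have sp: "space M = S"
    using sets_eq_imp_space_eq[OF sets] by (simp add: space_restrict_space)
  show "second_countable (top_of_set S)"
    by (intro second_countable_subtopology) (rule second_countable_euclidean)
  show "topspace (top_of_set S) = space M" by (simp add: sp)
  have sb: "sets (borel :: real measure) = sigma_sets UNIV {S. open S}"
    by (simp add: borel_def)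
  hence "sets M = (\<inter>) S ` sigma_sets UNIV {S. open S}"
    by (simp add: sets sets_restrict_space)
  also have "\<dots> = sigma_sets S ((\<inter>) S ` {S. open S})"
    by (rule sigma_sets_Int) (use S sb in simp_all)
  also have "(\<inter>) S ` {S. open S} = {U. openin (top_of_set S) U}"
    by (auto simp: openin_open)
  finally show "sets M = sigma_sets (space M) {U. openin (top_of_set S) U}" by (simp add: sp)
qed

text \<open>The eigenfunction has modulus 1, so the L2 norm of the average of its translates is
  exactly the modulus of the average of \<open>\<psi> (poly P n)\<close>. Its mean vanishes, since
  invariance under the rotation by \<open>\<psi> n0\<close> multiplies the mean by a number
  different from 1.\<close>

lemma UC_lim_if_rotation_averages_converge:
  assumes R: "is_subring R" and \<psi>: "add_character R \<psi>" and nontriv: "n0 \<in> R" "\<psi> n0 \<noteq> 1"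
    and P: "P \<in> polys_over R" and conv: "ergodic_averages_converge TYPE(real) R P"
    and sys: "measure_preserving_system R M (rotation \<psi>)" and erg: "ergodic_along_ideals R M (rotation \<psi>)"
    and borel: "borel_measurable borel \<subseteq> (borel_measurable M :: (real \<Rightarrow> complex) set)"
  shows "UC_lim R (\<lambda>n. \<psi> (poly P n)) 0"
  unfolding UC_lim_def
proof (intro allI impI)
  fix \<Phi> assume \<Phi>: "folner R \<Phi>"
  interpret prob_space M using sys by (simp add: measure_preserving_system_def standard_prob_space_def)
  define f where "f x = cis (2 * pi * x)" for x
  have "f \<in> borel_measurable borel"
    unfolding f_def by (intro borel_measurable_continuous_onI continuous_intros)
  hence fm: "f \<in> borel_measurable M" using borel by blast
  have f: "L2 M f" using fm by (simp add: L2_def f_def)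
  have \<psi>1: "norm (\<psi> n) = 1" if "n \<in> R" for n using \<psi> that by (simp add: add_character_def)
  have fT: "f (rotation \<psi> n x) = \<psi> n * f x" if "n \<in> R" for n x
    using \<psi>1[OF that] by (simp add: f_def cis_rotation)
  have "(\<integral>x. f x \<partial>M) = (\<integral>x. f x \<partial>distr M M (rotation \<psi> n0))"
    using sys nontriv by (simp add: measure_preserving_system_def)
  also have "\<dots> = (\<integral>x. f (rotation \<psi> n0 x) \<partial>M)"
    using sys nontriv fm by (intro integral_distr) (auto simp: measure_preserving_system_def)
  also have "\<dots> = \<psi> n0 * (\<integral>x. f x \<partial>M)" by (simp add: fT[OF nontriv(1)])
  finally have "(1 - \<psi> n0) * (\<integral>x. f x \<partial>M) = 0" by (simp add: algebra_simps)
  hence f0: "(\<integral>x. f x \<partial>M) = 0" using nontriv by simp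
  have PR: "poly P n \<in> R" if "n \<in> R" for n by (rule poly_in_subring[OF R P that])
  define a where "a N = average (\<Phi> N) (\<lambda>n. \<psi> (poly P n))" for N
  have "(\<lambda>N. \<integral>\<^sup>+x. ennreal ((norm (average (\<Phi> N) (\<lambda>n. f (rotation \<psi> (poly P n) x)) - (\<integral>y. f y \<partial>M)))\<^sup>2) \<partial>M) \<longlonglongrightarrow> 0"
    using conv sys erg f \<Phi> unfolding ergodic_averages_converge_def UC_lim_L2_def by blast
  also have "(\<lambda>N. \<integral>\<^sup>+x. ennreal ((norm (average (\<Phi> N) (\<lambda>n. f (rotation \<psi> (poly P n) x)) - (\<integral>y. f y \<partial>M)))\<^sup>2) \<partial>M)
      = (\<lambda>N. ennreal ((norm (a N))\<^sup>2))"
  proof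
    fix N
    have sub: "n \<in> R" if "n \<in> \<Phi> N" for n using \<Phi> that by (auto simp: folner_def)
    have "average (\<Phi> N) (\<lambda>n. f (rotation \<psi> (poly P n) x)) = a N * f x" for x
      using sub PR by (simp add: average_def a_def fT sum_distrib_right)
    hence "norm (average (\<Phi> N) (\<lambda>n. f (rotation \<psi> (poly P n) x))) = norm (a N)" for x
      by (simp add: norm_mult f_def)
    thus "(\<integral>\<^sup>+x. ennreal ((norm (average (\<Phi> N) (\<lambda>n. f (rotation \<psi> (poly P n) x)) - (\<integral>y. f y \<partial>M)))\<^sup>2) \<partial>M)
      = ennreal ((norm (a N))\<^sup>2)" by (simp add: f0 emeasure_space_1)
  qed
  finally have "(\<lambda>N. ennreal ((norm (a N))\<^sup>2)) \<longlonglongrightarrow> ennreal 0" by simp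
  hence "(\<lambda>N. (norm (a N))\<^sup>2) \<longlonglongrightarrow> 0" by (subst (asm) tendsto_ennreal_iff) auto
  hence "(\<lambda>N. sqrt ((norm (a N))\<^sup>2)) \<longlonglongrightarrow> sqrt 0" by (rule tendsto_real_sqrt)
  hence "(\<lambda>N. norm (a N)) \<longlonglongrightarrow> 0" by simp
  thus "(\<lambda>N. average (\<Phi> N) (\<lambda>n. \<psi> (poly P n))) \<longlonglongrightarrow> 0" unfolding a_def by (rule tendsto_norm_zero_cancel)
qed

subsection \<open>Positive characteristic\<close>

text \<open>The p-th roots of unity form a group of prime order, generated by any element other than
  1: the first p powers of z are distinct by Bezout, and there are at most p roots.\<close>

lemma roots_of_unity_prime_powers:
  fixes z w :: complex
  assumes p: "prime p" and z: "z ^ p = 1" "z \<noteq> 1" and w: "w ^ p = 1"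
  obtains j where "w = z ^ j"
proof -
  have p0: "p > 0" using p by (rule prime_gt_0_nat)
  have z0: "z \<noteq> 0" using z p0 by (auto simp: power_0_left)
  have inj: "inj_on (\<lambda>j. z ^ j) {..<p}"
  proof (rule linorder_inj_onI)
    fix i j assume ij: "i < j" "i \<in> {..<p}" "j \<in> {..<p}"
    show "z ^ i \<noteq> z ^ j"
    proof
      assume "z ^ i = z ^ j"
      moreover have "z ^ j = z ^ i * z ^ (j - i)" using ij by (simp add: power_add[symmetric])
      ultimately have d: "z ^ (j - i) = 1" using z0 by simp
      have "coprime (j - i) p"
        using ij p by (metis coprime_commute diff_less lessThan_iff less_imp_diff_less nat_dvd_not_less prime_imp_coprime_nat zero_less_diff)
      then obtain u v where "(j - i) * u = p * v + 1"
        using bezout_nat[of "j - i" p] ij by (auto simp: coprime_iff_gcd_eq_1)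
      hence "z ^ ((j - i) * u) = z ^ (p * v + 1)" by simp
      hence "z = 1" using d z by (simp add: power_mult power_add)
      thus False using z by simp
    qed
  qed auto
  have "(\<lambda>j. z ^ j) ` {..<p} = {x. x ^ p = 1}"
  proof (rule card_subset_eq)
    show "finite {x::complex. x ^ p = 1}" using p0 by (intro finite_roots_unity) simp
    show "(\<lambda>j. z ^ j) ` {..<p} \<subseteq> {x. x ^ p = 1}"
      using z by (auto simp: power_mult[symmetric] mult.commute[of _ p]) (simp add: power_mult)
    hence "card ((\<lambda>j. z ^ j) ` {..<p}) \<le> card {x::complex. x ^ p = 1}"
      using \<open>finite {x::complex. x ^ p = 1}\<close> by (intro card_mono)
    moreover have "card {x::complex. x ^ p = 1} \<le> p" using p0 by (intro card_roots_unity) simp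
    ultimately show "card ((\<lambda>j. z ^ j) ` {..<p}) = card {x::complex. x ^ p = 1}"
      using card_image[OF inj] by simp
  qed
  hence "w \<in> (\<lambda>j. z ^ j) ` {..<p}" using w by blast
  thus ?thesis using that by blast
qed

text \<open>The relation \<open>p * n = 0\<close> gives \<open>\<psi> n ^ p = 1\<close>, so the
  rotations preserve \<open>S\<close>. A nonzero ideal contains an element on which \<psi> is not 1;
  its value generates the p-th roots of unity. The ideal therefore acts transitively, and an
  invariant set is empty or everything.\<close>

lemma rotation_system_char_pos:
  fixes R :: "'k::field set"
  assumes R: "is_subring R" and p: "CHAR('k) > 0" and \<psi>: "irrational_character R \<psi>"
  defines "S \<equiv> {x \<in> {0..<1}. cis (2 * pi * x) ^ CHAR('k) = 1}"
  shows "measure_preserving_system R (uniform_count_measure S) (rotation \<psi>)"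
    "ergodic_along_ideals R (uniform_count_measure S) (rotation \<psi>)"
    "borel_measurable borel \<subseteq> (borel_measurable (uniform_count_measure S) :: (real \<Rightarrow> complex) set)"
proof -
  define q where "q = CHAR('k)"
  have q: "prime q" unfolding q_def using p by (rule prime_CHAR_semidom)
  have ch: "add_character R \<psi>" using \<psi> by (simp add: irrational_character_def)
  have \<psi>1: "norm (\<psi> n) = 1" if "n \<in> R" for n using ch that by (simp add: add_character_def)
  have \<psi>q: "\<psi> n ^ q = 1" if "n \<in> R" for n
    using add_character_of_nat_mult[OF R ch that, of q] add_character_0[OF R ch] by (simp add: q_def)
  have "inj_on (\<lambda>x. cis (2 * pi * x)) S"
    by (rule inj_onI, rule cis_2pi_inj) (auto simp: S_def)
  moreover have "(\<lambda>x. cis (2 * pi * x)) ` S \<subseteq> {z. z ^ q = 1}" by (auto simp: S_def q_def)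
  moreover have "finite {z::complex. z ^ q = 1}"
    using prime_gt_0_nat[OF q] by (intro finite_roots_unity) simp
  ultimately have fin: "finite S" by (meson finite_imageD finite_subset)
  have "0 \<in> S" by (simp add: S_def)
  hence ne: "S \<noteq> {}" by blast
  let ?M = "uniform_count_measure S"
  have sets: "sets ?M = Pow S" and space: "space ?M = S"
    by (simp_all add: sets_uniform_count_measure space_uniform_count_measure)
  have TS: "rotation \<psi> n x \<in> S" if "n \<in> R" "x \<in> S" for n x
    using rotation_range[of \<psi> n x] \<psi>q[OF that(1)] \<psi>1[OF that(1)] that(2)
    by (simp add: S_def cis_rotation power_mult_distrib q_def)
  have inj: "inj_on (rotation \<psi> n) S" if "n \<in> R" for n
  proof (rule inj_onI)
    fix x y assume xy: "x \<in> S" "y \<in> S" "rotation \<psi> n x = rotation \<psi> n y"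
    hence "\<psi> n * cis (2 * pi * x) = \<psi> n * cis (2 * pi * y)"
      using \<psi>1[OF that] by (metis cis_rotation)
    moreover have "\<psi> n \<noteq> 0" using \<psi>1[OF that] by auto
    ultimately show "x = y" using xy by (intro cis_2pi_inj) (auto simp: S_def)
  qed
  have surj: "rotation \<psi> n ` S = S" if "n \<in> R" for n
    using TS[OF that] inj[OF that] fin by (intro endo_inj_surj) auto
  have "completely_metrizable_space (top_of_set S)"
    using fin by (intro completely_metrizable_space_closedin completely_metrizable_space_euclidean) (simp add: finite_imp_closed)
  moreover have "sets ?M = sets (restrict_space borel S)"
  proof -
    have "Pow S \<subseteq> sets (restrict_space borel S)"
      using fin by (auto simp: sets_restrict_space_iff finite_imp_closed finite_subset)
    moreover have "sets (restrict_space borel S) \<subseteq> Pow S"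
      using sets.sets_into_space[of _ "restrict_space borel S"] by (auto simp: space_restrict_space)
    ultimately show ?thesis unfolding sets by (rule subset_antisym)
  qed
  moreover have "S \<in> sets borel" using fin by (simp add: finite_imp_closed)
  ultimately have std: "standard_prob_space ?M"
    by (intro standard_prob_space_real[OF prob_space_uniform_count_measure[OF fin ne]])
  have meas: "rotation \<psi> n \<in> measurable ?M ?M" if "n \<in> R" for n
    using TS[OF that] by (intro measurableI) (auto simp: sets space)
  show "measure_preserving_system R ?M (rotation \<psi>)"
    unfolding measure_preserving_system_def
  proof (intro conjI std ballI)
    fix n assume n: "n \<in> R"
    show "rotation \<psi> n \<in> measurable ?M ?M" by (rule meas[OF n])
    show "distr ?M ?M (rotation \<psi> n) = ?M"
    proof (rule measure_eqI)
      fix A assume "A \<in> sets (distr ?M ?M (rotation \<psi> n))"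
      hence A: "A \<subseteq> S" by (simp add: sets)
      define B where "B = rotation \<psi> n -` A \<inter> S"
      have "rotation \<psi> n ` B = A \<inter> rotation \<psi> n ` S" by (auto simp: B_def)
      hence "rotation \<psi> n ` B = A" using surj[OF n] A by blast
      moreover have "inj_on (rotation \<psi> n) B" using inj[OF n] by (rule inj_on_subset) (simp add: B_def)
      ultimately have card: "card B = card A" by (metis card_image)
      have "emeasure (distr ?M ?M (rotation \<psi> n)) A = emeasure ?M B"
        using A by (subst emeasure_distr[OF meas[OF n]]) (simp_all add: sets space B_def)
      also have "\<dots> = emeasure ?M A"
        using A fin card by (simp add: emeasure_uniform_count_measure B_def)
      finally show "emeasure (distr ?M ?M (rotation \<psi> n)) A = emeasure ?M A" .
    qed simp
  next
    show "rotation \<psi> 0 x = x" if "x \<in> space ?M" for x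
      using that unfolding space by (intro rotation_0[OF R ch]) (simp add: S_def)
    show "rotation \<psi> (m + n) x = rotation \<psi> m (rotation \<psi> n x)" if "m \<in> R" "n \<in> R" for m n x
      by (rule rotation_add[OF ch that R])
  qed
  show "ergodic_along_ideals R ?M (rotation \<psi>)"
    unfolding ergodic_along_ideals_def
  proof (intro allI impI ballI)
    fix I A assume I: "ideal_of R I \<and> I \<noteq> {0}" and A: "A \<in> sets ?M" and inv: "\<forall>n\<in>I. rotation \<psi> n -` A \<inter> space ?M = A"
    obtain m where m: "m \<in> I" "m \<noteq> 0" using I by (auto simp: ideal_of_def)
    hence mR: "m \<in> R" using I by (auto simp: ideal_of_def)
    obtain n where n: "n \<in> R" "\<psi> (m * n) \<noteq> 1"
      using rational_characterI[OF R ch mR m(2)] \<psi> by (auto simp: irrational_character_def)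
    have "n * m \<in> I" using I m n unfolding ideal_of_def by blast
    hence mn: "m * n \<in> I" "m * n \<in> R" using subring_mult[OF R mR n(1)] by (simp_all add: mult.commute)
    have "A = S" if Ane: "A \<noteq> {}"
    proof -
      obtain x where x: "x \<in> A" using Ane by blast
      have AS: "A \<subseteq> S" using A by (simp add: sets)
      have "y \<in> A" if y: "y \<in> S" for y
      proof -
        have "(cis (2 * pi * y) / cis (2 * pi * x)) ^ q = 1"
          using y x AS by (auto simp: S_def q_def power_divide)
        then obtain j where j: "cis (2 * pi * y) / cis (2 * pi * x) = \<psi> (m * n) ^ j"
          using roots_of_unity_prime_powers[OF q \<psi>q[OF mn(2)] n(2)] by blast
        have jI: "of_nat j * (m * n) \<in> I" "of_nat j * (m * n) \<in> R"
          using I mn subring_of_nat[OF R] subring_mult[OF R] by (auto simp: ideal_of_def)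
        have "cis (2 * pi * rotation \<psi> (of_nat j * (m * n)) x) = cis (2 * pi * y)"
          unfolding cis_rotation[of \<psi>, OF \<psi>1[OF jI(2)]] add_character_of_nat_mult[OF R ch mn(2)] j[symmetric]
          by simp
        hence "rotation \<psi> (of_nat j * (m * n)) x = y"
          using y by (intro cis_2pi_inj rotation_range) (auto simp: S_def)
        moreover have "rotation \<psi> (of_nat j * (m * n)) x \<in> A" using inv jI(1) x by blast
        ultimately show ?thesis by simp
      qed
      thus ?thesis using AS by blast
    qed
    thus "measure ?M A = 0 \<or> measure ?M A = 1"
      using prob_space.prob_space[OF prob_space_uniform_count_measure[OF fin ne]] space by (cases "A = {}") auto
  qed
  show "borel_measurable borel \<subseteq> (borel_measurable ?M :: (real \<Rightarrow> complex) set)"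
    by (auto simp: uniform_count_measure_def)
qed

subsection \<open>Characteristic zero\<close>

lemma emeasure_lborel_shift:
  fixes B :: "real set"
  assumes B: "B \<in> sets borel"
  shows "emeasure lborel {x. x + t \<in> B} = emeasure lborel B"
proof -
  have "emeasure lborel B = emeasure (distr lborel borel ((+) t)) B" by (simp add: lborel_distr_plus)
  also have "\<dots> = emeasure lborel ((+) t -` B \<inter> space lborel)"
    by (rule emeasure_distr) (use B in auto)
  also have "(+) t -` B \<inter> space lborel = {x. x + t \<in> B}" by (auto simp: add.commute)
  finally show ?thesis by simp
qed

definition unit_lebesgue :: "real measure" where
  "unit_lebesgue = restrict_space lborel {0..<1}"

lemma space_unit_lebesgue [simp]: "space unit_lebesgue = {0..<1}"
  by (simp add: unit_lebesgue_def space_restrict_space)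

lemma sets_unit_lebesgue_iff: "A \<in> sets unit_lebesgue \<longleftrightarrow> A \<subseteq> {0..<1} \<and> A \<in> sets borel"
  by (simp add: unit_lebesgue_def sets_restrict_space_iff)

lemma emeasure_unit_lebesgue: "A \<in> sets unit_lebesgue \<Longrightarrow> emeasure unit_lebesgue A = emeasure lborel A"
  by (simp add: unit_lebesgue_def emeasure_restrict_space sets_restrict_space_iff)

lemma prob_space_unit_lebesgue: "prob_space unit_lebesgue"
proof
  have "{0..<1} \<in> sets unit_lebesgue" by (simp add: sets_unit_lebesgue_iff)
  from emeasure_unit_lebesgue[OF this] show "emeasure unit_lebesgue (space unit_lebesgue) = 1" by simp
qed

text \<open>The interval [0,1) is not closed on the line, but it is relatively open in the closed
  half-line from 0 and inherits complete metrizability from there.\<close>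

lemma standard_prob_space_unit_lebesgue: "standard_prob_space unit_lebesgue"
proof (rule standard_prob_space_real[OF prob_space_unit_lebesgue])
  show "sets unit_lebesgue = sets (restrict_space borel {0..<1})"
    by (auto simp: sets_unit_lebesgue_iff sets_restrict_space_iff)
  have "openin (top_of_set {0..}) {0..<1::real}"
    unfolding openin_open by (intro exI[of _ "{..<1}"]) auto
  moreover have "completely_metrizable_space (top_of_set {0::real..})"
    by (intro completely_metrizable_space_closedin completely_metrizable_space_euclidean) simp
  ultimately have "completely_metrizable_space (subtopology (top_of_set {0..}) {0..<1::real})"
    by (rule completely_metrizable_space_openin[rotated])
  thus "completely_metrizable_space (top_of_set {0..<1::real})"
    by (simp add: subtopology_subtopology Int_absorb1 subset_eq)
qed simp

lemma rotation_eq: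
  assumes "x \<in> {0..<1}"
  shows "rotation \<psi> n x = (if x < 1 - angle \<psi> n then x + angle \<psi> n else x + (angle \<psi> n - 1))"
proof -
  have a: "0 \<le> angle \<psi> n" "angle \<psi> n < 1" using angle_range[of \<psi> n] by auto
  show ?thesis
  proof (cases "x < 1 - angle \<psi> n")
    case True
    hence "frac (x + angle \<psi> n) = x + angle \<psi> n" using a assms by (simp add: frac_eq)
    thus ?thesis using True by (simp add: rotation_def)
  next
    case False
    have "frac (x + angle \<psi> n) = x + (angle \<psi> n - 1)"
      by (subst frac_unique_iff) (use False a assms in \<open>auto\<close>)
    thus ?thesis using False by (simp add: rotation_def)
  qed
qed

lemma rotation_measurable: "rotation \<psi> n \<in> measurable unit_lebesgue unit_lebesgue"
proof (rule measurableI)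
  show "rotation \<psi> n x \<in> space unit_lebesgue" for x using rotation_range[of \<psi> n x] by simp
  fix A assume "A \<in> sets unit_lebesgue"
  hence "A \<in> sets borel" by (simp add: sets_unit_lebesgue_iff)
  moreover have "rotation \<psi> n \<in> borel_measurable borel"
    unfolding rotation_def frac_def by measurable
  ultimately have "rotation \<psi> n -` A \<in> sets borel"
    using measurable_sets[of "rotation \<psi> n" borel borel A] by simp
  thus "rotation \<psi> n -` A \<inter> space unit_lebesgue \<in> sets unit_lebesgue"
    by (simp add: sets_unit_lebesgue_iff)
qed

text \<open>A rotation exchanges two intervals, so the preimage of A is a disjoint union of
  translates of its parts in [a,1) and [0,a).\<close>

lemma rotation_distr: "distr unit_lebesgue unit_lebesgue (rotation \<psi> n) = unit_lebesgue"
proof (rule measure_eqI)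
  fix A assume "A \<in> sets (distr unit_lebesgue unit_lebesgue (rotation \<psi> n))"
  hence A: "A \<in> sets unit_lebesgue" by simp
  hence Ab: "A \<in> sets borel" "A \<subseteq> {0..<1}" by (auto simp: sets_unit_lebesgue_iff)
  define a where "a = angle \<psi> n"
  have a: "0 \<le> a" "a < 1" using angle_range[of \<psi> n] by (auto simp: a_def)
  define B where "B = A \<inter> {a..<1}"
  define C where "C = A \<inter> {0..<a}"
  have BC: "B \<in> sets borel" "C \<in> sets borel" using Ab by (auto simp: B_def C_def)
  have m: "{x. x + t \<in> D} \<in> sets borel" if "D \<in> sets borel" for t and D :: "real set"
    using measurable_sets[of "\<lambda>x. x + t" borel borel D] that by (simp add: vimage_def)
  have pre: "rotation \<psi> n -` A \<inter> {0..<1} = {x. x + a \<in> B} \<union> {x. x + (a - 1) \<in> C}"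
    using a Ab(2) by (auto simp: rotation_eq a_def[symmetric] B_def C_def split: if_splits)
  have "emeasure (distr unit_lebesgue unit_lebesgue (rotation \<psi> n)) A
      = emeasure unit_lebesgue (rotation \<psi> n -` A \<inter> {0..<1})"
    by (subst emeasure_distr[OF rotation_measurable A]) simp
  also have "\<dots> = emeasure lborel ({x. x + a \<in> B} \<union> {x. x + (a - 1) \<in> C})"
    unfolding pre[symmetric]
    by (rule emeasure_unit_lebesgue) (use measurable_sets[OF rotation_measurable[of \<psi> n] A] in simp)
  also have "\<dots> = emeasure lborel {x. x + a \<in> B} + emeasure lborel {x. x + (a - 1) \<in> C}"
  proof (rule plus_emeasure[symmetric])
    show "{x. x + a \<in> B} \<inter> {x. x + (a - 1) \<in> C} = {}" by (auto simp: B_def C_def)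
  qed (use m BC in simp_all)
  also have "\<dots> = emeasure lborel B + emeasure lborel C"
    by (simp add: emeasure_lborel_shift BC)
  also have "\<dots> = emeasure lborel (B \<union> C)"
    using BC by (intro plus_emeasure) (auto simp: B_def C_def)
  also have "B \<union> C = A" using Ab(2) a by (auto simp: B_def C_def)
  also have "emeasure lborel A = emeasure unit_lebesgue A" by (rule emeasure_unit_lebesgue[OF A, symmetric])
  finally show "emeasure (distr unit_lebesgue unit_lebesgue (rotation \<psi> n)) A = emeasure unit_lebesgue A" .
qed simp

text \<open>A subset of \<open>[0,1)\<close> that is invariant under arbitrarily small shifts occupies the same
  proportion of every interval, hence of itself.\<close>

lemma zero_one_if_small_shifts:
  fixes A :: "real set"
  assumes A: "A \<in> sets borel" "A \<subseteq> {0..<1}"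
    and shift: "\<And>\<epsilon>. \<epsilon> > 0 \<Longrightarrow> \<exists>d. 0 < d \<and> d < \<epsilon> \<and> (\<forall>x. 0 \<le> x \<and> x + d < 1 \<longrightarrow> (x + d \<in> A \<longleftrightarrow> x \<in> A))"
  shows "measure lborel A = 0 \<or> measure lborel A = 1"
proof -
  have fin: "emeasure lborel B < \<infinity>" if "B \<subseteq> A" "B \<in> sets borel" for B
  proof -
    have "emeasure lborel B \<le> emeasure lborel {0..<1::real}"
      using that A by (intro emeasure_mono) auto
    thus ?thesis by (simp add: le_less_trans)
  qed
  hence fm: "B \<in> fmeasurable lborel" if "B \<subseteq> A" "B \<in> sets borel" for B
    using that by (intro fmeasurableI) auto
  define F where "F x = measure lborel (A \<inter> {0..<x})" for x
  have F_split: "F y = F x + measure lborel (A \<inter> {x..<y})" if "0 \<le> x" "x \<le> y" for x y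
  proof -
    have "A \<inter> {0..<y} = (A \<inter> {0..<x}) \<union> (A \<inter> {x..<y})" using that by auto
    moreover have "measure lborel ((A \<inter> {0..<x}) \<union> (A \<inter> {x..<y})) = F x + measure lborel (A \<inter> {x..<y})"
      unfolding F_def using A by (intro measure_Un_AE AE_I2 fm) auto
    ultimately show ?thesis by (simp add: F_def)
  qed
  have part: "0 \<le> measure lborel (A \<inter> {x..<y})" "measure lborel (A \<inter> {x..<y}) \<le> y - x" if "x \<le> y" for x y
  proof -
    have "measure lborel (A \<inter> {x..<y}) \<le> measure lborel {x..<y}"
      using A that by (intro measure_mono_fmeasurable) (auto simp: fmeasurable_def)
    thus "measure lborel (A \<inter> {x..<y}) \<le> y - x" using that by simp
  qed simp
  have F0: "F 0 = 0" by (simp add: F_def)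
  define c where "c = F 1"
  have c: "c = measure lborel A"
    unfolding c_def F_def using A by (intro arg_cong[of _ _ "measure lborel"]) auto
  have c01: "0 \<le> c" "c \<le> 1" using F_split[of 0 1] part[of 0 1] F0 by (auto simp: c_def)
  have lin: "F x = x * c" if x: "0 \<le> x" "x \<le> 1" for x
  proof -
    have "\<bar>F x - x * c\<bar> \<le> 0 + \<epsilon>" if \<epsilon>: "\<epsilon> > 0" for \<epsilon>
    proof -
      \<comment> \<open>Three errors of at most d arise: rounding x to whole blocks, rounding 1 to
        whole blocks, and comparing the two numbers of blocks.\<close>
      obtain d where d: "0 < d" "d < \<epsilon> / 3" and inv: "\<And>u. 0 \<le> u \<Longrightarrow> u + d < 1 \<Longrightarrow> u + d \<in> A \<longleftrightarrow> u \<in> A"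
        using shift[of "\<epsilon> / 3"] \<epsilon> by auto
      have block: "measure lborel (A \<inter> {real k * d..<real (Suc k) * d}) = F d" if "real (Suc k) * d \<le> 1" for k
        using that
      proof (induction k)
        case (Suc k)
        have eq: "A \<inter> {real k * d..<real (Suc k) * d} = {u. u + d \<in> A \<inter> {real (Suc k) * d..<real (Suc (Suc k)) * d}}"
        proof (intro Set.set_eqI iffI)
          fix u assume u: "u \<in> A \<inter> {real k * d..<real (Suc k) * d}"
          have "0 \<le> real k * d" using d by simp
          moreover have "real k * d \<le> u" using u by simp
          ultimately have u0: "0 \<le> u" by (rule order_trans)
          have "u + d < 1" using u Suc.prems by (auto simp: algebra_simps)
          from inv[OF u0 this] show "u \<in> {u. u + d \<in> A \<inter> {real (Suc k) * d..<real (Suc (Suc k)) * d}}"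
            using u by (auto simp: algebra_simps)
        next
          fix u assume u: "u \<in> {u. u + d \<in> A \<inter> {real (Suc k) * d..<real (Suc (Suc k)) * d}}"
          have "0 \<le> real k * d" using d by simp
          moreover have "real k * d \<le> u" using u by (simp add: algebra_simps)
          ultimately have u0: "0 \<le> u" by (rule order_trans)
          have "u + d < 1" using u Suc.prems by (auto simp: algebra_simps)
          from inv[OF u0 this] show "u \<in> A \<inter> {real k * d..<real (Suc k) * d}"
            using u by (auto simp: algebra_simps)
        qed
        have "F d = measure lborel (A \<inter> {real k * d..<real (Suc k) * d})"
          using Suc.IH Suc.prems d by (simp add: algebra_simps)
        also have "\<dots> = measure lborel (A \<inter> {real (Suc k) * d..<real (Suc (Suc k)) * d})"
          unfolding eq measure_def using A by (subst emeasure_lborel_shift) auto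
        finally show ?case by simp
      qed (simp add: F_def)
      have mult: "F (real k * d) = real k * F d" if "real k * d \<le> 1" for k
        using that
      proof (induction k)
        case (Suc k)
        have "real k * d \<le> real (Suc k) * d" using d by simp
        hence "F (real (Suc k) * d) = F (real k * d) + F d"
          using F_split[of "real k * d" "real (Suc k) * d"] block[OF Suc.prems] d by simp
        thus ?case using Suc.IH Suc.prems \<open>real k * d \<le> real (Suc k) * d\<close> by (simp add: algebra_simps)
      qed (simp add: F0)
      have approx: "\<exists>k::nat. real k * d \<le> y \<and> y < (real k + 1) * d \<and> real k * F d \<le> F y \<and> F y \<le> real k * F d + d"
        if y: "0 \<le> y" "y \<le> 1" for y
      proof -
        define k where "k = nat \<lfloor>y / d\<rfloor>"
        have "real k = real_of_int \<lfloor>y / d\<rfloor>" using y d by (simp add: k_def)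
        hence "real k \<le> y / d" "y / d < real k + 1" by linarith+
        hence k: "real k * d \<le> y" "y < (real k + 1) * d" using d by (simp_all add: field_simps)
        have "F y = real k * F d + measure lborel (A \<inter> {real k * d..<y})"
          using F_split[of "real k * d" y] mult[of k] k y d by simp
        thus ?thesis using k part[OF k(1)] by (intro exI[of _ k]) (auto simp: algebra_simps)
      qed
      obtain k where k: "real k * d \<le> x" "x < (real k + 1) * d" "real k * F d \<le> F x" "F x \<le> real k * F d + d"
        using approx[OF x] by blast
      obtain l where l: "real l * d \<le> 1" "1 < (real l + 1) * d" "real l * F d \<le> c" "c \<le> real l * F d + d"
        using approx[of 1] unfolding c_def by auto
      have Fd: "0 \<le> F d" "F d \<le> d" using F_split[of 0 d] part[of 0 d] F0 d by auto
      \<comment> \<open>As k and l count the blocks of length d that fit below x and below 1, k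
        differs from \<open>x * l\<close> by at most 1, and one block has mass at most d.\<close>
      have "\<bar>(real k - x * real l) * F d\<bar> \<le> d"
      proof -
        have "x * (real l * d) \<le> x" using x l(1) by (simp add: mult_left_le)
        moreover have "x \<le> x * ((real l + 1) * d)" using x l(2) mult_left_mono[of 1 "(real l + 1) * d" x] by simp
        moreover have "x * d \<le> d" using x d by (simp add: mult_left_le_one_le)
        moreover have "(real k - x * real l) * d = real k * d - x * (real l * d)"
          "x * ((real l + 1) * d) = x * (real l * d) + x * d" "(real k + 1) * d = real k * d + d"
          by (simp_all add: algebra_simps)
        ultimately have "\<bar>(real k - x * real l) * d\<bar> \<le> d" using k(1,2) by linarith
        hence "\<bar>real k - x * real l\<bar> * d \<le> 1 * d" using d by (simp add: abs_mult)
        hence "\<bar>real k - x * real l\<bar> \<le> 1" using d by (simp only: mult_le_cancel_right_pos)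
        hence "\<bar>real k - x * real l\<bar> * F d \<le> 1 * d" using Fd by (intro mult_mono) auto
        thus ?thesis using Fd by (simp add: abs_mult)
      qed
      moreover have "x * (real l * F d) \<le> x * c" "x * c \<le> x * (real l * F d + d)"
        using l x by (auto intro: mult_left_mono)
      moreover have "x * d \<le> d" using x d by (simp add: mult_left_le_one_le)
      ultimately have "\<bar>F x - x * c\<bar> \<le> d + d + d" using k(3,4) by (simp add: abs_le_iff algebra_simps)
      thus ?thesis using d by simp
    qed
    hence "\<bar>F x - x * c\<bar> \<le> 0" by (rule field_le_epsilon)
    thus ?thesis by simp
  qed
  \<comment> \<open>Lebesgue measure on A and c times Lebesgue measure on [0,1) will have the same
    distribution function and hence coincide. Evaluated at A itself, they give c = c * c.\<close>
  define \<nu>1 :: "real measure" where "\<nu>1 = density lborel (indicator A)"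
  define \<nu>2 :: "real measure" where "\<nu>2 = density lborel (\<lambda>x. ennreal c * indicator {0..<1} x)"
  have e1: "emeasure \<nu>1 B = ennreal (measure lborel (A \<inter> B))" if "B \<in> sets borel" for B
  proof -
    have "emeasure \<nu>1 B = emeasure lborel (A \<inter> B)"
      unfolding \<nu>1_def using A that by (subst emeasure_density) (auto simp: nn_integral_indicator[symmetric] indicator_inter_arith)
    also have "\<dots> = ennreal (measure lborel (A \<inter> B))"
      using fin[of "A \<inter> B"] A that by (subst emeasure_eq_ennreal_measure) auto
    finally show ?thesis .
  qed
  have e2: "emeasure \<nu>2 B = ennreal (c * measure lborel ({0..<1} \<inter> B))" if B: "B \<in> sets borel" for B
  proof -
    have "emeasure \<nu>2 B = (\<integral>\<^sup>+x. ennreal c * indicator ({0..<1} \<inter> B) x \<partial>lborel)"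
      unfolding \<nu>2_def
    proof (subst emeasure_density)
      show "(\<lambda>x::real. ennreal c * indicator {0..<1} x) \<in> borel_measurable lborel"
        by (intro borel_measurable_times_ennreal borel_measurable_const borel_measurable_indicator) simp
    qed (use B in \<open>simp_all add: indicator_inter_arith mult.assoc\<close>)
    also have "\<dots> = ennreal c * emeasure lborel ({0..<1} \<inter> B)"
      using B by (simp add: nn_integral_cmult_indicator)
    also have "emeasure lborel ({0..<1} \<inter> B) = ennreal (measure lborel ({0..<1} \<inter> B))"
    proof -
      have "emeasure lborel ({0..<1} \<inter> B) \<le> emeasure lborel {0..<1::real}" using B by (intro emeasure_mono) auto
      also have "\<dots> < \<infinity>" by simp
      finally show ?thesis by (intro emeasure_eq_ennreal_measure) auto
    qed
    finally show ?thesis using c01 by (simp add: ennreal_mult)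
  qed
  have s: "sets \<nu>1 = sets borel" "sets \<nu>2 = sets borel" by (simp_all add: \<nu>1_def \<nu>2_def)
  have "finite_borel_measure \<nu>1" "finite_borel_measure \<nu>2"
    using e1[of UNIV] e2[of UNIV] s
    by (auto simp: finite_borel_measure_def finite_borel_measure_axioms_def \<nu>1_def \<nu>2_def intro!: finite_measureI)
  moreover have "cdf \<nu>1 = cdf \<nu>2"
  proof
    fix x :: real
    \<comment> \<open>\<open>cdf\<close> works with closed half-lines and \<open>F\<close> with
      half-open intervals; the endpoint is a null set.\<close>
    have null: "measure lborel (B \<inter> {..x}) = measure lborel (B \<inter> {..<x})" if "B \<in> sets borel" for B
      using AE_lborel_singleton[of x] that by (intro measure_eq_AE) (auto elim!: eventually_mono)
    have "measure lborel (A \<inter> {..<x}) = c * measure lborel ({0..<1} \<inter> {..<x})"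
    proof -
      consider "x \<le> 0" | "0 \<le> x" "x \<le> 1" | "1 \<le> x" by linarith
      thus ?thesis
      proof cases
        case 1
        hence "A \<inter> {..<x} = {}" "{0..<1} \<inter> {..<x} = {}" using A(2) by auto
        thus ?thesis by simp
      next
        case 2
        hence "A \<inter> {..<x} = A \<inter> {0..<x}" "{0..<1} \<inter> {..<x} = {0..<x}" using A(2) by auto
        thus ?thesis using lin[OF 2] 2 by (simp add: F_def)
      next
        case 3
        hence "A \<inter> {..<x} = A" "{0..<1} \<inter> {..<x} = {0..<1}" using A(2) by auto
        thus ?thesis by (simp add: c)
      qed
    qed
    thus "cdf \<nu>1 x = cdf \<nu>2 x"
      using c01 null[OF A(1)] null[of "{0..<1}"] by (simp add: cdf_def measure_def[of \<nu>1] measure_def[of \<nu>2] e1 e2)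
  qed
  ultimately have "\<nu>1 = \<nu>2" by (rule cdf_unique')
  hence "ennreal (measure lborel A) = ennreal (c * measure lborel A)"
    using e1[OF A(1)] e2[OF A(1)] A(2) by (simp add: Int_absorb1)
  hence "c = c * c" using c01 by (simp add: c[symmetric])
  thus ?thesis using c by auto
qed

text \<open>Ergodicity rests on arbitrarily small positive rotations coming from the ideal. They
  exist because \<psi> takes infinitely many values on it: a finite image would make \<psi> trivial
  on a nonzero integer multiple of the ideal \<open>m R\<close>.\<close>

lemma rotation_system_char_0:
  fixes R :: "'k::field set"
  assumes R: "is_subring R" and p: "CHAR('k) = 0" and \<psi>: "irrational_character R \<psi>"
  shows "measure_preserving_system R unit_lebesgue (rotation \<psi>)"
    "ergodic_along_ideals R unit_lebesgue (rotation \<psi>)"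
    "borel_measurable borel \<subseteq> (borel_measurable unit_lebesgue :: (real \<Rightarrow> complex) set)"
proof -
  have ch: "add_character R \<psi>" using \<psi> by (simp add: irrational_character_def)
  have \<psi>1: "norm (\<psi> n) = 1" if "n \<in> R" for n using ch that by (simp add: add_character_def)
  show "measure_preserving_system R unit_lebesgue (rotation \<psi>)"
    unfolding measure_preserving_system_def
    using rotation_0[OF R ch] rotation_add[OF ch _ _ R]
    by (auto simp: standard_prob_space_unit_lebesgue rotation_measurable rotation_distr)
  show "borel_measurable borel \<subseteq> (borel_measurable unit_lebesgue :: (real \<Rightarrow> complex) set)"
    by (auto simp: unit_lebesgue_def intro: measurable_restrict_space1)
  show "ergodic_along_ideals R unit_lebesgue (rotation \<psi>)"
    unfolding ergodic_along_ideals_def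
  proof (intro allI impI ballI)
    fix I A assume I: "ideal_of R I \<and> I \<noteq> {0}" and A: "A \<in> sets unit_lebesgue"
      and inv: "\<forall>n\<in>I. rotation \<psi> n -` A \<inter> space unit_lebesgue = A"
    have IR: "n \<in> R" if "n \<in> I" for n using I that by (auto simp: ideal_of_def)
    obtain m where m: "m \<in> I" "m \<noteq> 0" using I by (auto simp: ideal_of_def)
    have inf: "infinite (\<psi> ` I)"
    proof
      assume fin: "finite (\<psi> ` I)"
      \<comment> \<open>Each value on \<open>m R\<close> has order at most the size of the image;
        the factorial is a common multiple of all possible orders, so one modulus serves for every
        n. It is nonzero in the field by characteristic 0.\<close>
      define K :: nat where "K = fact (card (\<psi> ` I))"
      have K: "of_nat K \<noteq> (0 :: 'k)"
        using p by (simp add: of_nat_eq_0_iff_char_dvd K_def)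
      have "\<psi> (of_nat K * m * n) = 1" if n: "n \<in> R" for n
      proof -
        have "n * m \<in> I" using I m n unfolding ideal_of_def by blast
        hence mn: "m * n \<in> I" by (simp add: mult.commute)
        have jI: "of_nat j * (m * n) \<in> I" for j
          using I mn subring_of_nat[OF R] by (auto simp: ideal_of_def)
        have pw: "\<psi> (of_nat j * (m * n)) = \<psi> (m * n) ^ j" for j
          by (rule add_character_of_nat_mult[OF R ch IR[OF mn]])
        have "\<exists>i j. i < j \<and> j \<le> card (\<psi> ` I) \<and> \<psi> (m * n) ^ i = \<psi> (m * n) ^ j"
        proof (rule ccontr)
          assume "\<not> ?thesis"
          hence "inj_on (\<lambda>j. \<psi> (m * n) ^ j) {..card (\<psi> ` I)}"
            by (intro linorder_inj_onI) auto
          moreover have "(\<lambda>j. \<psi> (m * n) ^ j) ` {..card (\<psi> ` I)} \<subseteq> \<psi> ` I"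
            using jI by (auto simp: pw[symmetric])
          ultimately have "card {..card (\<psi> ` I)} \<le> card (\<psi> ` I)" using fin by (rule card_inj_on_le)
          thus False by simp
        qed
        then obtain i j where ij: "i < j" "j \<le> card (\<psi> ` I)" "\<psi> (m * n) ^ i = \<psi> (m * n) ^ j"
          by blast
        have "\<psi> (m * n) \<noteq> 0" using \<psi>1[OF IR[OF mn]] by auto
        moreover have "\<psi> (m * n) ^ j = \<psi> (m * n) ^ i * \<psi> (m * n) ^ (j - i)"
          using ij by (metis le_add_diff_inverse less_imp_le_nat power_add)
        ultimately have d: "\<psi> (m * n) ^ (j - i) = 1" using ij(3) by simp
        have "(j - i) dvd K" unfolding K_def using ij by (intro dvd_fact) auto
        then obtain l where "K = (j - i) * l" by blast
        hence "\<psi> (m * n) ^ K = 1" using d by (simp add: power_mult)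
        thus ?thesis using pw[of K] by (simp add: mult.assoc)
      qed
      hence "rational_character R \<psi>"
        using K m IR subring_mult[OF R subring_of_nat[OF R]]
        by (intro rational_characterI[OF R ch, of "of_nat K * m"]) auto
      thus False using \<psi> by (simp add: irrational_character_def)
    qed
    have small: "\<exists>n\<in>I. 0 < angle \<psi> n \<and> angle \<psi> n < \<epsilon>" if \<epsilon>: "\<epsilon> > 0" for \<epsilon> :: real
    proof -
      obtain N :: nat where N: "1 / \<epsilon> < real N" using reals_Archimedean2 by blast
      moreover have "0 < 1 / \<epsilon>" using \<epsilon> by simp
      ultimately have N0: "N > 0" by (metis less_trans of_nat_0_less_iff)
      have infa: "infinite (angle \<psi> ` I)"
      proof
        assume "finite (angle \<psi> ` I)"
        hence "finite ((\<lambda>x. cis (2 * pi * x)) ` angle \<psi> ` I)" by (rule finite_imageI)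
        also have "(\<lambda>x. cis (2 * pi * x)) ` angle \<psi> ` I = \<psi> ` I"
          using \<psi>1 IR by (force simp: image_iff cis_angle)
        finally show False using inf by simp
      qed
      have "finite ((\<lambda>x. \<lfloor>real N * x\<rfloor>) ` angle \<psi> ` I)"
      proof (rule finite_subset)
        show "(\<lambda>x. \<lfloor>real N * x\<rfloor>) ` angle \<psi> ` I \<subseteq> {0..int N}"
        proof safe
          fix n
          have a: "0 \<le> angle \<psi> n" "angle \<psi> n < 1" using angle_range[of \<psi> n] by auto
          have "0 \<le> real N * angle \<psi> n" "real N * angle \<psi> n \<le> real N"
            using a by (simp_all add: mult_left_le)
          thus "\<lfloor>real N * angle \<psi> n\<rfloor> \<in> {0..int N}"
            using floor_mono[of "real N * angle \<psi> n" "real N"] by simp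
        qed
      qed simp
      \<comment> \<open>Dirichlet's pigeonhole argument: infinitely many angles fall into finitely
        many boxes of length 1/N. Two angles in one box differ by less than \<epsilon>, and their
        difference, taken in increasing order, is the angle of an element of the ideal.\<close>
      hence "\<not> inj_on (\<lambda>x. \<lfloor>real N * x\<rfloor>) (angle \<psi> ` I)"
        using infa finite_imageD by blast
      then obtain u v where uv: "u \<in> angle \<psi> ` I" "v \<in> angle \<psi> ` I" "\<lfloor>real N * u\<rfloor> = \<lfloor>real N * v\<rfloor>" "u < v"
        unfolding inj_on_def by (metis linorder_neqE_linordered_idom)
      obtain a b where ab: "a \<in> I" "b \<in> I" "u = angle \<psi> a" "v = angle \<psi> b" using uv by auto
      have "real N * v - real N * u < 1" using uv(3) by linarith
      hence "v - u < 1 / real N" using N0 by (simp add: field_simps)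
      also have "1 / real N < \<epsilon>" using N \<epsilon> N0 by (simp add: field_simps)
      finally have vu: "v - u < \<epsilon>" .
      have "- 1 * a \<in> I" using I ab subring_uminus[OF R subring_1[OF R]] unfolding ideal_of_def by blast
      hence baI: "b - a \<in> I" using I ab(2) unfolding ideal_of_def by (metis add_uminus_conv_diff mult_minus1)
      have "angle \<psi> (b - a) = v - u"
      proof (rule cis_2pi_inj[OF angle_range])
        show "v - u \<in> {0..<1}" using uv(4) angle_range[of \<psi> a] angle_range[of \<psi> b] by (auto simp: ab)
        have "cis (2 * pi * (v - u)) = \<psi> b / \<psi> a"
          using \<psi>1[OF IR[OF ab(1)]] \<psi>1[OF IR[OF ab(2)]]
          by (simp add: ab right_diff_distrib cis_divide[symmetric] cis_angle)
        also have "\<dots> = \<psi> (b - a)"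
          using add_character_diff[OF R ch IR[OF ab(2)] IR[OF ab(1)]] \<psi>1[OF IR[OF ab(1)]]
          by (auto simp: divide_eq_eq)
        finally show "cis (2 * pi * angle \<psi> (b - a)) = cis (2 * pi * (v - u))"
          using \<psi>1[OF IR[OF baI]] by (simp add: cis_angle)
      qed
      thus ?thesis using baI uv(4) vu by (intro bexI[of _ "b - a"]) auto
    qed
    have "measure lborel A = 0 \<or> measure lborel A = 1"
    proof (rule zero_one_if_small_shifts)
      show "A \<in> sets borel" "A \<subseteq> {0..<1}" using A by (auto simp: sets_unit_lebesgue_iff)
      fix \<epsilon> :: real assume "\<epsilon> > 0"
      then obtain n where n: "n \<in> I" "0 < angle \<psi> n" "angle \<psi> n < \<epsilon>" using small by blast
      have "x + angle \<psi> n \<in> A \<longleftrightarrow> x \<in> A" if "0 \<le> x" "x + angle \<psi> n < 1" for x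
      proof -
        have x: "x \<in> {0..<1}" using that n by auto
        hence "rotation \<psi> n x = x + angle \<psi> n" using that by (simp add: rotation_eq)
        moreover have "rotation \<psi> n -` A \<inter> {0..<1} = A" using inv n(1) by simp
        hence "rotation \<psi> n x \<in> A \<longleftrightarrow> x \<in> A" using x by blast
        ultimately show ?thesis by simp
      qed
      thus "\<exists>d. 0 < d \<and> d < \<epsilon> \<and> (\<forall>x. 0 \<le> x \<and> x + d < 1 \<longrightarrow> (x + d \<in> A \<longleftrightarrow> x \<in> A))"
        using n by blast
    qed
    thus "measure unit_lebesgue A = 0 \<or> measure unit_lebesgue A = 1"
      using emeasure_unit_lebesgue[OF A] by (simp add: measure_def)
  qed
qed

section \<open>The converse and the equivalence\<close>

theorem good_if_ergodic_averages_converge: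
  fixes R :: "'k::field set"
  assumes R: "is_subring R" and P: "P \<in> polys_over R" and conv: "ergodic_averages_converge TYPE(real) R P"
  shows "good_for_irrational_equidistribution R P"
  unfolding good_for_irrational_equidistribution_def
proof (intro allI impI)
  fix \<psi> assume \<psi>: "irrational_character R \<psi>"
  hence ch: "add_character R \<psi>" by (simp add: irrational_character_def)
  obtain n where n: "n \<in> R" "\<psi> n \<noteq> 1"
    using rational_characterI[OF R ch subring_1[OF R]] \<psi> by (auto simp: irrational_character_def)
  show "UC_lim R (\<lambda>n. \<psi> (poly P n)) 0"
  proof (cases "CHAR('k) = 0")
    case True
    show ?thesis
      by (rule UC_lim_if_rotation_averages_converge[OF R ch n P conv rotation_system_char_0[OF R True \<psi>]])
  next
    case False
    hence "CHAR('k) > 0" by simp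
    show ?thesis
      by (rule UC_lim_if_rotation_averages_converge[OF R ch n P conv rotation_system_char_pos[OF R \<open>CHAR('k) > 0\<close> \<psi>]])
  qed
qed

text \<open>The rotations that prove the converse have points in [0,1), which is why the equivalence
  is formulated over \<open>real\<close>; the second conjunct provides the forward direction for
  systems with points in any other type.\<close>

theorem theorem4p19:
  fixes OK :: "'k::field set" and P :: "'k poly"
  assumes "global_field_integers OK"
    and "P \<in> polys_over OK"
  shows "(good_for_irrational_equidistribution OK P \<longleftrightarrow>
            ergodic_averages_converge TYPE(real) OK P) \<and>
         (good_for_irrational_equidistribution OK P \<longrightarrow>
            ergodic_averages_converge TYPE('x) OK P)"
proof -
  note R = global_field_integers_subring[OF assms(1)]
  note forward = ergodic_averages_converge_if_good[OF R assms(2)]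
  show ?thesis
    using forward[where 'x = real] forward[where 'x = 'x]
      good_if_ergodic_averages_converge[OF R(1) assms(2)] by blast
qed

end
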